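(* Let $F$ be a field with $\operatorname{char}(F)=2$ and let $n\geq 3$ be an integer. If every set $\{\varphi_1,\varphi_2,\varphi_3\}$ of three quadratic $n$-fold Pfister forms over $F$ is either separably linked or inseparably linked, then $I_q^{n+1}F=0$.
   Context: Let $F$ be a field of characteristic $2$. For $\alpha,\beta\in F$, $[\alpha,\beta]$ denotes the two-dimensional quadratic form $\alpha x^2+xy+\beta y^2$. A bilinear $m$-fold Pfister form ($m\ge 0$) is a symmetric bilinear form isometric to $\langle\langle\alpha_1,\dots,\alpha_m\rangle\rangle=\langle 1,\alpha_1\rangle\otimes\cdots\otimes\langle 1,\alpha_m\rangle$ with $\alpha_i\in F^\times$ (for $m=0$ it is $\langle 1\rangle$), where $\langle\cdot,\cdot\rangle$ denotes a diagonal bilinear form. For a symmetric bilinear form $B$ on $V$ and a quadratic form $\varphi$ on $W$, $B\otimes\varphi$ is the quadratic form on $V\otimes_F W$ determined by $(B\otimes\varphi)(v\otimes w)=B(v,v)\varphi(w)$ (with polar form $B\otimes B_\varphi$, where $B_\varphi$ is the polar form of $\varphi$). A quadratic $m$-fold Pfister form ($m\geq 1$) is a form $\langle\langle\alpha_1,\dots,\alpha_{m-1},\beta]]=\langle\langle\alpha_1,\dots,\alpha_{m-1}\rangle\rangle\otimes[1,\beta]$ with $\alpha_i\in F^\times$, $\beta\in F$. Equality of forms means isometry. $I_qF=I_q^1F$ is the group of Witt classes of nonsingular quadratic forms over $F$ under orthogonal sum, and $I_q^mF$ is its subgroup generated by the classes of scalar multiples of quadratic $m$-fold Pfister forms. A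 set $\{\varphi_1,\dots,\varphi_m\}$ of $m$ quadratic $n$-fold Pfister forms (a list of $m$ forms, repetitions allowed) is separably linked if there exist a quadratic $(n-1)$-fold Pfister form $\phi$ and bilinear $1$-fold Pfister forms $B_1,\dots,B_m$ with $\varphi_i=B_i\otimes\phi$ for all $i$. It is inseparably linked if there exist a bilinear $(n-1)$-fold Pfister form $B$ and quadratic $1$-fold Pfister forms $\phi_1,\dots,\phi_m$ with $\varphi_i=B\otimes\phi_i$ for all $i$. *)

theory Defs
  imports
    "HOL-Algebra.Generated_Groups"
    "Jordan_Normal_Form.Determinant"
begin

section \<open>Quadratic and bilinear forms over a field\<close>

text \<open>
  A form of dimension \<open>n\<close> lives on the column space \<open>F\<^sup>n = carrier_vec n\<close> and is given by an
  \<open>n \<times> n\<close> matrix.  A bilinear form is given by its Gram matrix.  A quadratic form is given by any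
  matrix \<open>Q\<close> with \<open>\<phi>(x) = x\<^sup>T Q x\<close>; \<open>Q\<close> is \<^emph>\<open>not\<close> symmetric in general, and it is determined by \<open>\<phi>\<close>
  only up to adding an alternating matrix.  All notions below depend only on the values of \<open>\<phi>\<close>,
  because forms are compared by \<open>isometric\<close>, which compares values.
\<close>

definition qeval :: "'a::field mat \<Rightarrow> 'a vec \<Rightarrow> 'a" where
  "qeval Q x = x \<bullet> (Q *\<^sub>v x)"

definition polar :: "'a::field mat \<Rightarrow> 'a mat" where
  "polar Q = Q + transpose_mat Q"

definition nonsingular :: "'a::field mat \<Rightarrow> bool" where
  "nonsingular Q \<longleftrightarrow> square_mat Q \<and> invertible_mat (polar Q)"

definition isometric :: "'a::field mat \<Rightarrow> 'a mat \<Rightarrow> bool" (infix "\<cong>\<^sub>q" 50) where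
  "Q \<cong>\<^sub>q R \<longleftrightarrow> square_mat Q \<and> square_mat R \<and> dim_row Q = dim_row R \<and>
     (\<exists>P \<in> carrier_mat (dim_row Q) (dim_row Q). invertible_mat P \<and>
        (\<forall>x \<in> carrier_vec (dim_row Q). qeval R (P *\<^sub>v x) = qeval Q x))"

definition bil_isometric :: "'a::field mat \<Rightarrow> 'a mat \<Rightarrow> bool" (infix "\<cong>\<^sub>b" 50) where
  "B \<cong>\<^sub>b C \<longleftrightarrow> square_mat B \<and> square_mat C \<and> dim_row B = dim_row C \<and>
     (\<exists>P \<in> carrier_mat (dim_row B) (dim_row B). invertible_mat P \<and>
        (\<forall>x \<in> carrier_vec (dim_row B). \<forall>y \<in> carrier_vec (dim_row B).
           (P *\<^sub>v x) \<bullet> (C *\<^sub>v (P *\<^sub>v y)) = x \<bullet> (B *\<^sub>v y)))"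

definition orth_sum :: "'a::field mat \<Rightarrow> 'a mat \<Rightarrow> 'a mat" (infixr "\<bottom>\<^sub>q" 65) where
  "Q \<bottom>\<^sub>q R = four_block_mat Q (0\<^sub>m (dim_row Q) (dim_col R)) (0\<^sub>m (dim_row R) (dim_col Q)) R"

text \<open>
  The Kronecker product, for \<open>F\<^sup>m \<otimes> F\<^sup>n\<close> identified with \<open>F\<^sup>m\<^sup>n\<close> through \<open>e\<^sub>i \<otimes> e\<^sub>j \<mapsto> e\<^bsub>i n + j\<^esub>\<close>.
  Applied to a Gram matrix \<open>B\<close> and a matrix of a quadratic form \<open>\<phi>\<close> it gives a matrix of \<open>B \<otimes> \<phi>\<close>;
  see \<open>qeval_kron_pure\<close> and \<open>polar_kron\<close>.
\<close>

definition kron :: "'a::field mat \<Rightarrow> 'a mat \<Rightarrow> 'a mat" (infixr "\<otimes>\<^sub>k" 70) where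
  "A \<otimes>\<^sub>k B = mat (dim_row A * dim_row B) (dim_col A * dim_col B)
     (\<lambda>(i, j). A $$ (i div dim_row B, j div dim_col B) * B $$ (i mod dim_row B, j mod dim_col B))"

definition kron_vec :: "'a::field vec \<Rightarrow> 'a vec \<Rightarrow> 'a vec" where
  "kron_vec v w = vec (dim_vec v * dim_vec w) (\<lambda>i. v $ (i div dim_vec w) * w $ (i mod dim_vec w))"

section \<open>Pfister forms and linkage\<close>

fun bil_pfister :: "'a::field list \<Rightarrow> 'a mat" where
  "bil_pfister [] = 1\<^sub>m 1"
| "bil_pfister (a # as) = mat_of_rows_list 2 [[1, 0], [0, a]] \<otimes>\<^sub>k bil_pfister as"

definition is_bil_pfister :: "nat \<Rightarrow> 'a::field mat \<Rightarrow> bool" where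
  "is_bil_pfister m B \<longleftrightarrow> transpose_mat B = B \<and>
     (\<exists>as. length as = m \<and> 0 \<notin> set as \<and> B \<cong>\<^sub>b bil_pfister as)"

definition binary_form :: "'a::field \<Rightarrow> 'a \<Rightarrow> 'a mat" where
  "binary_form a b = mat_of_rows_list 2 [[a, 1], [0, b]]"

text \<open>There is no quadratic \<open>0\<close>-fold Pfister form.\<close>

definition is_quad_pfister :: "nat \<Rightarrow> 'a::field mat \<Rightarrow> bool" where
  "is_quad_pfister m Q \<longleftrightarrow>
     (\<exists>as b. Suc (length as) = m \<and> 0 \<notin> set as \<and> Q \<cong>\<^sub>q bil_pfister as \<otimes>\<^sub>k binary_form 1 b)"

definition separably_linked :: "nat \<Rightarrow> 'a::field mat list \<Rightarrow> bool" where
  "separably_linked n Qs \<longleftrightarrow>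
     (\<exists>R Bs. is_quad_pfister (n - 1) R \<and> list_all (is_bil_pfister 1) Bs \<and>
        list_all2 (\<lambda>Q B. Q \<cong>\<^sub>q B \<otimes>\<^sub>k R) Qs Bs)"

definition inseparably_linked :: "nat \<Rightarrow> 'a::field mat list \<Rightarrow> bool" where
  "inseparably_linked n Qs \<longleftrightarrow>
     (\<exists>B Rs. is_bil_pfister (n - 1) B \<and> list_all (is_quad_pfister 1) Rs \<and>
        list_all2 (\<lambda>Q R. Q \<cong>\<^sub>q B \<otimes>\<^sub>k R) Qs Rs)"

section \<open>The quadratic Witt group and its filtration\<close>

text \<open>The form \<open>x\<^sub>1 y\<^sub>1 + \<dots> + x\<^sub>k y\<^sub>k\<close>, an orthogonal sum of \<open>k\<close> hyperbolic planes.\<close>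

definition hyperbolic :: "nat \<Rightarrow> 'a::field mat" where
  "hyperbolic k = four_block_mat (0\<^sub>m k k) (1\<^sub>m k) (0\<^sub>m k k) (0\<^sub>m k k)"

definition witt_rel :: "('a::field mat \<times> 'a mat) set" where
  "witt_rel = {(Q, R). nonsingular Q \<and> nonsingular R \<and>
     (\<exists>k l. Q \<bottom>\<^sub>q hyperbolic k \<cong>\<^sub>q R \<bottom>\<^sub>q hyperbolic l)}"

definition witt_class :: "'a::field mat \<Rightarrow> 'a mat set" where
  "witt_class Q = witt_rel `` {Q}"

definition witt_group :: "'a::field mat set monoid" where
  "witt_group = \<lparr>carrier = {Q. nonsingular Q} // witt_rel,
     monoid.mult = (\<lambda>X Y. \<Union>Q\<in>X. \<Union>R\<in>Y. witt_class (Q \<bottom>\<^sub>q R)),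
     monoid.one = witt_class (0\<^sub>m 0 0)\<rparr>"

definition I_q :: "nat \<Rightarrow> 'a::field mat set set" where
  "I_q m = generate witt_group {witt_class (c \<cdot>\<^sub>m Q) | c Q. c \<noteq> 0 \<and> is_quad_pfister m Q}"

section \<open>Agreement with the coordinate-free notions\<close>

lemma polar_carrier [simp]: "Q \<in> carrier_mat n n \<Longrightarrow> polar Q \<in> carrier_mat n n"
  by (simp add: polar_def)

lemma scalar_prod_mat_transpose:
  fixes Q :: "'a::field mat"
  assumes "Q \<in> carrier_mat n n" "x \<in> carrier_vec n" "y \<in> carrier_vec n"
  shows "x \<bullet> (transpose_mat Q *\<^sub>v y) = y \<bullet> (Q *\<^sub>v x)"
proof -
  have "x \<bullet> (transpose_mat Q *\<^sub>v y) = (transpose_mat Q *\<^sub>v y) \<bullet> x"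
    using assms by (intro comm_scalar_prod[of _ n]) auto
  also have "\<dots> = y \<bullet> (Q *\<^sub>v x)" using assms by (rule transpose_vec_mult_scalar)
  finally show ?thesis .
qed

lemma qeval_smult:
  assumes "Q \<in> carrier_mat n n" "x \<in> carrier_vec n"
  shows "qeval Q (c \<cdot>\<^sub>v x) = c\<^sup>2 * qeval Q x"
  using assms by (simp add: qeval_def mult_mat_vec[of _ n n] power2_eq_square)

lemma qeval_add:
  assumes Q: "Q \<in> carrier_mat n n" and x: "x \<in> carrier_vec n" and y: "y \<in> carrier_vec n"
  shows "qeval Q (x + y) = qeval Q x + qeval Q y + x \<bullet> (polar Q *\<^sub>v y)"
proof -
  have "x \<bullet> (polar Q *\<^sub>v y) = x \<bullet> (Q *\<^sub>v y) + y \<bullet> (Q *\<^sub>v x)"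
    using assms by (simp add: polar_def add_mult_distrib_mat_vec[of _ n n]
        scalar_prod_add_distrib[of _ n] scalar_prod_mat_transpose[of _ n])
  moreover have "qeval Q (x + y) = qeval Q x + qeval Q y + (x \<bullet> (Q *\<^sub>v y) + y \<bullet> (Q *\<^sub>v x))"
    using assms by (simp add: qeval_def mult_add_distrib_mat_vec[of _ n n]
        scalar_prod_add_distrib[of _ n] add_scalar_prod_distrib[of _ n])
  ultimately show ?thesis by simp
qed

lemma sum_div_mod:
  fixes f g :: "nat \<Rightarrow> 'a::comm_semiring_1"
  assumes "0 < n"
  shows "(\<Sum>i<m * n. f (i div n) * g (i mod n)) = (\<Sum>i<m. f i) * (\<Sum>j<n. g j)"
proof (induction m)
  case (Suc m)
  have "{..<Suc m * n} = {..<m * n} \<union> (\<lambda>j. m * n + j) ` {..<n}"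
  proof -
    have "x \<in> (\<lambda>j. m * n + j) ` {..<n}" if "x < n + m * n" "\<not> x < m * n" for x
      using that by (intro image_eqI[of _ _ "x - m * n"]) auto
    then show ?thesis by auto
  qed
  then have "(\<Sum>i<Suc m * n. f (i div n) * g (i mod n)) =
    (\<Sum>i<m * n. f (i div n) * g (i mod n)) +
    (\<Sum>i\<in>(\<lambda>j. m * n + j) ` {..<n}. f (i div n) * g (i mod n))"
    by (simp only:) (intro sum.union_disjoint; auto)
  also have "(\<Sum>i\<in>(\<lambda>j. m * n + j) ` {..<n}. f (i div n) * g (i mod n)) =
      (\<Sum>j<n. f m * g j)"
    using assms by (subst sum.reindex) (auto simp: inj_on_def)
  finally show ?case using Suc by (simp add: sum_distrib_left distrib_right sum.distrib)
qed simp

lemma scalar_prod_kron_vec: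
  assumes "v \<in> carrier_vec m" "v' \<in> carrier_vec m" "w \<in> carrier_vec n" "w' \<in> carrier_vec n"
  shows "kron_vec v w \<bullet> kron_vec v' w' = (v \<bullet> v') * (w \<bullet> w')"
proof (cases "n = 0")
  case True
  then show ?thesis using assms by (simp add: scalar_prod_def kron_vec_def)
next
  case False
  have "kron_vec v w \<bullet> kron_vec v' w' =
      (\<Sum>i<m * n. (v $ (i div n) * v' $ (i div n)) * (w $ (i mod n) * w' $ (i mod n)))"
    using assms by (simp add: scalar_prod_def kron_vec_def lessThan_atLeast0 mult_ac)
  also have "\<dots> = (\<Sum>i<m. v $ i * v' $ i) * (\<Sum>j<n. w $ j * w' $ j)"
    using False by (subst sum_div_mod[symmetric]) auto
  finally show ?thesis using assms by (simp add: scalar_prod_def lessThan_atLeast0)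
qed

lemma kron_mult_kron_vec:
  assumes A: "A \<in> carrier_mat m m" and B: "B \<in> carrier_mat n n"
    and v: "v \<in> carrier_vec m" and w: "w \<in> carrier_vec n"
  shows "(A \<otimes>\<^sub>k B) *\<^sub>v kron_vec v w = kron_vec (A *\<^sub>v v) (B *\<^sub>v w)"
proof (rule eq_vecI)
  fix i assume "i < dim_vec (kron_vec (A *\<^sub>v v) (B *\<^sub>v w))"
  then have i: "i < m * n" using A B by (simp add: kron_vec_def)
  then have n: "0 < n" by (cases n) auto
  have "i div n < m" "i mod n < n" using i n by (auto simp: less_mult_imp_div_less)
  moreover have "row (A \<otimes>\<^sub>k B) i = kron_vec (row A (i div n)) (row B (i mod n))"
  proof (rule eq_vecI)
    fix j assume "j < dim_vec (kron_vec (row A (i div n)) (row B (i mod n)))"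
    then have "j < m * n" using A B by (simp add: kron_vec_def)
    moreover from this have "j div n < m" "j mod n < n"
      using n by (auto simp: less_mult_imp_div_less)
    ultimately show "row (A \<otimes>\<^sub>k B) i $ j = kron_vec (row A (i div n)) (row B (i mod n)) $ j"
      using A B i \<open>i div n < m\<close> \<open>i mod n < n\<close> by (simp add: kron_def kron_vec_def)
  qed (use A B in \<open>simp add: kron_def kron_vec_def\<close>)
  ultimately show "((A \<otimes>\<^sub>k B) *\<^sub>v kron_vec v w) $ i = kron_vec (A *\<^sub>v v) (B *\<^sub>v w) $ i"
    using A B v w i scalar_prod_kron_vec[of "row A (i div n)" m v "row B (i mod n)" n w]
    by (simp add: kron_def) (simp add: kron_vec_def)
qed (use A B in \<open>simp add: kron_def kron_vec_def\<close>)

lemma qeval_kron_pure: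
  assumes "B \<in> carrier_mat m m" "Q \<in> carrier_mat n n" "v \<in> carrier_vec m" "w \<in> carrier_vec n"
  shows "qeval (B \<otimes>\<^sub>k Q) (kron_vec v w) = (v \<bullet> (B *\<^sub>v v)) * qeval Q w"
  using assms
  by (simp add: qeval_def kron_mult_kron_vec[of _ m _ n] scalar_prod_kron_vec[of _ m _ _ n])

lemma polar_kron:
  assumes B: "B \<in> carrier_mat m m" and Q: "Q \<in> carrier_mat n n" and sym: "transpose_mat B = B"
  shows "polar (B \<otimes>\<^sub>k Q) = B \<otimes>\<^sub>k polar Q"
proof (rule eq_matI)
  fix i j assume "i < dim_row (B \<otimes>\<^sub>k polar Q)" "j < dim_col (B \<otimes>\<^sub>k polar Q)"
  then have ij: "i < m * n" "j < m * n" using B Q by (auto simp: kron_def polar_def)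
  then have n: "0 < n" by (cases n) auto
  have d: "i div n < m" "j div n < m" "i mod n < n" "j mod n < n"
    using ij n by (auto simp: less_mult_imp_div_less)
  have "B $$ (j div n, i div n) = transpose_mat B $$ (i div n, j div n)"
    using B d by simp
  then have "B $$ (j div n, i div n) = B $$ (i div n, j div n)" by (simp add: sym)
  then show "polar (B \<otimes>\<^sub>k Q) $$ (i, j) = (B \<otimes>\<^sub>k polar Q) $$ (i, j)"
    using B Q ij d by (simp add: kron_def polar_def distrib_left)
qed (use B Q in \<open>auto simp: kron_def polar_def\<close>)

lemma qeval_binary_form:
  "qeval (binary_form a b) (vec_of_list [x, y]) = a * x\<^sup>2 + x * y + b * y\<^sup>2"
  by (simp add: qeval_def binary_form_def scalar_prod_def mat_of_rows_list_def
      vec_of_list_index numeral_2_eq_2 power2_eq_square algebra_simps)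

section \<open>Witt equivalence is a congruence and Witt classes form a group\<close>

lemma left_inverse_by_vec:
  fixes A B :: "'a::field mat"
  assumes A: "A \<in> carrier_mat n n" and B: "B \<in> carrier_mat n n"
    and eq: "\<And>x. x \<in> carrier_vec n \<Longrightarrow> B *\<^sub>v (A *\<^sub>v x) = x"
  shows "B * A = 1\<^sub>m n"
proof (rule eq_matI)
  fix i j assume ij: "i < dim_row (1\<^sub>m n :: 'a mat)" "j < dim_col (1\<^sub>m n :: 'a mat)"
  have "A *\<^sub>v unit_vec n j = col A j"
    using A ij by (intro eq_vecI) (auto simp: scalar_prod_right_unit)
  moreover have "col (B * A) j = B *\<^sub>v col A j"
    using A B ij by (intro eq_vecI) auto
  moreover have "B *\<^sub>v (A *\<^sub>v unit_vec n j) = unit_vec n j" by (rule eq) simp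
  ultimately have "col (B * A) j $ i = unit_vec n j $ i" by simp
  then show "(B * A) $$ (i, j) = 1\<^sub>m n $$ (i, j)" using A B ij by (auto simp: unit_vec_def)
qed (use A B in auto)

lemma isometricI:
  fixes Q :: "'a::field mat"
  assumes "Q \<in> carrier_mat n n" "R \<in> carrier_mat n n" "P \<in> carrier_mat n n" "S \<in> carrier_mat n n"
    and "\<And>x. x \<in> carrier_vec n \<Longrightarrow> S *\<^sub>v (P *\<^sub>v x) = x"
    and "\<And>x. x \<in> carrier_vec n \<Longrightarrow> qeval R (P *\<^sub>v x) = qeval Q x"
  shows "Q \<cong>\<^sub>q R"
proof -
  have SP: "S * P = 1\<^sub>m n" using left_inverse_by_vec[OF assms(3,4,5)] by simp
  have "P * S = 1\<^sub>m n" using mat_mult_left_right_inverse[OF assms(4,3) SP] .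
  with SP have "invertible_mat P"
    using assms(3,4) unfolding invertible_mat_def inverts_mat_def by auto
  then have "\<exists>P\<in>carrier_mat n n. invertible_mat P \<and> (\<forall>x\<in>carrier_vec n. qeval R (P *\<^sub>v x) = qeval Q x)"
    using assms(3,6) by blast
  then show ?thesis using assms(1,2) by (simp add: isometric_def)
qed

lemma isometricE:
  fixes Q :: "'a::field mat"
  assumes "Q \<cong>\<^sub>q R"
  obtains n P S where "Q \<in> carrier_mat n n" "R \<in> carrier_mat n n"
    "P \<in> carrier_mat n n" "S \<in> carrier_mat n n"
    "\<forall>x\<in>carrier_vec n. S *\<^sub>v (P *\<^sub>v x) = x"
    "\<forall>x\<in>carrier_vec n. P *\<^sub>v (S *\<^sub>v x) = x"
    "\<forall>x\<in>carrier_vec n. qeval R (P *\<^sub>v x) = qeval Q x"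
proof -
  define n where "n = dim_row Q"
  from assms obtain P where P: "P \<in> carrier_mat n n" "invertible_mat P"
    "\<forall>x\<in>carrier_vec n. qeval R (P *\<^sub>v x) = qeval Q x"
    unfolding isometric_def n_def by blast
  have QR: "Q \<in> carrier_mat n n" "R \<in> carrier_mat n n"
    using assms by (auto simp: isometric_def n_def)
  from P obtain S where S: "P * S = 1\<^sub>m n" "S * P = 1\<^sub>m (dim_row S)"
    unfolding invertible_mat_def inverts_mat_def by auto
  have "dim_row S = n" using arg_cong[OF S(2), of dim_col] P by simp
  moreover have "dim_col S = n" using arg_cong[OF S(1), of dim_col] P by simp
  ultimately have Sc: "S \<in> carrier_mat n n" by auto
  have SP: "S *\<^sub>v (P *\<^sub>v x) = x" and PS: "P *\<^sub>v (S *\<^sub>v x) = x" if "x \<in> carrier_vec n" for x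
    using S \<open>dim_row S = n\<close> that assoc_mult_mat_vec[OF Sc P(1) that] assoc_mult_mat_vec[OF P(1) Sc that]
    by simp_all
  show ?thesis by (rule that[OF QR P(1) Sc]) (use SP PS P(3) in blast)+
qed

lemma isometric_refl: "Q \<in> carrier_mat n n \<Longrightarrow> Q \<cong>\<^sub>q Q"
  by (rule isometricI[of _ n _ "1\<^sub>m n" "1\<^sub>m n"]) auto

lemma isometric_sym: assumes "Q \<cong>\<^sub>q R" shows "R \<cong>\<^sub>q Q"
proof -
  from assms obtain n P S where *: "Q \<in> carrier_mat n n" "R \<in> carrier_mat n n"
    "P \<in> carrier_mat n n" "S \<in> carrier_mat n n"
    "\<forall>x\<in>carrier_vec n. S *\<^sub>v (P *\<^sub>v x) = x"
    "\<forall>x\<in>carrier_vec n. P *\<^sub>v (S *\<^sub>v x) = x"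
    "\<forall>x\<in>carrier_vec n. qeval R (P *\<^sub>v x) = qeval Q x" by (elim isometricE) blast 
  show ?thesis
  proof (rule isometricI[of _ n _ S P])
    fix x :: "'a vec" assume x: "x \<in> carrier_vec n"
    then have "S *\<^sub>v x \<in> carrier_vec n" using * by auto
    from bspec[OF *(7) this] show "qeval Q (S *\<^sub>v x) = qeval R x" using bspec[OF *(6) x] by simp
  qed (use * in auto)
qed

lemma isometric_trans [trans]:
  fixes Q :: "'a::field mat" assumes "Q \<cong>\<^sub>q R" "R \<cong>\<^sub>q T" shows "Q \<cong>\<^sub>q T"
proof -
  from assms(1) obtain n P S where *: "Q \<in> carrier_mat n n" "R \<in> carrier_mat n n"
    "P \<in> carrier_mat n n" "S \<in> carrier_mat n n"
    "\<forall>x\<in>carrier_vec n. S *\<^sub>v (P *\<^sub>v x) = x"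
    "\<forall>x\<in>carrier_vec n. P *\<^sub>v (S *\<^sub>v x) = x"
    "\<forall>x\<in>carrier_vec n. qeval R (P *\<^sub>v x) = qeval Q x" by (elim isometricE) blast
  from assms(2) obtain m P' S' where m: "R \<in> carrier_mat m m" "T \<in> carrier_mat m m"
    "P' \<in> carrier_mat m m" "S' \<in> carrier_mat m m"
    "\<forall>x\<in>carrier_vec m. S' *\<^sub>v (P' *\<^sub>v x) = x"
    "\<forall>x\<in>carrier_vec m. P' *\<^sub>v (S' *\<^sub>v x) = x"
    "\<forall>x\<in>carrier_vec m. qeval T (P' *\<^sub>v x) = qeval R x" by (elim isometricE) blast
  have [simp]: "m = n" using * m by auto
  show ?thesis
  proof (rule isometricI[of _ n _ "P' * P" "S * S'"])
    fix x :: "'a vec" assume x: "x \<in> carrier_vec n"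
    then have Px: "P *\<^sub>v x \<in> carrier_vec n" using * by auto
    have e: "(P' * P) *\<^sub>v x = P' *\<^sub>v (P *\<^sub>v x)" using * m x by auto
    show "qeval T ((P' * P) *\<^sub>v x) = qeval Q x" using bspec[OF m(7)] bspec[OF *(7) x] Px e by simp
    have "P' *\<^sub>v (P *\<^sub>v x) \<in> carrier_vec n" using Px m by auto
    then have "(S * S') *\<^sub>v ((P' * P) *\<^sub>v x) = S *\<^sub>v (S' *\<^sub>v (P' *\<^sub>v (P *\<^sub>v x)))"
      using * m e by (simp add: assoc_mult_mat_vec[of _ n n _ n])
    then show "(S * S') *\<^sub>v ((P' * P) *\<^sub>v x) = x" using bspec[OF m(5)] bspec[OF *(5) x] Px by simp
  qed (use * m in auto)
qed

lemma orth_sum_carrier [simp]: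
  "Q \<in> carrier_mat n n \<Longrightarrow> R \<in> carrier_mat m m \<Longrightarrow> Q \<bottom>\<^sub>q R \<in> carrier_mat (n + m) (n + m)"
  by (auto simp: orth_sum_def)

lemma append_cases:
  fixes x :: "'a::field vec"
  assumes "x \<in> carrier_vec (n + m)"
  obtains y z where "y \<in> carrier_vec n" "z \<in> carrier_vec m" "x = y @\<^sub>v z"
  using vec_first_last_append[OF assms] by (metis vec_first_carrier vec_last_carrier)

lemma qeval_orth_sum:
  fixes Q :: "'a::field mat"
  assumes "Q \<in> carrier_mat n n" "R \<in> carrier_mat m m" "x \<in> carrier_vec n" "y \<in> carrier_vec m"
  shows "qeval (Q \<bottom>\<^sub>q R) (x @\<^sub>v y) = qeval Q x + qeval R y"
proof -
  have "(Q \<bottom>\<^sub>q R) *\<^sub>v (x @\<^sub>v y) = (Q *\<^sub>v x + 0\<^sub>m n m *\<^sub>v y) @\<^sub>v (0\<^sub>m m n *\<^sub>v x + R *\<^sub>v y)"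
    unfolding orth_sum_def using assms by (subst four_block_mat_mult_vec[of _ n n _ m _ m]) auto
  also have "\<dots> = (Q *\<^sub>v x) @\<^sub>v (R *\<^sub>v y)" using assms by auto
  finally show ?thesis using assms by (simp add: qeval_def scalar_prod_append[of _ n _ m])
qed

lemma orth_sum_cong:
  fixes Q :: "'a::field mat"
  assumes "Q \<cong>\<^sub>q Q'" "R \<cong>\<^sub>q R'"
  shows "Q \<bottom>\<^sub>q R \<cong>\<^sub>q Q' \<bottom>\<^sub>q R'"
proof -
  from assms(1) obtain n P S where *: "Q \<in> carrier_mat n n" "Q' \<in> carrier_mat n n"
    "P \<in> carrier_mat n n" "S \<in> carrier_mat n n"
    "\<forall>x\<in>carrier_vec n. S *\<^sub>v (P *\<^sub>v x) = x"
    "\<forall>x\<in>carrier_vec n. qeval Q' (P *\<^sub>v x) = qeval Q x" by (elim isometricE) blast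
  from assms(2) obtain m P' S' where m: "R \<in> carrier_mat m m" "R' \<in> carrier_mat m m"
    "P' \<in> carrier_mat m m" "S' \<in> carrier_mat m m"
    "\<forall>x\<in>carrier_vec m. S' *\<^sub>v (P' *\<^sub>v x) = x"
    "\<forall>x\<in>carrier_vec m. qeval R' (P' *\<^sub>v x) = qeval R x" by (elim isometricE) blast
  have mv: "four_block_mat A (0\<^sub>m n m) (0\<^sub>m m n) B *\<^sub>v (x @\<^sub>v y) = (A *\<^sub>v x) @\<^sub>v (B *\<^sub>v y)"
    if "A \<in> carrier_mat n n" "B \<in> carrier_mat m m" "x \<in> carrier_vec n" "y \<in> carrier_vec m"
    for A B :: "'a mat" and x y
    using that by (subst four_block_mat_mult_vec[of _ n n _ m _ m]) auto
  show ?thesis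
  proof (rule isometricI[of _ "n + m" _ "four_block_mat P (0\<^sub>m n m) (0\<^sub>m m n) P'"
        "four_block_mat S (0\<^sub>m n m) (0\<^sub>m m n) S'"])
    fix x :: "'a vec" assume "x \<in> carrier_vec (n + m)"
    then obtain y z where yz: "y \<in> carrier_vec n" "z \<in> carrier_vec m" "x = y @\<^sub>v z"
      by (rule append_cases)
    then have c: "P *\<^sub>v y \<in> carrier_vec n" "P' *\<^sub>v z \<in> carrier_vec m" using * m by auto
    show "four_block_mat S (0\<^sub>m n m) (0\<^sub>m m n) S' *\<^sub>v
        (four_block_mat P (0\<^sub>m n m) (0\<^sub>m m n) P' *\<^sub>v x) = x"
      using yz c * m by (simp add: mv)
    show "qeval (Q' \<bottom>\<^sub>q R') (four_block_mat P (0\<^sub>m n m) (0\<^sub>m m n) P' *\<^sub>v x) = qeval (Q \<bottom>\<^sub>q R) x"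
      using yz c * m by (simp add: mv qeval_orth_sum[of _ n _ m])
  qed (use * m in auto)
qed

lemma orth_sum_comm:
  fixes Q :: "'a::field mat"
  assumes Q: "Q \<in> carrier_mat n n" and R: "R \<in> carrier_mat m m"
  shows "Q \<bottom>\<^sub>q R \<cong>\<^sub>q R \<bottom>\<^sub>q Q"
proof -
  have mv: "four_block_mat (0\<^sub>m m n) (1\<^sub>m m) (1\<^sub>m n) (0\<^sub>m n m) *\<^sub>v (x @\<^sub>v y) = y @\<^sub>v x"
    if "x \<in> carrier_vec n" "y \<in> carrier_vec m" for x y :: "'a vec" and n m
    using that by (subst four_block_mat_mult_vec[of _ m n _ m _ n]) auto
  show ?thesis
  proof (rule isometricI[of _ "n + m" _ "four_block_mat (0\<^sub>m m n) (1\<^sub>m m) (1\<^sub>m n) (0\<^sub>m n m)"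
        "four_block_mat (0\<^sub>m n m) (1\<^sub>m n) (1\<^sub>m m) (0\<^sub>m m n)"])
    show "R \<bottom>\<^sub>q Q \<in> carrier_mat (n + m) (n + m)" using orth_sum_carrier[OF R Q] by (simp add: add.commute)
    show "four_block_mat (0\<^sub>m m n) (1\<^sub>m m) (1\<^sub>m n) (0\<^sub>m n m) \<in> carrier_mat (n + m) (n + m)"
      by (rule carrier_matI) auto
    show "four_block_mat (0\<^sub>m n m) (1\<^sub>m n) (1\<^sub>m m) (0\<^sub>m m n) \<in> carrier_mat (n + m) (n + m)"
      by (rule carrier_matI) auto
    fix x :: "'a vec" assume "x \<in> carrier_vec (n + m)"
    then obtain y z where yz: "y \<in> carrier_vec n" "z \<in> carrier_vec m" "x = y @\<^sub>v z"
      by (rule append_cases)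
    show "four_block_mat (0\<^sub>m n m) (1\<^sub>m n) (1\<^sub>m m) (0\<^sub>m m n) *\<^sub>v
        (four_block_mat (0\<^sub>m m n) (1\<^sub>m m) (1\<^sub>m n) (0\<^sub>m n m) *\<^sub>v x) = x"
      using yz by (simp add: mv)
    show "qeval (R \<bottom>\<^sub>q Q) (four_block_mat (0\<^sub>m m n) (1\<^sub>m m) (1\<^sub>m n) (0\<^sub>m n m) *\<^sub>v x) = qeval (Q \<bottom>\<^sub>q R) x"
      using yz Q R by (simp add: mv qeval_orth_sum[of _ n _ m] qeval_orth_sum[of _ m _ n])
  qed (use Q R in auto)
qed

lemma orth_sum_assoc:
  assumes "Q \<in> carrier_mat n n" "R \<in> carrier_mat m m" "S \<in> carrier_mat k k"
  shows "(Q \<bottom>\<^sub>q R) \<bottom>\<^sub>q S = Q \<bottom>\<^sub>q (R \<bottom>\<^sub>q S)"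
  using assms by (intro eq_matI) (auto simp: orth_sum_def)

lemma orth_sum_zero_left: "Q \<in> carrier_mat n n \<Longrightarrow> 0\<^sub>m 0 0 \<bottom>\<^sub>q Q = Q"
  by (intro eq_matI) (auto simp: orth_sum_def)

lemma hyperbolic_carrier [simp]: "hyperbolic k \<in> carrier_mat (k + k) (k + k)"
  by (auto simp: hyperbolic_def)

lemma qeval_hyperbolic:
  fixes x :: "'a::field vec"
  assumes "x \<in> carrier_vec k" "y \<in> carrier_vec k"
  shows "qeval (hyperbolic k) (x @\<^sub>v y) = x \<bullet> y"
proof -
  have "hyperbolic k *\<^sub>v (x @\<^sub>v y) = y @\<^sub>v 0\<^sub>v k"
    unfolding hyperbolic_def using assms by (subst four_block_mat_mult_vec[of _ k k _ k _ k]) auto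
  then show ?thesis using assms by (simp add: qeval_def scalar_prod_append[of _ k _ k])
qed

lemma hyperbolic_add:
  "(hyperbolic k :: 'a::field mat) \<bottom>\<^sub>q hyperbolic l \<cong>\<^sub>q hyperbolic (k + l)"
proof -
  define P :: "nat \<Rightarrow> nat \<Rightarrow> nat \<Rightarrow> nat \<Rightarrow> 'a mat" where
    "P a b c d = four_block_mat
      (four_block_mat (1\<^sub>m a) (0\<^sub>m a b) (0\<^sub>m c a) (0\<^sub>m c b))
      (four_block_mat (0\<^sub>m a c) (0\<^sub>m a d) (1\<^sub>m c) (0\<^sub>m c d))
      (four_block_mat (0\<^sub>m b a) (1\<^sub>m b) (0\<^sub>m d a) (0\<^sub>m d b))
      (four_block_mat (0\<^sub>m b c) (0\<^sub>m b d) (0\<^sub>m d c) (1\<^sub>m d))" for a b c d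
  have z: "0\<^sub>m i j *\<^sub>v x = 0\<^sub>v i" if "x \<in> carrier_vec j" for i j and x :: "'a vec"
    using that by (intro eq_vecI) auto
  have mv: "P a b c d *\<^sub>v ((x @\<^sub>v y) @\<^sub>v (z @\<^sub>v w)) = (x @\<^sub>v z) @\<^sub>v (y @\<^sub>v w)"
    if "x \<in> carrier_vec a" "y \<in> carrier_vec b" "z \<in> carrier_vec c" "w \<in> carrier_vec d"
    for a b c d x y z w
  proof -
    have "P a b c d *\<^sub>v ((x @\<^sub>v y) @\<^sub>v (z @\<^sub>v w)) =
      ((x @\<^sub>v 0\<^sub>v c) + (0\<^sub>v a @\<^sub>v z)) @\<^sub>v ((y @\<^sub>v 0\<^sub>v d) + (0\<^sub>v b @\<^sub>v w))"
      unfolding P_def using that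
      by (subst four_block_mat_mult_vec[of _ "a + c" "a + b" _ "c + d" _ "b + d"])
         (simp_all add: z four_block_mat_mult_vec[of _ a a _ b _ c] four_block_mat_mult_vec[of _ a c _ d _ c]
           four_block_mat_mult_vec[of _ b a _ b _ d] four_block_mat_mult_vec[of _ b c _ d _ d])
    then show ?thesis
      using that by (simp add: append_vec_add[of _ a _ _ c] append_vec_add[of _ b _ _ d])
  qed
  have Pc: "P a b c d \<in> carrier_mat ((a + c) + (b + d)) ((a + b) + (c + d))" for a b c d
    unfolding P_def by (intro four_block_carrier_mat) auto
  have e: "(k + l) + (k + l) = (k + k) + (l + l)" by simp
  show ?thesis
  proof (rule isometricI[of _ "(k + k) + (l + l)" _ "P k k l l" "P k l k l"])
    show "hyperbolic (k + l) \<in> carrier_mat ((k + k) + (l + l)) ((k + k) + (l + l))"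
      using hyperbolic_carrier[of "k + l"] unfolding e .
    show "P k k l l \<in> carrier_mat ((k + k) + (l + l)) ((k + k) + (l + l))"
      using Pc[of k k l l] unfolding e .
    show "P k l k l \<in> carrier_mat ((k + k) + (l + l)) ((k + k) + (l + l))"
      using Pc[of k l k l] unfolding e .
    fix x :: "'a vec" assume "x \<in> carrier_vec ((k + k) + (l + l))"
    then obtain u v where uv: "u \<in> carrier_vec (k + k)" "v \<in> carrier_vec (l + l)" "x = u @\<^sub>v v"
      by (rule append_cases)
    from uv(1) obtain y z where yz: "y \<in> carrier_vec k" "z \<in> carrier_vec k" "u = y @\<^sub>v z"
      by (rule append_cases)
    from uv(2) obtain y' z' where yz': "y' \<in> carrier_vec l" "z' \<in> carrier_vec l" "v = y' @\<^sub>v z'"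
      by (rule append_cases)
    show "P k l k l *\<^sub>v (P k k l l *\<^sub>v x) = x" using uv yz yz' by (simp add: mv)
    show "qeval (hyperbolic (k + l)) (P k k l l *\<^sub>v x) = qeval (hyperbolic k \<bottom>\<^sub>q hyperbolic l) x"
      using uv yz yz' by (simp add: mv qeval_orth_sum[of _ "k + k" _ "l + l"] qeval_hyperbolic
          scalar_prod_append[of _ k _ l])
  qed auto
qed

lemma nonsingularE:
  fixes Q :: "'a::field mat"
  assumes "nonsingular Q"
  obtains n B where "Q \<in> carrier_mat n n" "B \<in> carrier_mat n n"
    "polar Q * B = 1\<^sub>m n" "B * polar Q = 1\<^sub>m n"
proof -
  define n where "n = dim_row Q"
  have Q: "Q \<in> carrier_mat n n" using assms by (auto simp: nonsingular_def n_def)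
  then have pQ: "polar Q \<in> carrier_mat n n" by simp
  from assms obtain B where B: "polar Q * B = 1\<^sub>m n" "B * polar Q = 1\<^sub>m (dim_row B)"
    using pQ unfolding nonsingular_def invertible_mat_def inverts_mat_def by auto
  have "dim_row B = n" using arg_cong[OF B(2), of dim_col] pQ by simp
  moreover have "dim_col B = n" using arg_cong[OF B(1), of dim_col] pQ by simp
  ultimately show ?thesis using that[of n B] Q B by auto
qed

lemma nonsingularI:
  assumes "Q \<in> carrier_mat n n" "B \<in> carrier_mat n n" "polar Q * B = 1\<^sub>m n"
  shows "nonsingular Q"
proof -
  have "B * polar Q = 1\<^sub>m n" using assms by (intro mat_mult_left_right_inverse[of "polar Q"]) auto
  moreover have "dim_row (polar Q) = n" "dim_col (polar Q) = n" "dim_row B = n" "dim_row Q = n" "dim_col Q = n"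
    using carrier_matD[OF polar_carrier[OF assms(1)]] assms(1,2) by auto
  ultimately show ?thesis using assms(3)
    unfolding nonsingular_def invertible_mat_def inverts_mat_def by auto
qed

lemma nonsingular_orth_sum:
  fixes Q :: "'a::field mat"
  assumes "nonsingular Q" "nonsingular R"
  shows "nonsingular (Q \<bottom>\<^sub>q R)"
proof -
  from assms(1) obtain n B where n: "Q \<in> carrier_mat n n" "B \<in> carrier_mat n n"
    "polar Q * B = 1\<^sub>m n" by (elim nonsingularE)
  from assms(2) obtain m C where m: "R \<in> carrier_mat m m" "C \<in> carrier_mat m m"
    "polar R * C = 1\<^sub>m m" by (elim nonsingularE)
  have p: "polar (Q \<bottom>\<^sub>q R) = four_block_mat (polar Q) (0\<^sub>m n m) (0\<^sub>m m n) (polar R)"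
    using n m by (intro eq_matI) (auto simp: polar_def orth_sum_def)
  show ?thesis
  proof (rule nonsingularI[of _ "n + m" "four_block_mat B (0\<^sub>m n m) (0\<^sub>m m n) C"])
    have "polar Q \<in> carrier_mat n n" "polar R \<in> carrier_mat m m" using n m by auto
    then show "polar (Q \<bottom>\<^sub>q R) * four_block_mat B (0\<^sub>m n m) (0\<^sub>m m n) C = 1\<^sub>m (n + m)"
      unfolding p using n m by (subst mult_four_block_mat[of _ n n _ m _ m _ _ n _ m])
         (auto simp: right_mult_zero_mat[of _ n n] right_mult_zero_mat[of _ m m])
  qed (use n m in auto)
qed

lemma nonsingular_zero: "nonsingular (0\<^sub>m 0 0 :: 'a::field mat)"
  by (rule nonsingularI[of _ 0 "0\<^sub>m 0 0"]) (auto simp: polar_def)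

lemma nonsingular_uminus:
  fixes Q :: "'a::field mat"
  assumes "nonsingular Q" shows "nonsingular (- Q)"
proof -
  from assms obtain n B where n: "Q \<in> carrier_mat n n" "B \<in> carrier_mat n n"
    "polar Q * B = 1\<^sub>m n" by (elim nonsingularE)
  have "polar (- Q) = - polar Q" using n by (intro eq_matI) (auto simp: polar_def)
  then have "polar (- Q) * (- B) = 1\<^sub>m n"
    using n carrier_matD[OF polar_carrier[OF n(1)]]
    by (simp add: uminus_mult_left_mat uminus_mult_right_mat)
  then show ?thesis using n by (intro nonsingularI[of _ n "- B"]) auto
qed

lemma orth_sum_uminus_hyperbolic:
  fixes Q :: "'a::field mat"
  assumes ns: "nonsingular Q" and Q: "Q \<in> carrier_mat n n"
  shows "Q \<bottom>\<^sub>q (- Q) \<cong>\<^sub>q hyperbolic n"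
proof -
  from ns Q obtain C where C: "C \<in> carrier_mat n n" "C * polar Q = 1\<^sub>m n"
    by (elim nonsingularE) auto
  let ?B = "polar Q"
  have B: "?B \<in> carrier_mat n n" using Q by simp
  define P where "P = four_block_mat (1\<^sub>m n) (- 1\<^sub>m n) Q (?B - Q)"
  define S where "S = four_block_mat (1\<^sub>m n - C * Q) C (- (C * Q)) C"
  have P: "P *\<^sub>v (x @\<^sub>v y) = (x - y) @\<^sub>v (Q *\<^sub>v (x - y) + ?B *\<^sub>v y)"
    if "x \<in> carrier_vec n" "y \<in> carrier_vec n" for x y
  proof -
    have "P *\<^sub>v (x @\<^sub>v y) = (1\<^sub>m n *\<^sub>v x + (- 1\<^sub>m n) *\<^sub>v y) @\<^sub>v (Q *\<^sub>v x + (?B - Q) *\<^sub>v y)"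
      unfolding P_def by (intro four_block_mat_mult_vec) (use that Q B in auto)
    moreover have "1\<^sub>m n *\<^sub>v x + (- 1\<^sub>m n) *\<^sub>v y = x - y"
      using that by (intro eq_vecI) auto
    moreover have "Q *\<^sub>v x + (?B - Q) *\<^sub>v y = Q *\<^sub>v (x - y) + ?B *\<^sub>v y"
    proof -
      have c: "Q *\<^sub>v x \<in> carrier_vec n" "Q *\<^sub>v y \<in> carrier_vec n" "?B *\<^sub>v y \<in> carrier_vec n"
        using that by (auto intro!: mult_mat_vec_carrier[OF Q] mult_mat_vec_carrier[OF B])
      have "(?B - Q) *\<^sub>v y = ?B *\<^sub>v y - Q *\<^sub>v y" using that Q B by (intro minus_mult_distrib_mat_vec) auto
      moreover have "Q *\<^sub>v (x - y) = Q *\<^sub>v x - Q *\<^sub>v y" using that Q by (intro mult_minus_distrib_mat_vec) auto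
      moreover have "u + (w - v) = u - v + w"
        if "u \<in> carrier_vec n" "v \<in> carrier_vec n" "w \<in> carrier_vec n" for u v w :: "'a vec"
        using that by (intro eq_vecI) auto
      ultimately show ?thesis using c by simp
    qed
    ultimately show ?thesis by simp
  qed
  have S: "S *\<^sub>v (u @\<^sub>v z) = (u + C *\<^sub>v (z - Q *\<^sub>v u)) @\<^sub>v (C *\<^sub>v (z - Q *\<^sub>v u))"
    if "u \<in> carrier_vec n" "z \<in> carrier_vec n" for u z
  proof -
    have "S *\<^sub>v (u @\<^sub>v z) = ((1\<^sub>m n - C * Q) *\<^sub>v u + C *\<^sub>v z) @\<^sub>v ((- (C * Q)) *\<^sub>v u + C *\<^sub>v z)"
      unfolding S_def using that C Q by (intro four_block_mat_mult_vec) auto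
    moreover have c: "C *\<^sub>v z \<in> carrier_vec n" "C *\<^sub>v (Q *\<^sub>v u) \<in> carrier_vec n" using C Q that by auto
    moreover have "C *\<^sub>v (z - Q *\<^sub>v u) = C *\<^sub>v z - C *\<^sub>v (Q *\<^sub>v u)"
      using that C Q by (intro mult_minus_distrib_mat_vec) auto
    moreover have "(- (C * Q)) *\<^sub>v u = - (C *\<^sub>v (Q *\<^sub>v u))"
      using that C Q by simp
    moreover have "(1\<^sub>m n - C * Q) *\<^sub>v u = u - C *\<^sub>v (Q *\<^sub>v u)"
      using that C Q by (simp add: minus_mult_distrib_mat_vec[of _ n n])
    moreover have "a - b + c = a + (c - b)" "- b + c = c - b"
      if "a \<in> carrier_vec n" "b \<in> carrier_vec n" "c \<in> carrier_vec n" for a b c :: "'a vec"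
      by (intro eq_vecI; use that in simp)+
    ultimately show ?thesis using that by simp
  qed
  show ?thesis
  proof (rule isometricI[of _ "n + n" _ P S])
    fix x :: "'a vec" assume "x \<in> carrier_vec (n + n)"
    then obtain y z where yz: "y \<in> carrier_vec n" "z \<in> carrier_vec n" "x = y @\<^sub>v z"
      by (rule append_cases)
    have c: "y - z \<in> carrier_vec n" "Q *\<^sub>v (y - z) \<in> carrier_vec n" "?B *\<^sub>v z \<in> carrier_vec n"
      using yz by (auto intro!: mult_mat_vec_carrier[OF Q] mult_mat_vec_carrier[OF B])
    have e: "Q *\<^sub>v (y - z) + ?B *\<^sub>v z - Q *\<^sub>v (y - z) = ?B *\<^sub>v z"
    proof -
      have "u + w - u = w" if "u \<in> carrier_vec n" "w \<in> carrier_vec n" for u w :: "'a vec"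
        using that by (intro eq_vecI) auto
      then show ?thesis using c by simp
    qed
    have "C *\<^sub>v (?B *\<^sub>v z) = z"
      using C B yz by (subst assoc_mult_mat_vec[symmetric, of _ n n _ n]) auto
    moreover have yy: "y - z + z = y" using yz by (intro eq_vecI) auto
    ultimately show "S *\<^sub>v (P *\<^sub>v x) = x" using yz c e by (simp add: P S)
    have m: "qeval (- Q) z = - qeval Q z"
      using Q yz by (simp add: qeval_def)
    have "qeval Q y = qeval Q (y - z) + qeval Q z + (y - z) \<bullet> (?B *\<^sub>v z)"
      using qeval_add[OF Q c(1) yz(2)] yy by simp
    then show "qeval (hyperbolic n) (P *\<^sub>v x) = qeval (Q \<bottom>\<^sub>q (- Q)) x"
      using yz c Q m by (simp add: P qeval_hyperbolic qeval_orth_sum[of _ n _ n]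
          scalar_prod_add_distrib[of _ n]) (simp add: qeval_def)
  qed (use Q B C in \<open>auto simp: P_def S_def\<close>)
qed

lemma nonsingular_carrier: "nonsingular Q \<Longrightarrow> Q \<in> carrier_mat (dim_row Q) (dim_row Q)"
  by (auto simp: nonsingular_def)

lemma equiv_witt_rel: "equiv {Q :: 'a::field mat. nonsingular Q} witt_rel"
proof (rule equivI)
  show "refl_on {Q :: 'a mat. nonsingular Q} witt_rel"
    unfolding refl_on_def witt_rel_def
    using isometric_refl[OF orth_sum_carrier[OF nonsingular_carrier hyperbolic_carrier]] by blast
  show "(witt_rel :: ('a mat \<times> 'a mat) set) \<subseteq> {Q. nonsingular Q} \<times> {Q. nonsingular Q}"
    by (auto simp: witt_rel_def)
  show "sym (witt_rel :: ('a mat \<times> 'a mat) set)"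
    unfolding sym_def witt_rel_def using isometric_sym by blast
  show "trans (witt_rel :: ('a mat \<times> 'a mat) set)"
  proof (rule transI)
    fix Q R T :: "'a mat" assume a: "(Q, R) \<in> witt_rel" "(R, T) \<in> witt_rel"
    then obtain k l i j where kl: "Q \<bottom>\<^sub>q hyperbolic k \<cong>\<^sub>q R \<bottom>\<^sub>q hyperbolic l"
      and ij: "R \<bottom>\<^sub>q hyperbolic i \<cong>\<^sub>q T \<bottom>\<^sub>q hyperbolic j"
      by (auto simp: witt_rel_def)
    have ns: "nonsingular Q" "nonsingular R" "nonsingular T" using a by (auto simp: witt_rel_def)
    note c = ns[THEN nonsingular_carrier]
    note h = hyperbolic_carrier[THEN isometric_refl]
    have "Q \<bottom>\<^sub>q hyperbolic (k + i) \<cong>\<^sub>q Q \<bottom>\<^sub>q (hyperbolic k \<bottom>\<^sub>q hyperbolic i)"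
      by (intro orth_sum_cong isometric_refl[OF c(1)] isometric_sym[OF hyperbolic_add])
    also have "Q \<bottom>\<^sub>q (hyperbolic k \<bottom>\<^sub>q hyperbolic i) = (Q \<bottom>\<^sub>q hyperbolic k) \<bottom>\<^sub>q hyperbolic i"
      by (rule orth_sum_assoc[symmetric, OF c(1) hyperbolic_carrier hyperbolic_carrier])
    also have "\<dots> \<cong>\<^sub>q (R \<bottom>\<^sub>q hyperbolic l) \<bottom>\<^sub>q hyperbolic i"
      by (intro orth_sum_cong kl h)
    also have "\<dots> = R \<bottom>\<^sub>q (hyperbolic l \<bottom>\<^sub>q hyperbolic i)"
      by (rule orth_sum_assoc[OF c(2) hyperbolic_carrier hyperbolic_carrier])
    also have "\<dots> \<cong>\<^sub>q R \<bottom>\<^sub>q (hyperbolic i \<bottom>\<^sub>q hyperbolic l)"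
      by (intro orth_sum_cong isometric_refl[OF c(2)] orth_sum_comm[OF hyperbolic_carrier hyperbolic_carrier])
    also have "\<dots> = (R \<bottom>\<^sub>q hyperbolic i) \<bottom>\<^sub>q hyperbolic l"
      by (rule orth_sum_assoc[symmetric, OF c(2) hyperbolic_carrier hyperbolic_carrier])
    also have "\<dots> \<cong>\<^sub>q (T \<bottom>\<^sub>q hyperbolic j) \<bottom>\<^sub>q hyperbolic l"
      by (intro orth_sum_cong ij h)
    also have "\<dots> = T \<bottom>\<^sub>q (hyperbolic j \<bottom>\<^sub>q hyperbolic l)"
      by (rule orth_sum_assoc[OF c(3) hyperbolic_carrier hyperbolic_carrier])
    also have "\<dots> \<cong>\<^sub>q T \<bottom>\<^sub>q hyperbolic (j + l)"
      by (intro orth_sum_cong isometric_refl[OF c(3)] hyperbolic_add)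
    finally show "(Q, T) \<in> witt_rel" using ns by (auto simp: witt_rel_def)
  qed
qed

lemma witt_relI_isometric:
  assumes "nonsingular Q" "nonsingular R" "Q \<cong>\<^sub>q R"
  shows "(Q, R) \<in> witt_rel"
  using assms orth_sum_cong[OF assms(3) isometric_refl[OF hyperbolic_carrier]]
  by (auto simp: witt_rel_def)

lemma witt_rel_orth_sum_left:
  fixes Q :: "'a::field mat"
  assumes "(Q, Q') \<in> witt_rel" and R: "nonsingular R"
  shows "(R \<bottom>\<^sub>q Q, R \<bottom>\<^sub>q Q') \<in> witt_rel"
proof -
  from assms(1) obtain k l where kl: "Q \<bottom>\<^sub>q hyperbolic k \<cong>\<^sub>q Q' \<bottom>\<^sub>q hyperbolic l"
    and ns: "nonsingular Q" "nonsingular Q'" by (auto simp: witt_rel_def)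
  have "R \<bottom>\<^sub>q (Q \<bottom>\<^sub>q hyperbolic k) \<cong>\<^sub>q R \<bottom>\<^sub>q (Q' \<bottom>\<^sub>q hyperbolic l)"
    by (intro orth_sum_cong kl isometric_refl[OF nonsingular_carrier[OF R]])
  then have "(R \<bottom>\<^sub>q Q) \<bottom>\<^sub>q hyperbolic k \<cong>\<^sub>q (R \<bottom>\<^sub>q Q') \<bottom>\<^sub>q hyperbolic l"
    using orth_sum_assoc[OF nonsingular_carrier[OF R] nonsingular_carrier[OF ns(1)] hyperbolic_carrier]
      orth_sum_assoc[OF nonsingular_carrier[OF R] nonsingular_carrier[OF ns(2)] hyperbolic_carrier]
    by simp
  then show ?thesis using ns R by (auto simp: witt_rel_def nonsingular_orth_sum)
qed

lemma witt_rel_comm: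
  fixes Q :: "'a::field mat"
  assumes "nonsingular Q" "nonsingular R"
  shows "(Q \<bottom>\<^sub>q R, R \<bottom>\<^sub>q Q) \<in> witt_rel"
  using assms by (intro witt_relI_isometric nonsingular_orth_sum
      orth_sum_comm[OF nonsingular_carrier nonsingular_carrier])

lemma witt_rel_orth_sum:
  fixes Q :: "'a::field mat"
  assumes a: "(Q, Q') \<in> witt_rel" and b: "(R, R') \<in> witt_rel"
  shows "(Q \<bottom>\<^sub>q R, Q' \<bottom>\<^sub>q R') \<in> witt_rel"
proof -
  have t: "trans (witt_rel :: ('a mat \<times> 'a mat) set)" using equiv_witt_rel by (rule equivE)
  have ns: "nonsingular Q" "nonsingular Q'" "nonsingular R" "nonsingular R'"
    using assms by (auto simp: witt_rel_def)
  show ?thesis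
    by (rule transD[OF t witt_rel_orth_sum_left[OF b ns(1)]],
        rule transD[OF t witt_rel_comm[OF ns(1,4)]],
        rule transD[OF t witt_rel_orth_sum_left[OF a ns(4)]],
        rule witt_rel_comm[OF ns(4,2)])
qed

lemma witt_class_eq_iff:
  "nonsingular Q \<Longrightarrow> nonsingular R \<Longrightarrow> witt_class Q = witt_class R \<longleftrightarrow> (Q, R) \<in> witt_rel"
  unfolding witt_class_def using eq_equiv_class_iff[OF equiv_witt_rel, of Q R] by simp

lemma witt_mult:
  fixes Q :: "'a::field mat"
  assumes "nonsingular Q" "nonsingular R"
  shows "witt_class Q \<otimes>\<^bsub>witt_group\<^esub> witt_class R = witt_class (Q \<bottom>\<^sub>q R)"
proof -
  have "congruent2 witt_rel witt_rel (\<lambda>Q R :: 'a mat. witt_class (Q \<bottom>\<^sub>q R))"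
  proof (rule congruent2I')
    fix Q Q' R R' :: "'a mat"
    assume a: "(Q, Q') \<in> witt_rel" "(R, R') \<in> witt_rel"
    then show "witt_class (Q \<bottom>\<^sub>q R) = witt_class (Q' \<bottom>\<^sub>q R')"
      using witt_rel_orth_sum[OF a]
      by (subst witt_class_eq_iff) (auto simp: witt_rel_def)
  qed
  from UN_equiv_class2[OF equiv_witt_rel equiv_witt_rel this, of Q R] assms
  show ?thesis by (simp add: witt_group_def witt_class_def[of Q] witt_class_def[of R])
qed

lemma witt_carrier: "X \<in> carrier witt_group \<longleftrightarrow> (\<exists>Q. nonsingular Q \<and> X = witt_class Q)"
  by (auto simp: witt_group_def witt_class_def quotient_def)

lemma witt_one: "\<one>\<^bsub>witt_group\<^esub> = witt_class (0\<^sub>m 0 0)"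
  by (simp add: witt_group_def)

lemma comm_group_witt_group: "comm_group (witt_group :: 'a::field mat set monoid)"
proof (rule comm_groupI)
  fix X Y Z :: "'a mat set"
  assume "X \<in> carrier witt_group"
  then obtain Q where Q: "nonsingular Q" "X = witt_class Q" by (auto simp: witt_carrier)
  show "\<one>\<^bsub>witt_group\<^esub> \<otimes>\<^bsub>witt_group\<^esub> X = X"
    using Q by (simp add: witt_one witt_mult nonsingular_zero
        orth_sum_zero_left[OF nonsingular_carrier])
  let ?n = "dim_row Q"
  have "Q \<bottom>\<^sub>q (- Q) \<cong>\<^sub>q hyperbolic ?n"
    using Q by (intro orth_sum_uminus_hyperbolic nonsingular_carrier)
  then have "(- Q) \<bottom>\<^sub>q Q \<cong>\<^sub>q hyperbolic ?n"
    using isometric_trans orth_sum_comm nonsingular_carrier nonsingular_uminus Q(1) by blast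
  then have "(- Q \<bottom>\<^sub>q Q) \<bottom>\<^sub>q hyperbolic 0 \<cong>\<^sub>q hyperbolic ?n \<bottom>\<^sub>q hyperbolic 0"
    by (intro orth_sum_cong isometric_refl[OF hyperbolic_carrier])
  then have "(- Q \<bottom>\<^sub>q Q) \<bottom>\<^sub>q hyperbolic 0 \<cong>\<^sub>q hyperbolic (?n + 0)"
    using hyperbolic_add isometric_trans by blast
  then have "(- Q \<bottom>\<^sub>q Q) \<bottom>\<^sub>q hyperbolic 0 \<cong>\<^sub>q 0\<^sub>m 0 0 \<bottom>\<^sub>q hyperbolic ?n"
    by (simp add: orth_sum_zero_left[OF hyperbolic_carrier])
  then have "(- Q \<bottom>\<^sub>q Q, 0\<^sub>m 0 0) \<in> witt_rel"
    using Q nonsingular_zero nonsingular_orth_sum nonsingular_uminus by (auto simp: witt_rel_def)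
  then have "witt_class (- Q) \<otimes>\<^bsub>witt_group\<^esub> X = \<one>\<^bsub>witt_group\<^esub>"
    using Q by (simp add: witt_mult witt_one witt_class_eq_iff
        nonsingular_zero nonsingular_orth_sum nonsingular_uminus)
  then show "\<exists>Y\<in>carrier witt_group. Y \<otimes>\<^bsub>witt_group\<^esub> X = \<one>\<^bsub>witt_group\<^esub>"
    using Q nonsingular_uminus witt_carrier by blast
  assume "Y \<in> carrier witt_group"
  then obtain R where R: "nonsingular R" "Y = witt_class R" by (auto simp: witt_carrier)
  show "X \<otimes>\<^bsub>witt_group\<^esub> Y \<in> carrier witt_group"
    using Q R witt_carrier nonsingular_orth_sum by (auto simp: witt_mult)
  show "X \<otimes>\<^bsub>witt_group\<^esub> Y = Y \<otimes>\<^bsub>witt_group\<^esub> X"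
    using Q R by (simp add: witt_mult witt_class_eq_iff nonsingular_orth_sum witt_rel_comm)
  assume "Z \<in> carrier witt_group"
  then obtain S where S: "nonsingular S" "Z = witt_class S" by (auto simp: witt_carrier)
  show "X \<otimes>\<^bsub>witt_group\<^esub> Y \<otimes>\<^bsub>witt_group\<^esub> Z = X \<otimes>\<^bsub>witt_group\<^esub> (Y \<otimes>\<^bsub>witt_group\<^esub> Z)"
    using Q R S by (simp add: witt_mult nonsingular_orth_sum
        orth_sum_assoc[OF nonsingular_carrier nonsingular_carrier nonsingular_carrier])
next
  show "\<one>\<^bsub>witt_group\<^esub> \<in> carrier (witt_group :: 'a mat set monoid)"
    using nonsingular_zero witt_carrier witt_one by blast
qed

end

theory Submission
  imports Defs
begin

text \<open>
  Let \<open>\<pi> = \<langle>\<langle>\<alpha>, \<beta>, \<gamma>]]\<rho>\<close> with \<open>\<rho>\<close> a bilinear \<open>(n - 2)\<close>-fold Pfister form, and put \<open>b = \<beta> + \<gamma>\<^sup>2\<close>,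
  \<open>c = \<gamma> b / \<beta>\<close>.  Then \<open>\<langle>\<langle>\<beta>, \<gamma>]] = \<langle>\<langle>\<beta>, b]] = \<langle>\<langle>b, c]]\<close>, so that \<open>b\<close> is both a quadratic and a bilinear slot.
  The hypothesis is applied to the triple \<open>\<langle>\<langle>\<alpha>, b]]\<rho>, \<langle>\<langle>\<alpha>, c]]\<rho>, \<langle>\<langle>b, c]]\<rho>\<close>.

  If these are \<open>\<langle>\<langle>x\<rangle>\<rangle>\<psi>, \<langle>\<langle>y\<rangle>\<rangle>\<psi>, \<langle>\<langle>z\<rangle>\<rangle>\<psi>\<close>, comparing pairs of them, and using that similar Pfister
  forms are isometric, gives \<open>\<langle>\<langle>x, y\<rangle>\<rangle>\<psi> = 0\<close> and \<open>\<langle>\<langle>x, z\<rangle>\<rangle>\<psi> = \<langle>\<langle>y, z\<rangle>\<rangle>\<psi> = \<pi>\<close>.  Since \<open>\<langle>\<langle>b, b]] = 0\<close>,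
  the sum \<open>\<langle>\<langle>\<alpha>, b + c]]\<rho>\<close> of the first two forms and \<open>\<langle>\<langle>b, b + c]]\<rho>\<close>, which is the third one, give
  \<open>\<langle>\<langle>xy, z\<rangle>\<rangle>\<psi> = \<pi>\<close> as well.  But the sum of the last three classes is \<open>\<langle>\<langle>x, y, z\<rangle>\<rangle>\<psi> = 0\<close>,
  so \<open>3 \<pi> = 0\<close> and \<open>\<pi> = 0\<close>.

  If the triple is inseparably linked, the sum of the first and the third form is Witt equivalent
  to an \<open>n\<close>-fold Pfister form; it is also the class of \<open>\<alpha>\<langle>\<langle>\<alpha>\<beta>, b]]\<rho>\<close>, so that
  \<open>\<alpha>\<langle>\<langle>\<alpha>\<beta>, b]]\<rho> = \<langle>\<langle>\<alpha>\<beta>, b]]\<rho>\<close>, which says \<open>\<pi> = 0\<close>.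
\<close>

section \<open>Kronecker products and isometries\<close>

lemma kron_carrier [simp]:
  "A \<in> carrier_mat m n \<Longrightarrow> B \<in> carrier_mat p q \<Longrightarrow> A \<otimes>\<^sub>k B \<in> carrier_mat (m * p) (n * q)"
  by (auto simp: kron_def)

lemma kron_index:
  assumes "A \<in> carrier_mat m n" "B \<in> carrier_mat p q" "i < m * p" "j < n * q"
  shows "(A \<otimes>\<^sub>k B) $$ (i, j) = A $$ (i div p, j div q) * B $$ (i mod p, j mod q)"
  using assms by (simp add: kron_def)

lemma kron_mult:
  fixes A :: "'a::field mat"
  assumes A: "A \<in> carrier_mat m n" and C: "C \<in> carrier_mat n k"
    and B: "B \<in> carrier_mat p q" and D: "D \<in> carrier_mat q r"
  shows "(A \<otimes>\<^sub>k B) * (C \<otimes>\<^sub>k D) = (A * C) \<otimes>\<^sub>k (B * D)"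
proof (rule eq_matI)
  fix i j assume "i < dim_row ((A * C) \<otimes>\<^sub>k (B * D))" "j < dim_col ((A * C) \<otimes>\<^sub>k (B * D))"
  then have ij: "i < m * p" "j < k * r" using assms by (auto simp: kron_def)
  then have pr: "0 < p" "0 < r" by (auto intro: gr0I)
  have d: "i div p < m" "i mod p < p" "j div r < k" "j mod r < r"
    using ij pr by (auto simp: less_mult_imp_div_less)
  have "((A \<otimes>\<^sub>k B) * (C \<otimes>\<^sub>k D)) $$ (i, j) = (\<Sum>l<n * q. (A \<otimes>\<^sub>k B) $$ (i, l) * (C \<otimes>\<^sub>k D) $$ (l, j))"
    using ij assms carrier_matD[OF kron_carrier[OF A B]] carrier_matD[OF kron_carrier[OF C D]]
    by (simp add: scalar_prod_def lessThan_atLeast0)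
  also have "\<dots> = (\<Sum>l<n * q. (A $$ (i div p, l div q) * C $$ (l div q, j div r)) *
      (B $$ (i mod p, l mod q) * D $$ (l mod q, j mod r)))"
    using ij by (intro sum.cong) (auto simp: kron_index[OF A B] kron_index[OF C D])
  also have "\<dots> = (\<Sum>l<n. A $$ (i div p, l) * C $$ (l, j div r)) * (\<Sum>l<q. B $$ (i mod p, l) * D $$ (l, j mod r))"
    by (cases "q = 0") (simp_all add: sum_div_mod[where f = "\<lambda>l. A $$ (i div p, l) * C $$ (l, j div r)"
          and g = "\<lambda>l. B $$ (i mod p, l) * D $$ (l, j mod r)"])
  also have "\<dots> = (A * C) $$ (i div p, j div r) * (B * D) $$ (i mod p, j mod r)"
    using d assms by (simp add: scalar_prod_def lessThan_atLeast0)
  also have "\<dots> = ((A * C) \<otimes>\<^sub>k (B * D)) $$ (i, j)"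
    using ij assms by (subst kron_index[of _ m k _ p r]) auto
  finally show "((A \<otimes>\<^sub>k B) * (C \<otimes>\<^sub>k D)) $$ (i, j) = ((A * C) \<otimes>\<^sub>k (B * D)) $$ (i, j)" .
qed (use assms in \<open>auto simp: kron_def\<close>)

lemma kron_one: "1\<^sub>m m \<otimes>\<^sub>k 1\<^sub>m n = (1\<^sub>m (m * n) :: 'a::field mat)"
proof (rule eq_matI)
  fix i j assume "i < dim_row (1\<^sub>m (m * n) :: 'a mat)" "j < dim_col (1\<^sub>m (m * n) :: 'a mat)"
  then have ij: "i < m * n" "j < m * n" by auto
  then have n: "0 < n" by (auto intro: gr0I)
  have "i div n = j div n \<and> i mod n = j mod n \<longleftrightarrow> i = j" by (metis div_mult_mod_eq)
  then show "(1\<^sub>m m \<otimes>\<^sub>k 1\<^sub>m n) $$ (i, j) = (1\<^sub>m (m * n) :: 'a mat) $$ (i, j)"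
    using ij n by (auto simp: kron_def less_mult_imp_div_less)
qed (auto simp: kron_def)

lemma kron_one_left: "1\<^sub>m 1 \<otimes>\<^sub>k Q = (Q :: 'a::field mat)"
  by (rule eq_matI) (auto simp: kron_def)

lemma kron_transpose: "transpose_mat (A \<otimes>\<^sub>k B) = transpose_mat A \<otimes>\<^sub>k transpose_mat B"
proof -
  have "i div dim_row B < dim_row A" "i mod dim_row B < dim_row B"
    if "i < dim_row A * dim_row B" for i
    using that by (auto simp: less_mult_imp_div_less intro!: mod_less_divisor gr0I)
  moreover have "i div dim_col B < dim_col A" "i mod dim_col B < dim_col B"
    if "i < dim_col A * dim_col B" for i
    using that by (auto simp: less_mult_imp_div_less intro!: mod_less_divisor gr0I)
  ultimately show ?thesis by (intro eq_matI) (auto simp: kron_def)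
qed

lemma kron_assoc: "(A \<otimes>\<^sub>k B) \<otimes>\<^sub>k C = A \<otimes>\<^sub>k (B \<otimes>\<^sub>k C)"
proof -
  have m: "i mod (q * r) div r = i div r mod q" "i div (q * r) = i div r div q" "i mod (q * r) mod r = i mod r" for i q r :: nat
    by (cases "r = 0"; simp add: mod_mult2_eq div_mult2_eq mult.commute[of q r])+
  have l: "i div r < p * q" "i div r mod q < q" "i mod (q * r) < q * r" "i mod r < r" if "i < p * (q * r)" for i p q r :: nat
    using that by (auto simp: less_mult_imp_div_less mult.assoc intro!: mod_less_divisor gr0I)
  show ?thesis
  proof (rule eq_matI)
    fix i j assume "i < dim_row (A \<otimes>\<^sub>k (B \<otimes>\<^sub>k C))" "j < dim_col (A \<otimes>\<^sub>k (B \<otimes>\<^sub>k C))"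
    then have ij: "i < dim_row A * (dim_row B * dim_row C)" "j < dim_col A * (dim_col B * dim_col C)"
      by (auto simp: kron_def)
    show "((A \<otimes>\<^sub>k B) \<otimes>\<^sub>k C) $$ (i, j) = (A \<otimes>\<^sub>k (B \<otimes>\<^sub>k C)) $$ (i, j)"
      using ij l[OF ij(1)] l[OF ij(2)] by (simp add: kron_def m mult.assoc)
  qed (simp_all add: kron_def mult.assoc)
qed

section \<open>Matrices of quadratic forms: change of basis and the alternating ambiguity\<close>

lemma qeval_mult_mat_vec:
  fixes M :: "'a::field mat"
  assumes M: "M \<in> carrier_mat n n" and K: "K \<in> carrier_mat n n" and x: "x \<in> carrier_vec n"
  shows "qeval M (K *\<^sub>v x) = qeval (transpose_mat K * M * K) x"
proof -
  have "x \<bullet> ((transpose_mat K * M * K) *\<^sub>v x) = x \<bullet> (transpose_mat K *\<^sub>v (M *\<^sub>v (K *\<^sub>v x)))"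
    using assms by (simp add: assoc_mult_mat_vec[of _ n n _ n])
  also have "\<dots> = (M *\<^sub>v (K *\<^sub>v x)) \<bullet> (K *\<^sub>v x)"
    using assms by (intro scalar_prod_mat_transpose[of _ n]) auto
  also have "\<dots> = (K *\<^sub>v x) \<bullet> (M *\<^sub>v (K *\<^sub>v x))"
    using assms by (intro comm_scalar_prod[of _ n]) auto
  finally show ?thesis by (simp add: qeval_def)
qed

lemma qeval_eq_sum:
  assumes "A \<in> carrier_mat n n" "x \<in> carrier_vec n"
  shows "qeval A x = (\<Sum>i<n. \<Sum>j<n. x $ i * A $$ (i, j) * x $ j)"
  using assms by (simp add: qeval_def scalar_prod_def lessThan_atLeast0 sum_distrib_left mult.assoc)

text \<open>The off-diagonal terms cancel in pairs; the induction adds one row and one column at a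
  time. The diagonal has its own hypothesis because in characteristic 2 it is not controlled by skew
  symmetry.\<close>

lemma qeval_alternating:
  fixes A :: "'a::field mat"
  assumes A: "A \<in> carrier_mat n n" and x: "x \<in> carrier_vec n"
    and diag: "\<And>i. i < n \<Longrightarrow> A $$ (i, i) = 0"
    and skew: "\<And>i j. i < n \<Longrightarrow> j < n \<Longrightarrow> A $$ (i, j) = - A $$ (j, i)"
  shows "qeval A x = 0"
proof -
  let ?f = "\<lambda>i j. x $ i * A $$ (i, j) * x $ j"
  have "(\<Sum>i<k. \<Sum>j<k. ?f i j) = 0" if "k \<le> n" for k
    using that
  proof (induction k)
    case (Suc k)
    have "(\<Sum>i<Suc k. \<Sum>j<Suc k. ?f i j) = (\<Sum>i<k. \<Sum>j<k. ?f i j) + (\<Sum>i<k. ?f i k + ?f k i) + ?f k k"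
      by (simp add: sum.distrib)
    moreover have "(\<Sum>i<k. ?f i k + ?f k i) = 0"
    proof (rule sum.neutral, rule ballI)
      fix i assume "i \<in> {..<k}"
      then have "A $$ (i, k) = - A $$ (k, i)" using skew[of i k] Suc.prems by simp
      then show "?f i k + ?f k i = 0" by simp
    qed
    ultimately show ?case using Suc diag by simp
  qed simp
  then show ?thesis using qeval_eq_sum[OF A x] by simp
qed

lemma unit_vec_mult:
  fixes M :: "'a::field mat"
  assumes "M \<in> carrier_mat n n" "i < n" "j < n"
  shows "unit_vec n i \<bullet> (M *\<^sub>v unit_vec n j) = M $$ (i, j)"
  using assms by simp

lemma qeval_unit_vec:
  "M \<in> carrier_mat n n \<Longrightarrow> i < n \<Longrightarrow> qeval M (unit_vec n i) = M $$ (i, i)"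
  by (simp add: qeval_def)

text \<open>Unit vectors recover the diagonal, sums of two of them the polar form. Hence matrices
  with the same values differ by an alternating matrix.\<close>

lemma qeval_eq_imp:
  fixes M :: "'a::field mat"
  assumes M: "M \<in> carrier_mat n n" and N: "N \<in> carrier_mat n n"
    and eq: "\<And>x. x \<in> carrier_vec n \<Longrightarrow> qeval M x = qeval N x"
  shows "\<And>i. i < n \<Longrightarrow> M $$ (i, i) = N $$ (i, i)"
    and "\<And>i j. i < n \<Longrightarrow> j < n \<Longrightarrow> M $$ (i, j) + M $$ (j, i) = N $$ (i, j) + N $$ (j, i)"
proof -
  show d: "M $$ (i, i) = N $$ (i, i)" if "i < n" for i
    using eq[of "unit_vec n i"] that by (simp add: qeval_unit_vec[OF M] qeval_unit_vec[OF N])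
  fix i j assume ij: "i < n" "j < n"
  have "qeval K (unit_vec n i + unit_vec n j) = K $$ (i, i) + K $$ (j, j) + (K $$ (i, j) + K $$ (j, i))"
    if "K \<in> carrier_mat n n" for K :: "'a mat"
  proof -
    have "unit_vec n i \<bullet> (polar K *\<^sub>v unit_vec n j) = K $$ (i, j) + K $$ (j, i)"
      using unit_vec_mult[OF polar_carrier[OF that] ij] that ij by (simp add: polar_def)
    then show ?thesis
      using that ij qeval_add[OF that, of "unit_vec n i" "unit_vec n j"] by (simp add: qeval_unit_vec)
  qed
  from this[OF M] this[OF N] eq[of "unit_vec n i + unit_vec n j"] d[OF ij(1)] d[OF ij(2)]
  show "M $$ (i, j) + M $$ (j, i) = N $$ (i, j) + N $$ (j, i)" by simp
qed

text \<open>Tensoring the alternating matrix \<open>M - N\<close> with a symmetric \<open>B\<close>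
  gives an alternating matrix again. So the tensor product does not depend on the matrix chosen for
  the quadratic factor.\<close>

lemma qeval_kron_cong:
  fixes B :: "'a::field mat"
  assumes B: "B \<in> carrier_mat m m" and sym: "transpose_mat B = B"
    and M: "M \<in> carrier_mat n n" and N: "N \<in> carrier_mat n n"
    and eq: "\<And>x. x \<in> carrier_vec n \<Longrightarrow> qeval M x = qeval N x"
    and x: "x \<in> carrier_vec (m * n)"
  shows "qeval (B \<otimes>\<^sub>k M) x = qeval (B \<otimes>\<^sub>k N) x"
proof -
  let ?A = "(B \<otimes>\<^sub>k M) - (B \<otimes>\<^sub>k N)"
  have c: "B \<otimes>\<^sub>k M \<in> carrier_mat (m * n) (m * n)" "B \<otimes>\<^sub>k N \<in> carrier_mat (m * n) (m * n)"
    using B M N by auto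
  have dm: "i div n < m" "i mod n < n" if "i < m * n" for i
    using that by (auto simp: less_mult_imp_div_less intro!: mod_less_divisor gr0I)
  have A: "?A $$ (i, j) = B $$ (i div n, j div n) * (M $$ (i mod n, j mod n) - N $$ (i mod n, j mod n))"
    if "i < m * n" "j < m * n" for i j
    using that c by (simp add: kron_index[OF B M] kron_index[OF B N] right_diff_distrib)
  have "qeval ?A x = 0"
  proof (rule qeval_alternating[OF _ x])
    fix i j assume ij: "i < m * n" "j < m * n"
    show "?A $$ (i, i) = 0" using ij qeval_eq_imp(1)[OF M N eq] dm by (simp add: A)
    have "B $$ (j div n, i div n) = B $$ (i div n, j div n)"
      using arg_cong[OF sym, of "\<lambda>B. B $$ (i div n, j div n)"] B dm ij by simp
    moreover have "M $$ (i mod n, j mod n) - N $$ (i mod n, j mod n) =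
        - (M $$ (j mod n, i mod n) - N $$ (j mod n, i mod n))"
      using qeval_eq_imp(2)[OF M N eq dm(2)[OF ij(1)] dm(2)[OF ij(2)]] by (simp add: algebra_simps)
    ultimately show "?A $$ (i, j) = - ?A $$ (j, i)" using ij by (simp only: A) (metis mult_minus_right)
  qed (use c in auto)
  then show ?thesis using c x
    by (simp add: qeval_def minus_mult_distrib_mat_vec[of _ "m * n" "m * n"] scalar_prod_minus_distrib[of _ "m * n"])
qed

lemma kron_isometric:
  fixes B :: "'a::field mat"
  assumes BC: "B \<cong>\<^sub>b C" and sym: "transpose_mat B = B" and QR: "Q \<cong>\<^sub>q R"
  shows "B \<otimes>\<^sub>k Q \<cong>\<^sub>q C \<otimes>\<^sub>k R"
proof -
  define m where "m = dim_row B"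
  have B: "B \<in> carrier_mat m m" and C: "C \<in> carrier_mat m m"
    using BC unfolding bil_isometric_def m_def by auto
  from BC obtain P where P: "P \<in> carrier_mat m m" "invertible_mat P"
    and PB': "\<forall>x\<in>carrier_vec m. \<forall>y\<in>carrier_vec m. (P *\<^sub>v x) \<bullet> (C *\<^sub>v (P *\<^sub>v y)) = x \<bullet> (B *\<^sub>v y)"
    unfolding bil_isometric_def m_def[symmetric] by blast
  have PB: "(P *\<^sub>v x) \<bullet> (C *\<^sub>v (P *\<^sub>v y)) = x \<bullet> (B *\<^sub>v y)"
    if "x \<in> carrier_vec m" "y \<in> carrier_vec m" for x y using PB' that by blast
  from P obtain S where S: "P * S = 1\<^sub>m m" "S * P = 1\<^sub>m (dim_row S)"
    unfolding invertible_mat_def inverts_mat_def by auto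
  have "dim_row S = m" using arg_cong[OF S(2), of dim_col] P by simp
  moreover have "dim_col S = m" using arg_cong[OF S(1), of dim_col] P by simp
  ultimately have Sc: "S \<in> carrier_mat m m" and SP: "S * P = 1\<^sub>m m" using S by auto
  from QR obtain n P' S' where Q: "Q \<in> carrier_mat n n" and R: "R \<in> carrier_mat n n"
    and P': "P' \<in> carrier_mat n n" and S': "S' \<in> carrier_mat n n"
    and SP': "\<forall>x\<in>carrier_vec n. S' *\<^sub>v (P' *\<^sub>v x) = x"
    and PQ: "\<forall>x\<in>carrier_vec n. qeval R (P' *\<^sub>v x) = qeval Q x" by (elim isometricE) blast
  have SP'1: "S' * P' = 1\<^sub>m n" using SP' by (intro left_inverse_by_vec[OF P' S']) auto
  \<comment> \<open>A Gram matrix is determined by its values, so a bilinear isometry is a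
    congruence of matrices.\<close>
  have BP: "transpose_mat P * C * P = B"
  proof (rule eq_matI)
    fix i j assume "i < dim_row B" "j < dim_col B"
    then have ij: "i < m" "j < m" using B by auto
    have "(transpose_mat P * C * P) $$ (i, j) = unit_vec m i \<bullet> ((transpose_mat P * C * P) *\<^sub>v unit_vec m j)"
      using ij P C by (intro unit_vec_mult[symmetric]) auto
    also have "\<dots> = unit_vec m i \<bullet> (transpose_mat P *\<^sub>v (C *\<^sub>v (P *\<^sub>v unit_vec m j)))"
      using P C by (simp add: assoc_mult_mat_vec[of _ m m _ m])
    also have "\<dots> = (C *\<^sub>v (P *\<^sub>v unit_vec m j)) \<bullet> (P *\<^sub>v unit_vec m i)"
      using P C by (intro scalar_prod_mat_transpose[of _ m]) auto
    also have "\<dots> = (P *\<^sub>v unit_vec m i) \<bullet> (C *\<^sub>v (P *\<^sub>v unit_vec m j))"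
      using P C by (intro comm_scalar_prod[of _ m]) auto
    also have "\<dots> = unit_vec m i \<bullet> (B *\<^sub>v unit_vec m j)" by (rule PB) auto
    also have "\<dots> = B $$ (i, j)" using ij B by (intro unit_vec_mult) auto
    finally show "(transpose_mat P * C * P) $$ (i, j) = B $$ (i, j)" .
  qed (use B P in auto)
  let ?K = "P \<otimes>\<^sub>k P'"
  show ?thesis
  proof (rule isometricI[of _ "m * n" _ ?K "S \<otimes>\<^sub>k S'"])
    fix x :: "'a vec" assume x: "x \<in> carrier_vec (m * n)"
    have "(S \<otimes>\<^sub>k S') *\<^sub>v (?K *\<^sub>v x) = ((S \<otimes>\<^sub>k S') * ?K) *\<^sub>v x"
      using P P' Sc S' x by (simp add: assoc_mult_mat_vec[OF kron_carrier kron_carrier])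
    also have "(S \<otimes>\<^sub>k S') * ?K = 1\<^sub>m (m * n)"
      using SP SP'1 by (simp add: kron_mult[OF Sc P(1) S' P'] kron_one)
    finally show "(S \<otimes>\<^sub>k S') *\<^sub>v (?K *\<^sub>v x) = x" using x by simp
    have "qeval (C \<otimes>\<^sub>k R) (?K *\<^sub>v x) = qeval (transpose_mat ?K * (C \<otimes>\<^sub>k R) * ?K) x"
      by (rule qeval_mult_mat_vec[of _ "m * n"]) (use C R P P' x in auto)
    also have "transpose_mat ?K * (C \<otimes>\<^sub>k R) * ?K = (transpose_mat P * C * P) \<otimes>\<^sub>k (transpose_mat P' * R * P')"
      using P P' C R by (simp add: kron_transpose kron_mult[of _ m m _ m _ n n _ n])
    also have "qeval \<dots> x = qeval (B \<otimes>\<^sub>k (transpose_mat P' * R * P')) x" by (simp add: BP)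
    \<comment> \<open>\<open>P'\<close> only transports values, so
      \<open>transpose_mat P' * R * P'\<close> need not equal \<open>Q\<close> as a matrix.\<close>
    also have "\<dots> = qeval (B \<otimes>\<^sub>k Q) x"
    proof (rule qeval_kron_cong[OF B sym _ Q _ x])
      fix y :: "'a vec" assume y: "y \<in> carrier_vec n"
      show "qeval (transpose_mat P' * R * P') y = qeval Q y"
        using PQ y qeval_mult_mat_vec[OF R P' y] by simp
    qed (use P' R in auto)
    finally show "qeval (C \<otimes>\<^sub>k R) (?K *\<^sub>v x) = qeval (B \<otimes>\<^sub>k Q) x" .
  qed (use B C Q R P P' Sc S' in auto)
qed

lemma binary_form_carrier [simp]: "binary_form a b \<in> carrier_mat 2 2"
  by (simp add: binary_form_def mat_of_rows_list_def carrier_matI)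

section \<open>Scalar multiples and Witt equivalence\<close>

lemma smult_orth_sum:
  "Q \<in> carrier_mat n n \<Longrightarrow> R \<in> carrier_mat m m \<Longrightarrow> c \<cdot>\<^sub>m (Q \<bottom>\<^sub>q R) = (c \<cdot>\<^sub>m Q) \<bottom>\<^sub>q (c \<cdot>\<^sub>m R)"
  by (intro eq_matI) (auto simp: orth_sum_def)

lemma smult_smult_mat: "c \<cdot>\<^sub>m (d \<cdot>\<^sub>m (Q :: 'a::field mat)) = (c * d) \<cdot>\<^sub>m Q"
  by (intro eq_matI) (auto simp: mult.assoc)

lemma smult_one_mat: "(1 :: 'a::field) \<cdot>\<^sub>m Q = Q"
  by (intro eq_matI) auto

lemma smult_mat_mult_vec:
  "A \<in> carrier_mat m n \<Longrightarrow> x \<in> carrier_vec n \<Longrightarrow> (c \<cdot>\<^sub>m A) *\<^sub>v x = c \<cdot>\<^sub>v (A *\<^sub>v (x :: 'a::field vec))"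
  by (intro eq_vecI) auto

lemma qeval_smult_mat:
  "Q \<in> carrier_mat n n \<Longrightarrow> x \<in> carrier_vec n \<Longrightarrow> qeval (c \<cdot>\<^sub>m Q) x = c * qeval Q x"
  by (simp add: qeval_def smult_mat_mult_vec[of _ n n])

lemma isometric_smult:
  fixes Q :: "'a::field mat"
  assumes "Q \<cong>\<^sub>q R" shows "c \<cdot>\<^sub>m Q \<cong>\<^sub>q c \<cdot>\<^sub>m R"
proof -
  from assms obtain n P S where *: "Q \<in> carrier_mat n n" "R \<in> carrier_mat n n"
    "P \<in> carrier_mat n n" "S \<in> carrier_mat n n"
    "\<forall>x\<in>carrier_vec n. S *\<^sub>v (P *\<^sub>v x) = x"
    "\<forall>x\<in>carrier_vec n. qeval R (P *\<^sub>v x) = qeval Q x" by (elim isometricE) blast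
  then show ?thesis
    by (intro isometricI[of _ n _ P S]) (auto simp: qeval_smult_mat[of _ n])
qed

lemma polar_smult: "Q \<in> carrier_mat n n \<Longrightarrow> polar (c \<cdot>\<^sub>m Q) = c \<cdot>\<^sub>m polar Q"
  by (intro eq_matI) (auto simp: polar_def distrib_left)

lemma nonsingular_smult:
  fixes Q :: "'a::field mat"
  assumes "nonsingular Q" "c \<noteq> 0" shows "nonsingular (c \<cdot>\<^sub>m Q)"
proof -
  from assms(1) obtain n B where n: "Q \<in> carrier_mat n n" "B \<in> carrier_mat n n"
    "polar Q * B = 1\<^sub>m n" by (elim nonsingularE)
  have "(c \<cdot>\<^sub>m polar Q) * ((1 / c) \<cdot>\<^sub>m B) = 1\<^sub>m n"
    using n assms(2) polar_carrier[OF n(1)]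
    by (simp add: mult_smult_assoc_mat[of _ n n _ n] mult_smult_distrib[of _ n n _ n] smult_smult_mat smult_one_mat)
  then show ?thesis using n by (intro nonsingularI[of _ n "(1 / c) \<cdot>\<^sub>m B"]) (auto simp: polar_smult)
qed

text \<open>Polar forms depend on values only, so an isometry \<open>P\<close> makes them congruent:
  \<open>polar Q = transpose_mat P * polar R * P\<close>. Each factor is invertible.\<close>

lemma nonsingular_isometric:
  fixes Q :: "'a::field mat"
  assumes QR: "Q \<cong>\<^sub>q R" and "nonsingular R" shows "nonsingular Q"
proof -
  from QR obtain n P S where Q: "Q \<in> carrier_mat n n" and R: "R \<in> carrier_mat n n"
    and P: "P \<in> carrier_mat n n" and S: "S \<in> carrier_mat n n"
    and SP: "\<forall>x\<in>carrier_vec n. S *\<^sub>v (P *\<^sub>v x) = x"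
    and PQ: "\<forall>x\<in>carrier_vec n. qeval R (P *\<^sub>v x) = qeval Q x" by (elim isometricE) blast
  have SP1: "S * P = 1\<^sub>m n" using SP by (intro left_inverse_by_vec[OF P S]) auto
  have PS1: "P * S = 1\<^sub>m n" by (rule mat_mult_left_right_inverse[OF S P SP1])
  from \<open>nonsingular R\<close> R obtain B where B: "B \<in> carrier_mat n n" "polar R * B = 1\<^sub>m n"
    by (elim nonsingularE) auto
  let ?M = "transpose_mat P * R * P"
  have M: "?M \<in> carrier_mat n n" using P R by auto
  have "polar Q = polar ?M"
  proof (rule eq_matI)
    have eq: "qeval Q x = qeval ?M x" if "x \<in> carrier_vec n" for x
      using PQ that qeval_mult_mat_vec[OF R P that] by simp
    fix i j assume "i < dim_row (polar ?M)" "j < dim_col (polar ?M)"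
    then have ij: "i < n" "j < n" using P by (auto simp: polar_def)
    have p: "polar K $$ (i, j) = K $$ (i, j) + K $$ (j, i)" if "K \<in> carrier_mat n n" for K :: "'a mat"
      using that ij by (simp add: polar_def)
    show "polar Q $$ (i, j) = polar ?M $$ (i, j)"
      unfolding p[OF Q] p[OF M] by (rule qeval_eq_imp(2)[OF Q M eq ij])
  qed (use Q P in \<open>auto simp: polar_def\<close>)
  also have "\<dots> = transpose_mat P * polar R * P"
    using P R by (simp add: polar_def transpose_mult[of _ n n _ n] add_mult_distrib_mat[of _ n n _ _ n]
        mult_add_distrib_mat[of _ n n _ n] assoc_mult_mat[of _ n n _ n _ n])
  finally have pQ: "polar Q = transpose_mat P * polar R * P" .
  have pR: "polar R \<in> carrier_mat n n" using R by simp
  note assoc = assoc_mult_mat[of _ n n _ n _ n]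
  have "polar Q * (S * (B * transpose_mat S)) = transpose_mat P * (polar R * ((P * S) * (B * transpose_mat S)))"
    unfolding pQ using P S B pR by (simp add: assoc)
  also have "(P * S) * (B * transpose_mat S) = B * transpose_mat S" using PS1 S B by simp
  also have "polar R * (B * transpose_mat S) = (polar R * B) * transpose_mat S"
    using S B pR by (intro assoc[symmetric]) auto
  also have "\<dots> = transpose_mat S" using S B by simp
  also have "transpose_mat P * transpose_mat S = transpose_mat (S * P)"
    using P S by (simp add: transpose_mult[of _ n n _ n])
  also have "\<dots> = 1\<^sub>m n" by (simp add: SP1)
  finally show ?thesis using Q S B by (intro nonsingularI[of _ n "S * (B * transpose_mat S)"]) auto
qed

text \<open>The factor c is absorbed by scaling one of the two coordinate blocks.\<close>

lemma hyperbolic_smult: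
  fixes c :: "'a::field"
  assumes "c \<noteq> 0" shows "c \<cdot>\<^sub>m hyperbolic k \<cong>\<^sub>q hyperbolic k"
proof -
  define P :: "'a \<Rightarrow> 'a mat" where "P d = four_block_mat (d \<cdot>\<^sub>m 1\<^sub>m k) (0\<^sub>m k k) (0\<^sub>m k k) (1\<^sub>m k)" for d
  have P: "P d *\<^sub>v (x @\<^sub>v y) = (d \<cdot>\<^sub>v x) @\<^sub>v y" if "x \<in> carrier_vec k" "y \<in> carrier_vec k" for d x y
    unfolding P_def using that
    by (subst four_block_mat_mult_vec[of _ k k _ k _ k]) (auto simp: smult_mat_mult_vec[of _ k k])
  show ?thesis
  proof (rule isometricI[of _ "k + k" _ "P c" "P (1 / c)"])
    fix x :: "'a vec" assume "x \<in> carrier_vec (k + k)"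
    then obtain y z where yz: "y \<in> carrier_vec k" "z \<in> carrier_vec k" "x = y @\<^sub>v z"
      by (rule append_cases)
    then show "P (1 / c) *\<^sub>v (P c *\<^sub>v x) = x" using assms by (simp add: P smult_smult_assoc)
    show "qeval (hyperbolic k) (P c *\<^sub>v x) = qeval (c \<cdot>\<^sub>m hyperbolic k) x"
      using yz by (simp add: P qeval_smult_mat[of _ "k + k"] qeval_hyperbolic)
  qed (auto simp: P_def)
qed

lemma witt_rel_smult:
  fixes c :: "'a::field"
  assumes QR: "(Q, R) \<in> witt_rel" and c: "c \<noteq> 0"
  shows "(c \<cdot>\<^sub>m Q, c \<cdot>\<^sub>m R) \<in> witt_rel"
proof -
  from QR obtain k l where kl: "Q \<bottom>\<^sub>q hyperbolic k \<cong>\<^sub>q R \<bottom>\<^sub>q hyperbolic l"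
    and ns: "nonsingular Q" "nonsingular R" by (auto simp: witt_rel_def)
  have *: "c \<cdot>\<^sub>m (X \<bottom>\<^sub>q hyperbolic j) \<cong>\<^sub>q (c \<cdot>\<^sub>m X) \<bottom>\<^sub>q hyperbolic j" if "nonsingular X" for X and j
    unfolding smult_orth_sum[OF nonsingular_carrier[OF that] hyperbolic_carrier]
    using that by (intro orth_sum_cong hyperbolic_smult[OF c] isometric_refl[OF nonsingular_carrier]
        nonsingular_smult c)
  have "(c \<cdot>\<^sub>m Q) \<bottom>\<^sub>q hyperbolic k \<cong>\<^sub>q (c \<cdot>\<^sub>m R) \<bottom>\<^sub>q hyperbolic l"
    using isometric_sym[OF *[OF ns(1)]] isometric_smult[OF kl] *[OF ns(2)] isometric_trans by blast
  then show ?thesis using ns c by (auto simp: witt_rel_def nonsingular_smult)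
qed

section \<open>The Witt group as an additive group type\<close>

text \<open>As a type with an \<open>ab_group_add\<close> instance, the Witt group admits
  computation by simplification in an additive group.\<close>

typedef (overloaded) ('a::field) witt = "carrier (witt_group :: 'a mat set monoid)"
proof -
  interpret comm_group "witt_group :: 'a mat set monoid" by (rule comm_group_witt_group)
  show ?thesis by blast
qed

instantiation witt :: (field) ab_group_add
begin

definition "0 = Abs_witt \<one>\<^bsub>witt_group\<^esub>"
definition "v + w = Abs_witt (Rep_witt v \<otimes>\<^bsub>witt_group\<^esub> Rep_witt w)"
definition "- w = Abs_witt (inv\<^bsub>witt_group\<^esub> Rep_witt w)"
definition "v - w = v + - (w :: 'a witt)"

instance
proof
  interpret comm_group "witt_group :: 'a mat set monoid" by (rule comm_group_witt_group)
  note [simp] = Rep_witt Abs_witt_inverse Rep_witt_inverse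
  fix u v w :: "'a witt"
  show "u + v + w = u + (v + w)" by (simp add: plus_witt_def m_assoc)
  show "u + v = v + u" by (simp add: plus_witt_def m_comm)
  show "0 + u = u" by (simp add: plus_witt_def zero_witt_def)
  show "- u + u = 0" by (simp add: plus_witt_def zero_witt_def uminus_witt_def)
qed (simp add: minus_witt_def)

end

definition witt :: "'a::field mat \<Rightarrow> 'a witt" where
  "witt Q = Abs_witt (witt_class Q)"

lemma witt_eq_iff:
  "nonsingular Q \<Longrightarrow> nonsingular R \<Longrightarrow> witt Q = witt R \<longleftrightarrow> (Q, R) \<in> witt_rel"
  unfolding witt_def using Abs_witt_inject[of "witt_class Q" "witt_class R"] witt_carrier witt_class_eq_iff
  by blast

lemma witt_isometric:
  "nonsingular Q \<Longrightarrow> nonsingular R \<Longrightarrow> Q \<cong>\<^sub>q R \<Longrightarrow> witt Q = witt R"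
  by (simp add: witt_eq_iff witt_relI_isometric)

lemma witt_orth_sum:
  fixes Q R :: "'a::field mat"
  assumes "nonsingular Q" "nonsingular R"
  shows "witt (Q \<bottom>\<^sub>q R) = witt Q + witt R"
proof -
  have "witt_class Q \<in> carrier witt_group" "witt_class R \<in> carrier witt_group"
    using assms witt_carrier by auto
  then show ?thesis using assms by (simp add: witt_def plus_witt_def Abs_witt_inverse witt_mult)
qed

lemma witt_smult_cong:
  "witt Q = witt R \<Longrightarrow> nonsingular Q \<Longrightarrow> nonsingular R \<Longrightarrow> c \<noteq> 0 \<Longrightarrow> witt (c \<cdot>\<^sub>m Q) = witt (c \<cdot>\<^sub>m R)"
  by (simp add: witt_eq_iff nonsingular_smult witt_rel_smult)

lemma witt_zero_mat: "witt (0\<^sub>m 0 0) = (0 :: 'a::field witt)"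
  by (simp add: witt_def zero_witt_def witt_one)

lemma witt_eq_zero_iff:
  "nonsingular Q \<Longrightarrow> witt Q = 0 \<longleftrightarrow> (\<exists>k l. Q \<bottom>\<^sub>q hyperbolic k \<cong>\<^sub>q hyperbolic l)"
  unfolding witt_zero_mat[symmetric]
  by (simp add: witt_eq_iff nonsingular_zero witt_rel_def orth_sum_zero_left[OF hyperbolic_carrier])

section \<open>Pfister forms as iterated orthogonal sums\<close>

lemma kron_diag:
  fixes R :: "'a::field mat"
  assumes R: "R \<in> carrier_mat n n"
  shows "mat_of_rows_list 2 [[1, 0], [0, a]] \<otimes>\<^sub>k R = R \<bottom>\<^sub>q (a \<cdot>\<^sub>m R)"
proof (rule eq_matI)
  fix i j assume "i < dim_row (R \<bottom>\<^sub>q (a \<cdot>\<^sub>m R))" "j < dim_col (R \<bottom>\<^sub>q (a \<cdot>\<^sub>m R))"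
  then have ij: "i < n + n" "j < n + n" using R by (auto simp: orth_sum_def)
  have d: "k div n = (if k < n then 0 else 1)" "k mod n = (if k < n then k else k - n)" if "k < n + n" for k
    using that by (auto simp: div_if mod_if)
  show "(mat_of_rows_list 2 [[1, 0], [0, a]] \<otimes>\<^sub>k R) $$ (i, j) = (R \<bottom>\<^sub>q (a \<cdot>\<^sub>m R)) $$ (i, j)"
    using ij R d[OF ij(1)] d[OF ij(2)] by (simp add: kron_def orth_sum_def mat_of_rows_list_def)
qed (use R in \<open>auto simp: kron_def orth_sum_def mat_of_rows_list_def\<close>)

definition pf :: "'a::field list \<Rightarrow> 'a \<Rightarrow> 'a mat" where
  "pf as b = bil_pfister as \<otimes>\<^sub>k binary_form 1 b"

lemma bil_pfister_carrier: "bil_pfister as \<in> carrier_mat (2 ^ length as) (2 ^ length as)"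
proof (induction as)
  case (Cons a as)
  have "mat_of_rows_list 2 [[1, 0], [0, a]] \<in> carrier_mat 2 2"
    by (simp add: mat_of_rows_list_def carrier_matI)
  from kron_carrier[OF this Cons] show ?case by simp
qed simp

lemma pf_carrier: "pf as b \<in> carrier_mat (2 ^ length as * 2) (2 ^ length as * 2)"
  unfolding pf_def by (rule kron_carrier[OF bil_pfister_carrier binary_form_carrier])

lemma pf_Nil [simp]: "pf [] b = binary_form 1 b"
  by (simp add: pf_def kron_one_left del: One_nat_def)

lemma pf_Cons: "pf (a # as) b = pf as b \<bottom>\<^sub>q (a \<cdot>\<^sub>m pf as b)"
  unfolding pf_def bil_pfister.simps kron_assoc by (rule kron_diag[OF pf_carrier[unfolded pf_def]])

section \<open>Isotropy of Witt-trivial forms\<close>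

text \<open>An m-dimensional totally isotropic subspace is encoded by an injective matrix
  \<open>T\<close> whose columns form a basis of it.\<close>

definition tot_isotropic :: "nat \<Rightarrow> 'a::field mat \<Rightarrow> bool" where
  "tot_isotropic m Q \<longleftrightarrow> (\<exists>T \<in> carrier_mat (dim_row Q) m.
     (\<forall>c \<in> carrier_vec m. T *\<^sub>v c = 0\<^sub>v (dim_row Q) \<longrightarrow> c = 0\<^sub>v m) \<and>
     (\<forall>c \<in> carrier_vec m. qeval Q (T *\<^sub>v c) = 0))"

lemma tot_isotropicI:
  assumes "Q \<in> carrier_mat n n" "T \<in> carrier_mat n m"
    and "\<And>c. c \<in> carrier_vec m \<Longrightarrow> T *\<^sub>v c = 0\<^sub>v n \<Longrightarrow> c = 0\<^sub>v m"
    and "\<And>c. c \<in> carrier_vec m \<Longrightarrow> qeval Q (T *\<^sub>v c) = 0"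
  shows "tot_isotropic m Q"
  unfolding tot_isotropic_def using assms by (intro bexI[of _ T]) auto

lemma tot_isotropicE:
  assumes "tot_isotropic m Q" "Q \<in> carrier_mat n n"
  obtains T where "T \<in> carrier_mat n m"
    "\<And>c. c \<in> carrier_vec m \<Longrightarrow> T *\<^sub>v c = 0\<^sub>v n \<Longrightarrow> c = 0\<^sub>v m"
    "\<And>c. c \<in> carrier_vec m \<Longrightarrow> qeval Q (T *\<^sub>v c) = 0"
  using assms unfolding tot_isotropic_def by auto

lemma tot_isotropic_isometric:
  fixes Q :: "'a::field mat"
  assumes QR: "Q \<cong>\<^sub>q R" and t: "tot_isotropic m Q"
  shows "tot_isotropic m R"
proof -
  from QR obtain n P S where Q: "Q \<in> carrier_mat n n" and R: "R \<in> carrier_mat n n"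
    and P: "P \<in> carrier_mat n n" and S: "S \<in> carrier_mat n n"
    and SP: "\<forall>x\<in>carrier_vec n. S *\<^sub>v (P *\<^sub>v x) = x"
    and PQ: "\<forall>x\<in>carrier_vec n. qeval R (P *\<^sub>v x) = qeval Q x" by (elim isometricE) blast
  from t Q obtain T where T: "T \<in> carrier_mat n m"
    "\<And>c. c \<in> carrier_vec m \<Longrightarrow> T *\<^sub>v c = 0\<^sub>v n \<Longrightarrow> c = 0\<^sub>v m"
    "\<And>c. c \<in> carrier_vec m \<Longrightarrow> qeval Q (T *\<^sub>v c) = 0"
    by (elim tot_isotropicE) blast+
  have PT: "(P * T) *\<^sub>v c = P *\<^sub>v (T *\<^sub>v c)" "T *\<^sub>v c \<in> carrier_vec n" if "c \<in> carrier_vec m" for c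
    using that P T(1) by auto
  show ?thesis
  proof (rule tot_isotropicI[OF R, of "P * T"])
    fix c :: "'a vec" assume c: "c \<in> carrier_vec m"
    show "qeval R ((P * T) *\<^sub>v c) = 0" using PQ PT[OF c] T(3)[OF c] by simp
    assume "(P * T) *\<^sub>v c = 0\<^sub>v n"
    then have "S *\<^sub>v (P *\<^sub>v (T *\<^sub>v c)) = S *\<^sub>v 0\<^sub>v n" using PT[OF c] by simp
    moreover have "S *\<^sub>v 0\<^sub>v n = 0\<^sub>v n" using S by (intro eq_vecI) auto
    ultimately show "c = 0\<^sub>v m" using SP PT(2)[OF c] T(2)[OF c] by simp
  qed (use P T in auto)
qed

lemma tot_isotropic_hyperbolic: "tot_isotropic k (hyperbolic k :: 'a::field mat)"
proof (rule tot_isotropicI[OF hyperbolic_carrier, where T = "1\<^sub>m k @\<^sub>r 0\<^sub>m k k"])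
  have e: "(1\<^sub>m k @\<^sub>r 0\<^sub>m k k) *\<^sub>v c = c @\<^sub>v 0\<^sub>v k" if "c \<in> carrier_vec k" for c :: "'a vec"
    using that by (subst mat_mult_append[of _ k k _ k]) auto
  fix c :: "'a vec" assume c: "c \<in> carrier_vec k"
  show "qeval (hyperbolic k) ((1\<^sub>m k @\<^sub>r 0\<^sub>m k k) *\<^sub>v c) = 0"
    using c by (simp add: e qeval_hyperbolic)
  assume "(1\<^sub>m k @\<^sub>r 0\<^sub>m k k) *\<^sub>v c = 0\<^sub>v (k + k)"
  then have "(c @\<^sub>v 0\<^sub>v k) $ i = (0\<^sub>v (k + k) :: 'a vec) $ i" for i using c e by simp
  from this have "c $ i = 0" if "i < k" for i
    using that c by (metis add_lessD1 carrier_vecD index_append_vec(1) index_zero_vec(1) index_zero_vec(2) trans_less_add1)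
  then show "c = 0\<^sub>v k" using c by (intro eq_vecI) auto
qed auto

text \<open>The equation of the hyperplane orthogonal to w is solved for one coordinate, and the
  other m coordinates serve as parameters.\<close>

lemma hyperplane_injection:
  fixes w :: "'a::field vec"
  assumes w: "w \<in> carrier_vec (Suc m)"
  obtains M where "M \<in> carrier_mat (Suc m) m"
    "\<And>c. c \<in> carrier_vec m \<Longrightarrow> M *\<^sub>v c = 0\<^sub>v (Suc m) \<Longrightarrow> c = 0\<^sub>v m"
    "\<And>c. c \<in> carrier_vec m \<Longrightarrow> w \<bullet> (M *\<^sub>v c) = 0"
proof -
  \<comment> \<open>For w = 0 the index is arbitrary; row \<open>j\<close> of \<open>M\<close> then
    consists of quotients 0 / 0 = 0.\<close>
  obtain j where j: "j < Suc m" and wj: "w $ j = 0 \<Longrightarrow> (\<forall>i<Suc m. w $ i = 0)"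
    by (cases "\<exists>j<Suc m. w $ j \<noteq> 0") auto
  define s where "s k = (if k < j then k else Suc k)" for k
  have s: "s k < Suc m" "s k \<noteq> j" if "k < m" for k using that by (auto simp: s_def)
  have inj: "s k = s l \<longleftrightarrow> k = l" for k l by (auto simp: s_def)
  have img: "{..<Suc m} = insert j (s ` {..<m})"
  proof (intro equalityI subsetI)
    fix i assume "i \<in> {..<Suc m}"
    then consider "i = j" | "i < j" | "j < i" "i < Suc m" by fastforce
    then show "i \<in> insert j (s ` {..<m})"
    proof cases
      case 2
      then show ?thesis using j by (intro insertI2 image_eqI[of _ _ i]) (auto simp: s_def)
    next
      case 3
      then show ?thesis by (intro insertI2 image_eqI[of _ _ "i - 1"]) (auto simp: s_def)
    qed auto
  qed (use j s in auto)
  define M where "M = mat (Suc m) m (\<lambda>(i, k). if i = j then - (w $ s k) / w $ j else if i = s k then 1 else 0)"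
  have M: "M \<in> carrier_mat (Suc m) m" by (simp add: M_def)
  have Ms: "(M *\<^sub>v c) $ s k = c $ k" if "c \<in> carrier_vec m" "k < m" for c k
  proof -
    have "(M *\<^sub>v c) $ s k = (\<Sum>l<m. M $$ (s k, l) * c $ l)"
      using that M s by (simp add: scalar_prod_def lessThan_atLeast0)
    also have "\<dots> = (\<Sum>l<m. if l = k then c $ l else 0)"
      using that s by (intro sum.cong) (auto simp: M_def inj)
    also have "\<dots> = c $ k" using that by (simp add: sum.delta)
    finally show ?thesis .
  qed
  have Mj: "(M *\<^sub>v c) $ j = - (\<Sum>l<m. w $ s l * c $ l) / w $ j" if "c \<in> carrier_vec m" for c
  proof -
    have "(M *\<^sub>v c) $ j = (\<Sum>l<m. M $$ (j, l) * c $ l)"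
      using that M j by (simp add: scalar_prod_def lessThan_atLeast0)
    also have "\<dots> = (\<Sum>l<m. - (w $ s l * c $ l) / w $ j)"
      using j by (intro sum.cong) (auto simp: M_def)
    finally show ?thesis by (simp add: sum_divide_distrib sum_negf)
  qed
  show ?thesis
  proof (rule that[OF M])
    fix c :: "'a vec" assume c: "c \<in> carrier_vec m"
    show "c = 0\<^sub>v m" if "M *\<^sub>v c = 0\<^sub>v (Suc m)"
      using Ms[OF c] that c s by (intro eq_vecI) auto
    have "w \<bullet> (M *\<^sub>v c) = (\<Sum>i<Suc m. w $ i * (M *\<^sub>v c) $ i)"
      using c M by (simp add: scalar_prod_def lessThan_atLeast0)
    also have "\<dots> = w $ j * (M *\<^sub>v c) $ j + (\<Sum>k<m. w $ s k * c $ k)"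
    proof -
      have "sum f (s ` {..<m}) = (\<Sum>k<m. f (s k))" for f :: "nat \<Rightarrow> 'a"
        by (subst sum.reindex) (auto simp: inj_on_def inj)
      moreover have "j \<notin> s ` {..<m}" using s by auto
      ultimately show ?thesis unfolding img using Ms[OF c] by simp
    qed
    also have "\<dots> = 0"
    proof (cases "w $ j = 0")
      case True
      then show ?thesis using wj s by simp
    qed (simp add: Mj[OF c])
    finally show "w \<bullet> (M *\<^sub>v c) = 0" .
  qed
qed

text \<open>
  Let \<open>U\<close>, \<open>p\<close>, \<open>q\<close> be the components of the given injection \<open>T\<close> in \<open>R\<close> and in the hyperbolic plane.
  If \<open>U\<close> is not injective on the kernel of \<open>q\<close>, the image of \<open>T\<close> meets the plane in a line, which
  forces \<open>q = 0\<close>; then \<open>U\<close> is injective on the kernel of \<open>p\<close>.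
\<close>

lemma tot_isotropic_cancel_plane:
  fixes R :: "'a::field mat"
  assumes R: "R \<in> carrier_mat n n" and t: "tot_isotropic (Suc m) (R \<bottom>\<^sub>q hyperbolic 1)"
  shows "tot_isotropic m R"
proof -
  have "R \<bottom>\<^sub>q hyperbolic 1 \<in> carrier_mat (n + (1 + 1)) (n + (1 + 1))"
    by (rule orth_sum_carrier[OF R hyperbolic_carrier])
  from t this obtain T where T: "T \<in> carrier_mat (n + (1 + 1)) (Suc m)"
    and Tinj: "\<And>c. c \<in> carrier_vec (Suc m) \<Longrightarrow> T *\<^sub>v c = 0\<^sub>v (n + (1 + 1)) \<Longrightarrow> c = 0\<^sub>v (Suc m)"
    and Tiso: "\<And>c. c \<in> carrier_vec (Suc m) \<Longrightarrow> qeval (R \<bottom>\<^sub>q hyperbolic 1) (T *\<^sub>v c) = 0"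
    by (elim tot_isotropicE) blast+
  define U where "U = mat n (Suc m) (\<lambda>(i, j). T $$ (i, j))"
  define p where "p = row T n"
  define q where "q = row T (n + 1)"
  have U: "U \<in> carrier_mat n (Suc m)" and p: "p \<in> carrier_vec (Suc m)" and q: "q \<in> carrier_vec (Suc m)"
    using T by (auto simp: U_def p_def q_def intro!: carrier_vecI)
  have dec: "T *\<^sub>v c = (U *\<^sub>v c) @\<^sub>v (vec 1 (\<lambda>_. p \<bullet> c) @\<^sub>v vec 1 (\<lambda>_. q \<bullet> c))"
    if c: "c \<in> carrier_vec (Suc m)" for c
  proof (rule eq_vecI)
    fix i assume "i < dim_vec ((U *\<^sub>v c) @\<^sub>v (vec 1 (\<lambda>_. p \<bullet> c) @\<^sub>v vec 1 (\<lambda>_. q \<bullet> c)))"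
    then have "i < n + 2" using U by simp
    then consider "i < n" | "i = n" | "i = n + 1" by linarith
    then show "(T *\<^sub>v c) $ i = ((U *\<^sub>v c) @\<^sub>v (vec 1 (\<lambda>_. p \<bullet> c) @\<^sub>v vec 1 (\<lambda>_. q \<bullet> c))) $ i"
    proof cases
      case 1
      then have "row T i = row U i" using T by (intro eq_vecI) (auto simp: U_def)
      then show ?thesis using 1 T U by simp
    qed (use T U in \<open>auto simp: p_def q_def\<close>)
  qed (use T U in auto)
  have van: "qeval R (U *\<^sub>v c) + (p \<bullet> c) * (q \<bullet> c) = 0" if c: "c \<in> carrier_vec (Suc m)" for c
  proof -
    have "qeval (hyperbolic 1) (vec 1 (\<lambda>_. p \<bullet> c) @\<^sub>v vec 1 (\<lambda>_. q \<bullet> c)) = (p \<bullet> c) * (q \<bullet> c)"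
      by (subst qeval_hyperbolic) (auto simp: scalar_prod_def)
    moreover have "vec 1 (\<lambda>_. p \<bullet> c) @\<^sub>v vec 1 (\<lambda>_. q \<bullet> c) \<in> carrier_vec (1 + 1)"
      by (intro append_carrier_vec) auto
    moreover have "U *\<^sub>v c \<in> carrier_vec n" using U c by auto
    ultimately show ?thesis
      using Tiso[OF c] qeval_orth_sum[OF R hyperbolic_carrier[of 1], of "U *\<^sub>v c" "vec 1 (\<lambda>_. p \<bullet> c) @\<^sub>v vec 1 (\<lambda>_. q \<bullet> c)"]
      by (simp only: dec[OF c])
  qed
  have inj: "c = 0\<^sub>v (Suc m)" if "c \<in> carrier_vec (Suc m)" "U *\<^sub>v c = 0\<^sub>v n" "p \<bullet> c = 0" "q \<bullet> c = 0" for c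
  proof (rule Tinj[OF that(1)])
    show "T *\<^sub>v c = 0\<^sub>v (n + (1 + 1))" unfolding dec[OF that(1)] that(2-) by (intro eq_vecI) auto
  qed
  have main: ?thesis if M: "M \<in> carrier_mat (Suc m) m"
    and Mi: "\<And>c. c \<in> carrier_vec m \<Longrightarrow> U *\<^sub>v (M *\<^sub>v c) = 0\<^sub>v n \<Longrightarrow> c = 0\<^sub>v m"
    and Mz: "\<And>c. c \<in> carrier_vec m \<Longrightarrow> (p \<bullet> (M *\<^sub>v c)) * (q \<bullet> (M *\<^sub>v c)) = 0" for M
  proof (rule tot_isotropicI[OF R, of "U * M"])
    fix c :: "'a vec" assume c: "c \<in> carrier_vec m"
    have e: "(U * M) *\<^sub>v c = U *\<^sub>v (M *\<^sub>v c)" "M *\<^sub>v c \<in> carrier_vec (Suc m)" using U M c by auto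
    show "qeval R ((U * M) *\<^sub>v c) = 0" using van[OF e(2)] Mz[OF c] by (simp add: e)
    show "c = 0\<^sub>v m" if "(U * M) *\<^sub>v c = 0\<^sub>v n" using that Mi[OF c] by (simp add: e)
  qed (use U M in auto)
  obtain M where M: "M \<in> carrier_mat (Suc m) m"
    and Mi: "\<And>c. c \<in> carrier_vec m \<Longrightarrow> M *\<^sub>v c = 0\<^sub>v (Suc m) \<Longrightarrow> c = 0\<^sub>v m"
    and Mq: "\<And>c. c \<in> carrier_vec m \<Longrightarrow> q \<bullet> (M *\<^sub>v c) = 0"
    by (rule hyperplane_injection[OF q]) blast
  show ?thesis
  proof (cases "\<forall>c\<in>carrier_vec m. U *\<^sub>v (M *\<^sub>v c) = 0\<^sub>v n \<longrightarrow> c = 0\<^sub>v m")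
    case True
    then show ?thesis using Mq by (intro main[OF M]) auto
  next
    case False
    then obtain c0 where c0: "c0 \<in> carrier_vec m" "U *\<^sub>v (M *\<^sub>v c0) = 0\<^sub>v n" "c0 \<noteq> 0\<^sub>v m" by blast
    define t where "t = M *\<^sub>v c0"
    have t: "t \<in> carrier_vec (Suc m)" using M c0 by (simp add: t_def)
    have Ut: "U *\<^sub>v t = 0\<^sub>v n" and qt: "q \<bullet> t = 0" using c0 Mq by (auto simp: t_def)
    have "t \<noteq> 0\<^sub>v (Suc m)" using Mi[OF c0(1)] c0(3) by (auto simp: t_def)
    then have pt: "p \<bullet> t \<noteq> 0" using inj[OF t Ut _ qt] by blast
    \<comment> \<open>Adding t to c changes only the value of p, so the two instances of
      \<open>van\<close> differ by (p . t)(q . c).\<close>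
    have qz: "q \<bullet> c = 0" if c: "c \<in> carrier_vec (Suc m)" for c
    proof -
      have "U *\<^sub>v (c + t) = U *\<^sub>v c"
        using c t U Ut by (simp add: mult_add_distrib_mat_vec[of _ n "Suc m"])
      moreover have "p \<bullet> (c + t) = p \<bullet> c + p \<bullet> t" "q \<bullet> (c + t) = q \<bullet> c"
        using c t p q qt by (simp_all add: scalar_prod_add_distrib[of _ "Suc m"])
      ultimately have "qeval R (U *\<^sub>v c) + (p \<bullet> c + p \<bullet> t) * (q \<bullet> c) = 0"
        using van[of "c + t"] c t by simp
      then have "(p \<bullet> t) * (q \<bullet> c) = 0" using van[OF c] by (simp add: distrib_right add.assoc[symmetric])
      then show ?thesis using pt by simp
    qed
    obtain N where N: "N \<in> carrier_mat (Suc m) m"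
      and Ni: "\<And>c. c \<in> carrier_vec m \<Longrightarrow> N *\<^sub>v c = 0\<^sub>v (Suc m) \<Longrightarrow> c = 0\<^sub>v m"
      and Np: "\<And>c. c \<in> carrier_vec m \<Longrightarrow> p \<bullet> (N *\<^sub>v c) = 0"
      by (rule hyperplane_injection[OF p]) blast
    show ?thesis
    proof (rule main[OF N])
      fix c :: "'a vec" assume c: "c \<in> carrier_vec m"
      then have Nc: "N *\<^sub>v c \<in> carrier_vec (Suc m)" using N by auto
      show "(p \<bullet> (N *\<^sub>v c)) * (q \<bullet> (N *\<^sub>v c)) = 0" using Np[OF c] by simp
      show "c = 0\<^sub>v m" if "U *\<^sub>v (N *\<^sub>v c) = 0\<^sub>v n"
        using inj[OF Nc that Np[OF c] qz[OF Nc]] Ni[OF c] by simp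
    qed
  qed
qed

text \<open>Each hyperbolic plane removed costs one dimension of the totally isotropic subspace.
  This count takes the place of Witt cancellation.\<close>

lemma tot_isotropic_cancel:
  fixes R :: "'a::field mat"
  assumes R: "R \<in> carrier_mat n n" and t: "tot_isotropic (m + k) (R \<bottom>\<^sub>q hyperbolic k)"
  shows "tot_isotropic m R"
  using t
proof (induction k)
  case 0
  have "R \<bottom>\<^sub>q hyperbolic 0 = R" using R by (intro eq_matI) (auto simp: orth_sum_def hyperbolic_def)
  then show ?case using 0 by simp
next
  case (Suc k)
  have "R \<bottom>\<^sub>q hyperbolic (Suc k) \<cong>\<^sub>q R \<bottom>\<^sub>q (hyperbolic k \<bottom>\<^sub>q hyperbolic 1)"
    using isometric_sym[OF hyperbolic_add[of k 1]] by (intro orth_sum_cong isometric_refl[OF R]) simp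
  also have "R \<bottom>\<^sub>q (hyperbolic k \<bottom>\<^sub>q hyperbolic 1) = (R \<bottom>\<^sub>q hyperbolic k) \<bottom>\<^sub>q hyperbolic 1"
    by (rule orth_sum_assoc[symmetric, OF R hyperbolic_carrier hyperbolic_carrier])
  finally have "tot_isotropic (Suc (m + k)) ((R \<bottom>\<^sub>q hyperbolic k) \<bottom>\<^sub>q hyperbolic 1)"
    using tot_isotropic_isometric Suc.prems by fastforce
  then show ?case
    using Suc.IH tot_isotropic_cancel_plane[OF orth_sum_carrier[OF R hyperbolic_carrier]] by blast
qed

text \<open>Comparing dimensions in the isometry of Q plus k planes with l planes gives k < l. The
  l-dimensional totally isotropic subspace on the right leaves one of dimension l - k > 0 in
  Q.\<close>

lemma isotropic_if_witt_zero:
  fixes Q :: "'a::field mat"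
  assumes Q: "nonsingular Q" "Q \<in> carrier_mat n n" and z: "witt Q = 0" and n: "0 < n"
  obtains x where "x \<in> carrier_vec n" "x \<noteq> 0\<^sub>v n" "qeval Q x = 0"
proof -
  from z Q obtain k l where kl: "Q \<bottom>\<^sub>q hyperbolic k \<cong>\<^sub>q hyperbolic l"
    by (auto simp: witt_eq_zero_iff)
  have "dim_row (Q \<bottom>\<^sub>q hyperbolic k) = dim_row (hyperbolic l :: 'a mat)"
    using kl by (auto simp: isometric_def)
  then have "n + (k + k) = l + l"
    using Q(2) by (simp add: orth_sum_def hyperbolic_def)
  then have "k < l" using n by linarith
  then obtain m where m: "l = Suc m + k" using less_imp_Suc_add[of k l] by (auto simp: add.commute)
  have "tot_isotropic (Suc m + k) (Q \<bottom>\<^sub>q hyperbolic k)"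
    using tot_isotropic_isometric[OF isometric_sym[OF kl] tot_isotropic_hyperbolic] m by simp
  from tot_isotropicE[OF tot_isotropic_cancel[OF Q(2) this] Q(2)]
  obtain T where T: "T \<in> carrier_mat n (Suc m)"
    "\<And>c. c \<in> carrier_vec (Suc m) \<Longrightarrow> T *\<^sub>v c = 0\<^sub>v n \<Longrightarrow> c = 0\<^sub>v (Suc m)"
    "\<And>c. c \<in> carrier_vec (Suc m) \<Longrightarrow> qeval Q (T *\<^sub>v c) = 0" by blast
  let ?e = "unit_vec (Suc m) 0 :: 'a vec"
  have e: "?e \<noteq> 0\<^sub>v (Suc m)" by (metis index_unit_vec(1) index_zero_vec(1) zero_less_Suc zero_neq_one)
  show ?thesis
  proof (rule that[of "T *\<^sub>v ?e"])
    show "T *\<^sub>v ?e \<noteq> 0\<^sub>v n" using T(2)[of ?e] e by auto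
  qed (use T(1) T(3)[of ?e] in auto)
qed

section \<open>Binary forms in characteristic 2\<close>

definition vec2 :: "'a::field \<Rightarrow> 'a \<Rightarrow> 'a vec" where
  "vec2 x y = vec_of_list [x, y]"

lemma vec2_carrier [simp]: "vec2 x y \<in> carrier_vec 2"
  unfolding vec2_def by (rule carrier_vecI) simp

lemma vec2_index [simp]: "vec2 x y $ 0 = x" "vec2 x y $ 1 = y" "vec2 x y $ Suc 0 = y"
  by (simp_all add: vec2_def)

lemma qeval_binary_form_vec2: "qeval (binary_form a b) (vec2 x y) = a * x\<^sup>2 + x * y + b * y\<^sup>2"
  unfolding vec2_def by (rule qeval_binary_form)

lemma vec2_eqI: "v \<in> carrier_vec 2 \<Longrightarrow> v $ 0 = x \<Longrightarrow> v $ 1 = y \<Longrightarrow> v = vec2 x y"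
  by (intro eq_vecI) (auto simp: less_2_cases_iff carrier_vecD[OF vec2_carrier])

lemma vec2E:
  assumes "x \<in> carrier_vec 2"
  obtains a b where "x = vec2 a b"
  using vec2_eqI[OF assms refl refl] that by blast

lemma mat2_mult_vec:
  "mat_of_rows_list 2 [[a, b], [c, d]] *\<^sub>v vec2 x y = vec2 (a * x + b * y) (c * x + d * y)"
proof -
  have "dim_vec (vec2 x y) = 2" by (rule carrier_vecD[OF vec2_carrier])
  then show ?thesis
    by (intro vec2_eqI carrier_vecI) (simp_all add: mat_of_rows_list_def scalar_prod_def numeral_2_eq_2)
qed

lemma mat2_carrier: "mat_of_rows_list 2 [[a, b], [c, d]] \<in> carrier_mat 2 2"
  by (simp add: mat_of_rows_list_def carrier_matI)

lemma isometric2I: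
  fixes Q :: "'a::field mat"
  assumes Q: "Q \<in> carrier_mat 2 2" and R: "R \<in> carrier_mat 2 2" and det: "a * d - b * c \<noteq> 0"
    and eq: "\<And>x y. qeval R (vec2 (a * x + b * y) (c * x + d * y)) = qeval Q (vec2 x y)"
  shows "Q \<cong>\<^sub>q R"
proof -
  let ?D = "a * d - b * c"
  show ?thesis
  proof (rule isometricI[OF Q R mat2_carrier[of a b c d]
        mat2_carrier[of "d / ?D" "- b / ?D" "- c / ?D" "a / ?D"]])
    fix x :: "'a vec" assume "x \<in> carrier_vec 2"
    then obtain u v where x: "x = vec2 u v" by (rule vec2E)
    have "d / ?D * (a * u + b * v) + - b / ?D * (c * u + d * v) = u * ?D / ?D"
      by (simp add: diff_divide_distrib add_divide_distrib algebra_simps)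
    moreover have "- c / ?D * (a * u + b * v) + a / ?D * (c * u + d * v) = v * ?D / ?D"
      by (simp add: diff_divide_distrib add_divide_distrib algebra_simps)
    ultimately show "mat_of_rows_list 2 [[d / ?D, - b / ?D], [- c / ?D, a / ?D]] *\<^sub>v
        (mat_of_rows_list 2 [[a, b], [c, d]] *\<^sub>v x) = x"
      using det by (simp add: x mat2_mult_vec)
    show "qeval R (mat_of_rows_list 2 [[a, b], [c, d]] *\<^sub>v x) = qeval Q x"
      by (simp add: x mat2_mult_vec eq)
  qed
qed

lemma witt_surj:
  fixes w :: "'a::field witt"
  obtains Q where "nonsingular Q" "w = witt Q"
proof -
  from Rep_witt[of w] obtain Q where "nonsingular Q" "Rep_witt w = witt_class Q"
    by (auto simp: witt_carrier)
  then show ?thesis using that[of Q] by (metis Rep_witt_inverse witt_def)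
qed

lemma witt_hyperbolic: "nonsingular (hyperbolic k :: 'a::field mat) \<Longrightarrow> witt (hyperbolic k :: 'a mat) = 0"
  using hyperbolic_add[of k 0] by (auto simp: witt_eq_zero_iff)

text \<open>The parameter \<open>ty\<close> fixes the type \<open>'a\<close>, so that the locale can
  be interpreted at \<open>TYPE('a)\<close>.\<close>

locale char_two =
  fixes ty :: "'a::field itself"
  assumes char2: "CHAR('a::field) = 2"
begin

lemma two_eq_zero: "(2 :: 'a) = 0"
  using of_nat_CHAR[where 'a = 'a] char2 by simp

lemma add_self: "(x :: 'a) + x = 0"
  using two_eq_zero mult_2[of x] by simp

lemma add_self_left: "(x :: 'a) + (x + y) = y"
  using add_self by (simp flip: add.assoc)

lemma uminus_eq: "- (x :: 'a) = x"
  using add_self[of x] by (simp add: neg_eq_iff_add_eq_0)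

lemma add_eq_zero_iff: "(x :: 'a) + y = 0 \<longleftrightarrow> x = y"
  by (metis add_eq_0_iff uminus_eq)

lemmas char2_simps = add_self add_self_left uminus_eq

text \<open>In characteristic 2 \<open>- Q = Q\<close>, so the inverse of a Witt class is the class
  itself.\<close>

lemma witt_add_self: "(w :: 'a witt) + w = 0"
proof -
  obtain Q :: "'a mat" where Q: "nonsingular Q" "w = witt Q" by (rule witt_surj)
  obtain n where n: "Q \<in> carrier_mat n n" using Q nonsingular_carrier by blast
  have "- Q = Q" using n by (intro eq_matI) (auto simp: uminus_eq)
  then have "Q \<bottom>\<^sub>q Q \<cong>\<^sub>q hyperbolic n" using orth_sum_uminus_hyperbolic[OF Q(1) n] by simp
  then have "(Q \<bottom>\<^sub>q Q) \<bottom>\<^sub>q hyperbolic 0 \<cong>\<^sub>q hyperbolic n \<bottom>\<^sub>q hyperbolic 0"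
    by (intro orth_sum_cong isometric_refl[OF hyperbolic_carrier])
  then have "(Q \<bottom>\<^sub>q Q) \<bottom>\<^sub>q hyperbolic 0 \<cong>\<^sub>q hyperbolic (n + 0)"
    using hyperbolic_add isometric_trans by blast
  then show ?thesis using Q by (auto simp: witt_orth_sum[symmetric] witt_eq_zero_iff nonsingular_orth_sum)
qed

lemma witt_add_self_left: "(w :: 'a witt) + (w + v) = v"
  using witt_add_self by (simp flip: add.assoc)

lemma nonsingular_binary_form: "nonsingular (binary_form p q :: 'a mat)"
proof (rule nonsingularI[OF binary_form_carrier mat2_carrier[of 0 1 1 0]])
  have "polar (binary_form p q :: 'a mat) = mat_of_rows_list 2 [[0, 1], [1, 0]]"
    by (intro eq_matI) (auto simp: polar_def binary_form_def mat_of_rows_list_def less_Suc_eq numeral_2_eq_2 add_self)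
  then show "polar (binary_form p q :: 'a mat) * mat_of_rows_list 2 [[0, 1], [1, 0]] = 1\<^sub>m 2"
    by (intro eq_matI) (auto simp: mat_of_rows_list_def less_Suc_eq scalar_prod_def numeral_2_eq_2)
qed

section \<open>Relations among classes of binary forms [p, q]\<close>

definition bf :: "'a \<Rightarrow> 'a \<Rightarrow> 'a witt" where
  "bf p q = witt (binary_form p q)"

lemma bf_comm: "bf p q = bf q p"
  unfolding bf_def
  by (intro witt_isometric nonsingular_binary_form isometric2I[where a = 0 and b = 1 and c = 1 and d = 0])
    (auto simp: qeval_binary_form_vec2 algebra_simps)

lemma bf_scale: "t \<noteq> 0 \<Longrightarrow> bf (p * t\<^sup>2) q = bf p (q * t\<^sup>2)"
  unfolding bf_def
  by (intro witt_isometric nonsingular_binary_form isometric2I[where a = t and b = 0 and c = 0 and d = "1 / t"])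
    (auto simp: qeval_binary_form_vec2 power_mult_distrib power_divide)

text \<open>Substitute (X, x X + Y) for (X, Y); the extra mixed term 2 q x X Y vanishes.\<close>

lemma bf_shift: "bf (p + x + q * x\<^sup>2) q = bf p q"
  unfolding bf_def
  by (intro witt_isometric nonsingular_binary_form isometric2I[where a = 1 and b = 0 and c = x and d = 1])
    (auto simp: qeval_binary_form_vec2 power2_eq_square algebra_simps char2_simps)

lemma bf_zero: "bf 0 q = 0"
proof -
  have "binary_form 0 0 = (hyperbolic 1 :: 'a mat)"
    by (intro eq_matI) (auto simp: binary_form_def hyperbolic_def mat_of_rows_list_def less_2_cases_iff)
  then have "bf 0 0 = 0" unfolding bf_def
    using witt_hyperbolic[of 1] nonsingular_binary_form[of 0 0] by simp
  moreover have "bf 0 q = bf 0 0"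
    using bf_shift[of q q 0] by (simp add: add_self bf_comm[of 0 q])
  ultimately show ?thesis by simp
qed

text \<open>If (e, f) and (e', f') are symplectic bases of the two planes, then (e + e', f) and (e',
  f + f') are again orthogonal symplectic pairs. \<open>P\<close> is this change of basis, an
  involution in characteristic 2.\<close>

lemma bf_add: "bf p q + bf p' q' = bf (p + p') q + bf p' (q + q')"
proof -
  define P :: "'a mat" where "P = four_block_mat (1\<^sub>m 2) (mat_of_rows_list 2 [[0, 0], [0, 1]])
    (mat_of_rows_list 2 [[1, 0], [0, 0]]) (1\<^sub>m 2)"
  have Pc: "P \<in> carrier_mat (2 + 2) (2 + 2)"
    unfolding P_def by (intro four_block_carrier_mat mat2_carrier) auto
  have P: "P *\<^sub>v (vec2 x y @\<^sub>v vec2 z w) = vec2 x (y + w) @\<^sub>v vec2 (x + z) w" for x y z w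
  proof -
    have v: "vec2 a b + vec2 c d = vec2 (a + c) (b + (d :: 'a))" for a b c d
      by (intro vec2_eqI) (simp_all add: carrier_vecD[OF vec2_carrier])
    show ?thesis unfolding P_def
      by (subst four_block_mat_mult_vec[OF one_carrier_mat mat2_carrier mat2_carrier one_carrier_mat])
        (simp_all add: mat2_mult_vec v)
  qed
  have "binary_form (p + p') q \<bottom>\<^sub>q binary_form p' (q + q') \<cong>\<^sub>q binary_form p q \<bottom>\<^sub>q binary_form p' q'"
  proof (rule isometricI[OF orth_sum_carrier[OF binary_form_carrier binary_form_carrier]
        orth_sum_carrier[OF binary_form_carrier binary_form_carrier] Pc Pc])
    fix u :: "'a vec" assume "u \<in> carrier_vec (2 + 2)"
    then obtain v v' where "v \<in> carrier_vec 2" "v' \<in> carrier_vec 2" and u0: "u = v @\<^sub>v v'"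
      by (rule append_cases)
    then obtain x y z w where u: "u = vec2 x y @\<^sub>v vec2 z w" by (metis vec2E)
    show "P *\<^sub>v (P *\<^sub>v u) = u" by (simp only: u P) (simp add: add.assoc char2_simps add.commute)
    show "qeval (binary_form p q \<bottom>\<^sub>q binary_form p' q') (P *\<^sub>v u) =
        qeval (binary_form (p + p') q \<bottom>\<^sub>q binary_form p' (q + q')) u"
      unfolding u P
      by (simp only: qeval_orth_sum[OF binary_form_carrier binary_form_carrier vec2_carrier vec2_carrier]
          qeval_binary_form_vec2) (simp add: power2_eq_square algebra_simps char2_simps)
  qed
  then show ?thesis unfolding bf_def
    by (simp add: witt_orth_sum[symmetric] nonsingular_binary_form witt_isometric[OF _ _ isometric_sym] nonsingular_orth_sum)
qed

text \<open>The class of \<open>d [1, b] = [d, b / d]\<close>.\<close>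

definition sbf :: "'a \<Rightarrow> 'a \<Rightarrow> 'a witt" where
  "sbf d b = bf d (b / d)"

lemma witt_smult_binary_form:
  assumes "d \<noteq> 0" shows "witt (d \<cdot>\<^sub>m binary_form 1 b) = sbf d b"
  unfolding sbf_def bf_def
proof (intro witt_isometric nonsingular_smult nonsingular_binary_form assms)
  show "d \<cdot>\<^sub>m binary_form 1 b \<cong>\<^sub>q binary_form d (b / d)"
    using assms
    by (intro isometric2I[where a = 1 and b = 0 and c = 0 and d = d])
      (auto simp: qeval_binary_form_vec2 qeval_smult_mat[OF binary_form_carrier vec2_carrier]
        power2_eq_square algebra_simps)
qed

text \<open>In \<open>bf_add\<close> with p = p' = d the first summand becomes [0, b / d], which is
  hyperbolic.\<close>

lemma sbf_add: "sbf d b + sbf d b' = sbf d (b + b')"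
  using bf_add[of d "b / d" d "b' / d"] by (simp add: sbf_def add_self bf_zero add_divide_distrib)

lemma sbf_square: "t \<noteq> 0 \<Longrightarrow> sbf (d * t\<^sup>2) b = sbf d b"
  using bf_scale[of t d "b / (d * t\<^sup>2)"] by (simp add: sbf_def)

text \<open>\<open>bf_shift\<close> after division by d: the quadratic slot matters only modulo
  Artin-Schreier elements.\<close>

lemma sbf_shift:
  assumes "d \<noteq> 0" shows "sbf d (b + x + x\<^sup>2) = sbf d b"
proof -
  have "bf (b / d + x / d + d * (x / d)\<^sup>2) d = bf (b / d) d" by (rule bf_shift)
  moreover have "b / d + x / d + d * (x / d)\<^sup>2 = (b + x + x\<^sup>2) / d"
    using assms by (simp add: power2_eq_square add_divide_distrib)
  ultimately show ?thesis by (simp add: sbf_def bf_comm)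
qed

text \<open>Nonzero values of the norm form [1, b] are similarity factors of it. This is the base
  case of roundness, \<open>wpf_norm\<close>.\<close>

lemma sbf_norm:
  assumes d: "d \<noteq> 0" and e: "e = x\<^sup>2 + x * y + b * y\<^sup>2" "e \<noteq> 0"
  shows "sbf (d * e) b = sbf d b"
proof (cases "x = 0")
  case True
  then have e': "e = b * y\<^sup>2" and nz: "y \<noteq> 0" "b \<noteq> 0" using e by auto
  have "sbf (d * e) b = sbf (d * b) b" using sbf_square[of y "d * b" b] nz by (simp add: e' mult.assoc)
  also have "\<dots> = sbf (b / d) b"
    using sbf_square[OF d, of "b / d" b] d by (simp add: power2_eq_square mult.commute)
  also have "\<dots> = sbf d b" using nz d by (simp add: sbf_def bf_comm)
  finally show ?thesis .
next
  case False
  \<comment> \<open>Chosen so that \<open>bf_shift\<close> turns d x^2 into d e.\<close>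
  let ?t = "d * x * y"
  have "sbf d b = sbf (d * x\<^sup>2) b" using sbf_square[OF False, of d b] by simp
  also have "\<dots> = bf (d * x\<^sup>2 + ?t + b / (d * x\<^sup>2) * ?t\<^sup>2) (b / (d * x\<^sup>2))"
    unfolding sbf_def by (rule bf_shift[symmetric])
  also have "d * x\<^sup>2 + ?t + b / (d * x\<^sup>2) * ?t\<^sup>2 = d * e"
    using d False by (simp add: e power2_eq_square algebra_simps)
  also have "b / (d * x\<^sup>2) = (b * e / x\<^sup>2) / (d * e)"
    using d False e(2) by simp
  also have "bf (d * e) \<dots> = sbf (d * e) (b * e / x\<^sup>2)" by (simp add: sbf_def)
  \<comment> \<open>The new slot differs from b by the Artin-Schreier element of b y / x.\<close>
  also have "b * e / x\<^sup>2 = b + b * y / x + (b * y / x)\<^sup>2"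
    using False by (simp add: e(1) power2_eq_square add_divide_distrib algebra_simps)
  also have "sbf (d * e) \<dots> = sbf (d * e) b" using d e(2) by (intro sbf_shift) simp
  finally show ?thesis ..
qed

text \<open>b is the value of [1, b] at (0, 1); equivalently \<langle>\<langle>b, b]] = 0.\<close>

lemma sbf_mult_self: "d \<noteq> 0 \<Longrightarrow> b \<noteq> 0 \<Longrightarrow> sbf (d * b) b = sbf d b"
  by (rule sbf_norm[where x = 0 and y = 1]) auto

text \<open>The relation \<langle>u, v\<rangle> = \<langle>u + v, u v (u + v)\<rangle> of diagonal
  bilinear forms, tensored with [1, b]. It takes two applications of \<open>bf_add\<close>, the
  second with the slots swapped.\<close>

lemma sbf_bilinear:
  assumes u: "u \<noteq> 0" and v: "v \<noteq> 0" and uv: "u + v \<noteq> 0"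
  shows "sbf u b + sbf v b = sbf (u + v) b + sbf (u * v * (u + v)) b"
proof -
  \<comment> \<open>Rescaling by \<open>?t\<close> turns the slot of the second form into the
    summand that completes b / u to b / (u + v).\<close>
  let ?w = "u + v" and ?t = "v / (u + v)"
  have "sbf u b + sbf v b = bf ?w (b / u) + bf v (b / u + b / v)"
    unfolding sbf_def by (rule bf_add)
  also have "b / u + b / v = b * ?w / (u * v)" using u v by (simp add: field_simps)
  also have "bf v \<dots> = bf (v * (1 / ?t)\<^sup>2 * ?t\<^sup>2) (b * ?w / (u * v))"
    using v uv by (simp add: power_divide)
  also have "\<dots> = bf (v * (1 / ?t)\<^sup>2) (b * ?w / (u * v) * ?t\<^sup>2)" using v uv by (intro bf_scale) simp
  also have "v * (1 / ?t)\<^sup>2 = ?w\<^sup>2 / v" using v uv by (simp add: power2_eq_square)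
  also have "b * ?w / (u * v) * ?t\<^sup>2 = b * v / (u * ?w)"
    using u v uv by (simp add: power2_eq_square)
  also have "bf ?w (b / u) + bf (?w\<^sup>2 / v) (b * v / (u * ?w)) =
      bf (b / u) ?w + bf (b * v / (u * ?w)) (?w\<^sup>2 / v)" by (simp add: bf_comm)
  also have "\<dots> = bf (b / u + b * v / (u * ?w)) ?w + bf (b * v / (u * ?w)) (?w + ?w\<^sup>2 / v)" by (rule bf_add)
  also have "b / u + b * v / (u * ?w) = b / ?w"
  proof -
    have "b / u + b * v / (u * ?w) = (b * ?w + b * v) / (u * ?w)"
      using u uv by (simp add: add_divide_distrib)
    also have "b * ?w + b * v = b * u" by (simp add: distrib_left add.assoc add_self)
    finally show ?thesis using u by simp
  qed
  also have "?w + ?w\<^sup>2 / v = u * ?w / v"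
  proof -
    have "?w + ?w\<^sup>2 / v = ?w * (v + ?w) / v" using v by (simp add: power2_eq_square field_simps)
    also have "v + ?w = u" by (simp add: add.commute[of u] char2_simps)
    finally show ?thesis by (simp add: mult.commute)
  qed
  also have "bf (b * v / (u * ?w)) (u * ?w / v) = sbf (u * ?w / v) b"
    using v by (simp add: sbf_def bf_comm)
  also have "\<dots> = sbf (u * v * ?w) b"
    using sbf_square[OF v, of "u * ?w / v" b] v by (simp add: power2_eq_square mult_ac)
  also have "bf (b / ?w) ?w = sbf ?w b" by (simp add: sbf_def bf_comm)
  finally show ?thesis .
qed

text \<open>Write the right side as [d \<beta>, \<gamma> / (d \<beta>)] +
  [d \<gamma>^2, \<gamma> / (d \<gamma>^2)]; then \<open>bf_add\<close> produces the scale d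
  (\<beta> + \<gamma>^2). Rescaling by \<gamma>^2 sets the case \<gamma> = 0 apart.\<close>

lemma sbf_exchange:
  assumes d: "d \<noteq> 0" and b: "\<beta> \<noteq> 0" "\<beta> + \<gamma>\<^sup>2 \<noteq> 0"
  shows "sbf d (\<gamma> * (\<beta> + \<gamma>\<^sup>2) / \<beta>) + sbf (d * (\<beta> + \<gamma>\<^sup>2)) (\<gamma> * (\<beta> + \<gamma>\<^sup>2) / \<beta>) =
    sbf d \<gamma> + sbf (d * \<beta>) \<gamma>"
proof (cases "\<gamma> = 0")
  case True
  then show ?thesis by (simp add: sbf_def bf_comm[of _ 0] bf_zero)
next
  case g: False
  let ?b = "\<beta> + \<gamma>\<^sup>2" let ?c = "\<gamma> * ?b / \<beta>"
  have "sbf d \<gamma> + sbf (d * \<beta>) \<gamma> = bf (d * \<beta>) (\<gamma> / (d * \<beta>)) + sbf (d * \<gamma>\<^sup>2) \<gamma>"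
    using sbf_square[OF g, of d \<gamma>] by (simp add: sbf_def add.commute)
  also have "\<dots> = bf (d * \<beta> + d * \<gamma>\<^sup>2) (\<gamma> / (d * \<beta>)) + bf (d * \<gamma>\<^sup>2) (\<gamma> / (d * \<beta>) + \<gamma> / (d * \<gamma>\<^sup>2))"
    unfolding sbf_def by (rule bf_add)
  also have "d * \<beta> + d * \<gamma>\<^sup>2 = d * ?b" by (simp add: distrib_left)
  \<comment> \<open>This equation is where the value of \<open>?c\<close> comes from.\<close>
  also have "\<gamma> / (d * \<beta>) = ?c / (d * ?b)" using b d by (simp add: mult_ac)
  also have "?c / (d * ?b) + \<gamma> / (d * \<gamma>\<^sup>2) = ?c / (d * \<gamma>\<^sup>2)"
  proof -
    have "?c / (d * ?b) = \<gamma> / (d * \<beta>)" using b d by (simp add: mult_ac)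
    moreover have "?c = \<gamma> * \<gamma>\<^sup>2 / \<beta> + \<gamma>"
      using b by (simp add: distrib_left add_divide_distrib add.commute)
    ultimately show ?thesis using g d b by (simp add: add_divide_distrib mult_ac)
  qed
  also have "bf (d * ?b) (?c / (d * ?b)) + bf (d * \<gamma>\<^sup>2) (?c / (d * \<gamma>\<^sup>2)) = sbf (d * ?b) ?c + sbf d ?c"
    using sbf_square[OF g, of d ?c] by (simp add: sbf_def)
  finally show ?thesis by (simp add: add.commute)
qed

text \<open>[1, \<gamma>^2] and [1, \<gamma>] agree by the Artin-Schreier shift, and the added
  \<beta> contributes \<langle>\<langle>\<beta>, \<beta>]] = 0.\<close>

lemma sbf_quadratic_slot:
  assumes d: "d \<noteq> 0" and b: "\<beta> \<noteq> 0"
  shows "sbf d (\<beta> + \<gamma>\<^sup>2) + sbf (d * \<beta>) (\<beta> + \<gamma>\<^sup>2) = sbf d \<gamma> + sbf (d * \<beta>) \<gamma>"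
proof -
  have "sbf t (\<beta> + \<gamma>\<^sup>2) = sbf t \<beta> + sbf t \<gamma>" if "t \<noteq> 0" for t
    using sbf_shift[OF that, of \<gamma> \<gamma>] by (simp add: sbf_add[symmetric] add_self bf_zero)
  then show ?thesis
    using d b by (simp add: sbf_mult_self add_ac witt_add_self_left)
qed

section \<open>Witt classes of Pfister forms\<close>

text \<open>The scale d is an argument because \<open>wpf_Cons\<close> splits a form into a shorter
  one at the scales d and d a. The identities for \<open>sbf\<close> lift along this recursion by
  induction with d arbitrary.\<close>

definition wpf :: "'a list \<Rightarrow> 'a \<Rightarrow> 'a \<Rightarrow> 'a witt" where
  "wpf as d b = witt (d \<cdot>\<^sub>m pf as b)"

lemma nonsingular_pf: "0 \<notin> set as \<Longrightarrow> nonsingular (pf as b :: 'a mat)"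
  by (induction as) (auto simp: pf_Cons nonsingular_binary_form nonsingular_orth_sum nonsingular_smult)

lemma wpf_Nil: "d \<noteq> 0 \<Longrightarrow> wpf [] d b = sbf d (b :: 'a)"
  by (simp add: wpf_def witt_smult_binary_form)

lemma wpf_Cons:
  assumes "a \<noteq> 0" "0 \<notin> set as" "d \<noteq> 0"
  shows "wpf (a # as) d b = wpf as d b + wpf as (d * a) (b :: 'a)"
proof -
  have "d \<cdot>\<^sub>m pf (a # as) b = (d \<cdot>\<^sub>m pf as b) \<bottom>\<^sub>q ((d * a) \<cdot>\<^sub>m pf as b)"
    using pf_carrier[of as b] by (simp add: pf_Cons smult_orth_sum[OF _ smult_carrier_mat] smult_smult_mat)
  then show ?thesis using assms by (simp add: wpf_def witt_orth_sum nonsingular_smult nonsingular_pf)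
qed

lemma wpf_add: "0 \<notin> set as \<Longrightarrow> d \<noteq> 0 \<Longrightarrow> wpf as d b + wpf as d b' = wpf as d (b + b' :: 'a)"
proof (induction as arbitrary: d)
  case (Cons a as)
  then have "wpf as d b + wpf as d b' = wpf as d (b + b')"
    "wpf as (d * a) b + wpf as (d * a) b' = wpf as (d * a) (b + b')" by auto
  then show ?case using Cons.prems by (simp add: wpf_Cons add_ac)
qed (simp add: wpf_Nil sbf_add)

lemma wpf_square: "0 \<notin> set as \<Longrightarrow> d \<noteq> 0 \<Longrightarrow> t \<noteq> 0 \<Longrightarrow> wpf as (d * t\<^sup>2) b = wpf as d (b :: 'a)"
proof (induction as arbitrary: d)
  case (Cons a as)
  then have "wpf as (d * t\<^sup>2) b = wpf as d b" "wpf as (d * a * t\<^sup>2) b = wpf as (d * a) b" by auto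
  then show ?case using Cons.prems by (simp add: wpf_Cons mult_ac)
qed (simp add: wpf_Nil sbf_square)

lemma wpf_mult_self: "0 \<notin> set as \<Longrightarrow> d \<noteq> 0 \<Longrightarrow> b \<noteq> 0 \<Longrightarrow> wpf as (d * b) b = wpf as d (b :: 'a)"
proof (induction as arbitrary: d)
  case (Cons a as)
  then have "wpf as (d * b) b = wpf as d b" "wpf as (d * a * b) b = wpf as (d * a) b" by auto
  then show ?case using Cons.prems by (simp add: wpf_Cons mult_ac)
qed (simp add: wpf_Nil sbf_mult_self)

lemma wpf_bilinear:
  "0 \<notin> set as \<Longrightarrow> u \<noteq> 0 \<Longrightarrow> v \<noteq> 0 \<Longrightarrow> u + v \<noteq> 0 \<Longrightarrow>
    wpf as u b + wpf as v b = wpf as (u + v) b + wpf as (u * v * (u + v)) (b :: 'a)"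
proof (induction as arbitrary: u v)
  case (Cons a as)
  have a: "a \<noteq> 0" "0 \<notin> set as" using Cons.prems by auto
  have nz: "u * a + v * a \<noteq> 0" using a Cons.prems by (simp flip: distrib_right)
  have "wpf as u b + wpf as v b = wpf as (u + v) b + wpf as (u * v * (u + v)) b"
    using Cons by auto
  \<comment> \<open>Scaling u and v by a multiplies u v (u + v) by a^3, from which a^2 is then
    dropped.\<close>
  moreover have "wpf as (u * a) b + wpf as (v * a) b =
      wpf as ((u + v) * a) b + wpf as (u * v * (u + v) * a * a\<^sup>2) b"
    using Cons.IH[of "u * a" "v * a"] Cons.prems a nz by (simp add: power2_eq_square algebra_simps)
  moreover have "wpf as (u * v * (u + v) * a * a\<^sup>2) b = wpf as (u * v * (u + v) * a) b"
    using Cons.prems a by (intro wpf_square) auto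
  ultimately show ?case using Cons.prems a by (simp add: wpf_Cons add_ac)
qed (simp add: wpf_Nil sbf_bilinear)

lemma add_swap_pairs:
  fixes a :: "'b::ab_semigroup_add"
  shows "a + b = c + d \<Longrightarrow> a' + b' = c' + d' \<Longrightarrow> (a + a') + (b + b') = (c + c') + (d + d')"
  by (metis add.assoc add.left_commute)

text \<open>\<open>\<langle>\<langle>\<beta>, \<gamma>]] = \<langle>\<langle>b, c]]\<close> for \<open>b = \<beta> + \<gamma>\<^sup>2\<close> and \<open>c = \<gamma> b / \<beta>\<close>.\<close>

lemma wpf_exchange:
  assumes b: "\<beta> \<noteq> 0" "\<beta> + \<gamma>\<^sup>2 \<noteq> 0"
  shows "0 \<notin> set as \<Longrightarrow> d \<noteq> 0 \<Longrightarrow>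
    wpf as d (\<gamma> * (\<beta> + \<gamma>\<^sup>2) / \<beta>) + wpf as (d * (\<beta> + \<gamma>\<^sup>2)) (\<gamma> * (\<beta> + \<gamma>\<^sup>2) / \<beta>) =
    wpf as d \<gamma> + wpf as (d * \<beta>) (\<gamma> :: 'a)"
proof (induction as arbitrary: d)
  case (Cons a as)
  define e c where "e = \<beta> + \<gamma>\<^sup>2" and "c = \<gamma> * (\<beta> + \<gamma>\<^sup>2) / \<beta>"
  have "wpf as d c + wpf as (d * e) c = wpf as d \<gamma> + wpf as (d * \<beta>) \<gamma>"
    "wpf as (d * a) c + wpf as (d * e * a) c = wpf as (d * a) \<gamma> + wpf as (d * \<beta> * a) \<gamma>"
    using Cons.IH[of d] Cons.IH[of "d * a"] Cons.prems unfolding e_def c_def by (auto simp: mult_ac)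
  then have "(wpf as d c + wpf as (d * a) c) + (wpf as (d * e) c + wpf as (d * e * a) c) =
      (wpf as d \<gamma> + wpf as (d * a) \<gamma>) + (wpf as (d * \<beta>) \<gamma> + wpf as (d * \<beta> * a) \<gamma>)"
    by (rule add_swap_pairs)
  then show ?case using Cons.prems b unfolding c_def[symmetric] unfolding e_def[symmetric] by (simp add: wpf_Cons)
qed (use b in \<open>simp add: wpf_Nil sbf_exchange\<close>)

lemma wpf_quadratic_slot:
  assumes b: "\<beta> \<noteq> 0"
  shows "0 \<notin> set as \<Longrightarrow> d \<noteq> 0 \<Longrightarrow>
    wpf as d (\<beta> + \<gamma>\<^sup>2) + wpf as (d * \<beta>) (\<beta> + \<gamma>\<^sup>2) = wpf as d \<gamma> + wpf as (d * \<beta>) (\<gamma> :: 'a)"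
proof (induction as arbitrary: d)
  case (Cons a as)
  define e where "e = \<beta> + \<gamma>\<^sup>2"
  have "wpf as d e + wpf as (d * \<beta>) e = wpf as d \<gamma> + wpf as (d * \<beta>) \<gamma>"
    "wpf as (d * a) e + wpf as (d * \<beta> * a) e = wpf as (d * a) \<gamma> + wpf as (d * \<beta> * a) \<gamma>"
    using Cons.IH[of d] Cons.IH[of "d * a"] Cons.prems unfolding e_def by (auto simp: mult_ac)
  then have "(wpf as d e + wpf as (d * a) e) + (wpf as (d * \<beta>) e + wpf as (d * \<beta> * a) e) =
      (wpf as d \<gamma> + wpf as (d * a) \<gamma>) + (wpf as (d * \<beta>) \<gamma> + wpf as (d * \<beta> * a) \<gamma>)"
    by (rule add_swap_pairs)
  then show ?case using Cons.prems b unfolding e_def[symmetric] by (simp add: wpf_Cons)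
qed (use b in \<open>simp add: wpf_Nil sbf_quadratic_slot\<close>)

section \<open>Roundness, isotropy and similarity of Pfister forms\<close>

lemma qeval_pf_Cons:
  assumes "v \<in> carrier_vec (2 ^ length as * 2)" "w \<in> carrier_vec (2 ^ length as * 2)"
  shows "qeval (pf (a # as) b) (v @\<^sub>v w) = qeval (pf as b) v + a * qeval (pf as b) (w :: 'a vec)"
  unfolding pf_Cons using assms pf_carrier[of as b]
  by (subst qeval_orth_sum[of _ "2 ^ length as * 2" _ "2 ^ length as * 2"]) (auto simp: qeval_smult_mat)

text \<open>Pfister forms are round. A value is f + a g with values f, g of the shorter form
  \<sigma>; if f and g are nonzero, then \<langle>1, a\<rangle>\<sigma> = \<langle>f, a
  g\<rangle>\<sigma> = \<langle>f + a g, (f + a g) a f g\<rangle>\<sigma> = (f + a g)\<langle>1,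
  a\<rangle>\<sigma>.\<close>

lemma wpf_norm:
  assumes "0 \<notin> set as" "d \<noteq> 0" "u \<in> carrier_vec (2 ^ length as * 2)" "qeval (pf as b) u \<noteq> 0"
  shows "wpf as (d * qeval (pf as b) u) b = wpf as d (b :: 'a)"
  using assms
proof (induction as arbitrary: d u)
  case Nil
  then obtain x y where u: "u = vec2 x y" using vec2E by auto
  show ?case using Nil sbf_norm[of d _ x y b] by (simp add: wpf_Nil u qeval_binary_form_vec2)
next
  case (Cons a as)
  let ?n = "2 ^ length as * 2 :: nat" and ?P = "pf as b"
  have a: "a \<noteq> 0" "0 \<notin> set as" using Cons.prems by auto
  have "u \<in> carrier_vec (?n + ?n)" using Cons.prems by (simp add: mult_2 mult.commute)
  then obtain v w where v: "v \<in> carrier_vec ?n" and w: "w \<in> carrier_vec ?n" and u: "u = v @\<^sub>v w"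
    by (rule append_cases)
  define f g where "f = qeval ?P v" and "g = qeval ?P w"
  have e: "qeval (pf (a # as) b) u = f + a * g" unfolding u f_def g_def by (rule qeval_pf_Cons[OF v w])
  have nz: "f + a * g \<noteq> 0" using Cons.prems e by simp
  have f: "wpf as (t * f) b = wpf as t b" if "f \<noteq> 0" "t \<noteq> 0" for t
    using Cons.IH[of t v] a v that by (simp add: f_def)
  have g: "wpf as (t * g) b = wpf as t b" if "g \<noteq> 0" "t \<noteq> 0" for t
    using Cons.IH[of t w] a w that by (simp add: g_def)
  have "wpf as (d * (f + a * g)) b + wpf as (d * (f + a * g) * a) b = wpf as d b + wpf as (d * a) b"
  proof -
    consider "g = 0" "f \<noteq> 0" | "f = 0" "g \<noteq> 0" | "f \<noteq> 0" "g \<noteq> 0" using nz by (cases "f = 0"; cases "g = 0") auto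
    then show ?thesis
    proof cases
      case 1
      have "wpf as (d * a * f) b = wpf as (d * a) b" using a Cons.prems 1 by (intro f) auto
      then show ?thesis using 1 f[of d] Cons.prems by (simp add: mult_ac)
    next
      \<comment> \<open>Multiplication by a g swaps the two summands, up to the square a^2.\<close>
      case 2
      have "wpf as (d * a * g) b = wpf as (d * a) b" using a Cons.prems 2 by (intro g) auto
      moreover have "wpf as (d * g * a\<^sup>2) b = wpf as (d * g) b"
        using a Cons.prems 2 by (intro wpf_square) auto
      moreover have "wpf as (d * g) b = wpf as d b" using Cons.prems 2 by (intro g) auto
      ultimately show ?thesis using 2 by (simp add: power2_eq_square mult_ac add.commute)
    next
      case 3
      have "wpf as d b + wpf as (d * a) b = wpf as (d * f) b + wpf as (d * a * g) b"
        using 3 a Cons.prems by (simp add: f g)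
      also have "\<dots> = wpf as (d * f + d * a * g) b + wpf as (d * f * (d * a * g) * (d * f + d * a * g)) b"
      proof (rule wpf_bilinear)
        show "d * f + d * a * g \<noteq> 0" using nz Cons.prems by (simp add: mult.assoc flip: distrib_left)
      qed (use 3 a Cons.prems in auto)
      also have "d * f + d * a * g = d * (f + a * g)" by (simp add: algebra_simps)
      also have "d * f * (d * a * g) * (d * (f + a * g)) = d * (f + a * g) * a * f * g * d\<^sup>2"
        by (simp add: power2_eq_square mult_ac)
      also have "wpf as \<dots> b = wpf as (d * (f + a * g) * a * f * g) b"
        using 3 a Cons.prems nz by (intro wpf_square) auto
      also have "\<dots> = wpf as (d * (f + a * g) * a * f) b" using 3 a Cons.prems nz by (intro g) auto
      also have "\<dots> = wpf as (d * (f + a * g) * a) b" using 3 a Cons.prems nz by (intro f) auto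
      finally show ?thesis ..
    qed
  qed
  then show ?case unfolding e using a Cons.prems nz by (simp add: wpf_Cons)
qed

text \<open>Isotropic Pfister forms are hyperbolic. For the shorter form \<sigma>, if f = a g is
  nonzero, roundness identifies \<sigma> with a \<sigma> and the two cancel; otherwise \<sigma> is
  itself isotropic.\<close>

lemma wpf_isotropic:
  assumes "0 \<notin> set as" "d \<noteq> 0" "u \<in> carrier_vec (2 ^ length as * 2)" "u \<noteq> 0\<^sub>v (2 ^ length as * 2)"
    "qeval (pf as b) u = 0"
  shows "wpf as d (b :: 'a) = 0"
  using assms
proof (induction as arbitrary: d u)
  case Nil
  then obtain x y where u: "u = vec2 x y" using vec2E by auto
  have q: "x\<^sup>2 + x * y + b * y\<^sup>2 = 0" using Nil by (simp add: u qeval_binary_form_vec2)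
  have y: "y \<noteq> 0"
  proof
    assume "y = 0"
    then have "u = vec2 0 0" using q u by simp
    moreover have "0\<^sub>v 2 = vec2 0 (0 :: 'a)" by (rule vec2_eqI) auto
    ultimately show False using Nil by simp
  qed
  have "x\<^sup>2 + x * y = b * y\<^sup>2" using q by (simp add: add_eq_zero_iff)
  then have "b = (x\<^sup>2 + x * y) / y\<^sup>2" using y by simp
  \<comment> \<open>The isotropic vector exhibits b as an Artin-Schreier element.\<close>
  also have "\<dots> = 0 + x / y + (x / y)\<^sup>2" using y by (simp add: power2_eq_square add_divide_distrib add.commute)
  finally have "sbf d b = sbf d 0" using sbf_shift[OF Nil.prems(2), of 0 "x / y"] by simp
  then show ?case using Nil by (simp add: wpf_Nil sbf_def bf_comm[of d 0] bf_zero)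
next
  case (Cons a as)
  let ?n = "2 ^ length as * 2 :: nat" and ?P = "pf as b"
  have a: "a \<noteq> 0" "0 \<notin> set as" using Cons.prems by auto
  have u': "u \<in> carrier_vec (?n + ?n)" "u \<noteq> 0\<^sub>v (?n + ?n)"
    using Cons.prems by (simp_all add: mult_2 mult.commute)
  from u'(1) obtain v w where v: "v \<in> carrier_vec ?n" and w: "w \<in> carrier_vec ?n" and u: "u = v @\<^sub>v w"
    by (rule append_cases)
  define f g where "f = qeval ?P v" and "g = qeval ?P w"
  have e: "f + a * g = 0" using Cons.prems qeval_pf_Cons[OF v w] by (simp add: u f_def g_def)
  show ?case
  proof (cases "f = 0")
    case True
    then have g: "g = 0" using e a by simp
    have "v \<noteq> 0\<^sub>v ?n \<or> w \<noteq> 0\<^sub>v ?n"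
    proof (rule ccontr)
      assume "\<not> ?thesis"
      then have "u = 0\<^sub>v (?n + ?n)" unfolding u by (intro eq_vecI) auto
      then show False using u' by blast
    qed
    then have "wpf as t b = 0" if "t \<noteq> 0" for t
      using Cons.IH[of t v] Cons.IH[of t w] that a v w True g by (auto simp: f_def g_def)
    then show ?thesis using Cons.prems a by (simp add: wpf_Cons)
  next
    case False
    have fg: "f = a * g" using e by (simp add: add_eq_zero_iff)
    then have g: "g \<noteq> 0" using False by auto
    have "wpf as (d * a) b = wpf as (d * a * g) b"
      unfolding g_def using Cons.prems a w g by (intro wpf_norm[symmetric]) (auto simp: g_def)
    also have "d * a * g = d * f" by (simp add: fg)
    also have "wpf as \<dots> b = wpf as d b"
      unfolding f_def using Cons.prems a v False by (intro wpf_norm) (auto simp: f_def)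
    finally show ?thesis using Cons.prems a by (simp add: wpf_Cons witt_add_self)
  qed
qed

lemma wpf_scale:
  assumes "wpf as d b = wpf as' d' (b' :: 'a)" "0 \<notin> set as" "0 \<notin> set as'" "d \<noteq> 0" "d' \<noteq> 0" "t \<noteq> 0"
  shows "wpf as (t * d) b = wpf as' (t * d') b'"
  using witt_smult_cong[OF assms(1)[unfolded wpf_def], of t] assms(2-)
  by (simp add: wpf_def nonsingular_smult nonsingular_pf smult_smult_mat)

text \<open>Similar Pfister forms are isometric, here for Witt classes. The orthogonal sum of the
  two scaled forms is Witt trivial, hence isotropic; an isotropic vector yields a common value, and
  roundness moves both forms to that scale.\<close>

lemma wpf_similar:
  assumes eq: "wpf as d b = wpf as' d' (b' :: 'a)" and len: "length as = length as'"
    and as: "0 \<notin> set as" "0 \<notin> set as'" and d: "d \<noteq> 0" "d' \<noteq> 0" and t: "t \<noteq> 0"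
  shows "wpf as t b = wpf as' t b'"
proof -
  define n :: nat where "n = 2 ^ length as * 2"
  let ?P = "pf as b" and ?P' = "pf as' b'"
  have P: "?P \<in> carrier_mat n n" "?P' \<in> carrier_mat n n"
    unfolding n_def using pf_carrier[of as b] pf_carrier[of as' b'] len by simp_all
  let ?Q = "(d \<cdot>\<^sub>m ?P) \<bottom>\<^sub>q (d' \<cdot>\<^sub>m ?P')"
  have ns: "nonsingular (d \<cdot>\<^sub>m ?P)" "nonsingular (d' \<cdot>\<^sub>m ?P')"
    using as d by (simp_all add: nonsingular_smult nonsingular_pf)
  have Q: "nonsingular ?Q" "?Q \<in> carrier_mat (n + n) (n + n)" using ns P by (auto simp: nonsingular_orth_sum)
  have "witt ?Q = 0" using eq ns by (simp add: witt_orth_sum wpf_def witt_add_self)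
  moreover have "0 < n + n" by (simp add: n_def)
  ultimately obtain z where z: "z \<in> carrier_vec (n + n)" "z \<noteq> 0\<^sub>v (n + n)" "qeval ?Q z = 0"
    using isotropic_if_witt_zero[OF Q] by blast
  from z(1) obtain v w where v: "v \<in> carrier_vec n" and w: "w \<in> carrier_vec n" and zvw: "z = v @\<^sub>v w"
    by (rule append_cases)
  have "d * qeval ?P v + d' * qeval ?P' w = 0"
    using z(3) P v w by (simp add: zvw qeval_orth_sum[of _ n _ n] qeval_smult_mat[of _ n])
  then have vw: "d * qeval ?P v = d' * qeval ?P' w" by (simp add: add_eq_zero_iff)
  have to_t: "wpf as t b = wpf as' t b'" if "wpf as s b = wpf as' s b'" "s \<noteq> 0" for s
    using wpf_scale[OF that(1) as that(2) that(2), of "t / s"] that t by simp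
  show ?thesis
  proof (cases "qeval ?P v = 0")
    \<comment> \<open>A common value 0 makes one of the two forms isotropic, hence trivial, and by
      \<open>eq\<close> the other one is trivial too.\<close>
    case True
    then have w0: "qeval ?P' w = 0" using vw d by simp
    have "v \<noteq> 0\<^sub>v n \<or> w \<noteq> 0\<^sub>v n"
    proof (rule ccontr)
      assume "\<not> ?thesis"
      then have "z = 0\<^sub>v (n + n)" unfolding zvw by (intro eq_vecI) auto
      then show False using z by blast
    qed
    then consider "\<forall>s. s \<noteq> 0 \<longrightarrow> wpf as s b = 0" | "\<forall>s. s \<noteq> 0 \<longrightarrow> wpf as' s b' = 0"
      using True w0 v w as len wpf_isotropic[of as _ v b] wpf_isotropic[of as' _ w b'] by (auto simp: n_def)
    then show ?thesis
    proof cases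
      case 1
      then have "wpf as' d' b' = 0" using eq d by simp
      then have "wpf as d' b = wpf as' d' b'" using 1 d by simp
      then show ?thesis by (rule to_t) (rule d)
    next
      case 2
      then have "wpf as d b = wpf as' d b'" using eq d by simp
      then show ?thesis by (rule to_t) (rule d)
    qed
  next
    case False
    then have w0: "qeval ?P' w \<noteq> 0" using vw d by auto
    have "wpf as (d * qeval ?P v) b = wpf as d b"
      using False v as d by (intro wpf_norm) (auto simp: n_def)
    moreover have "wpf as' (d' * qeval ?P' w) b' = wpf as' d' b'"
      using w0 w as d len by (intro wpf_norm) (auto simp: n_def)
    ultimately have "wpf as (d * qeval ?P v) b = wpf as' (d * qeval ?P v) b'" using eq vw by simp
    then show ?thesis by (rule to_t) (use False d in simp)
  qed
qed

lemma wpf_isometric: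
  "pf as b \<cong>\<^sub>q pf as' b' \<Longrightarrow> 0 \<notin> set as \<Longrightarrow> 0 \<notin> set as' \<Longrightarrow> t \<noteq> 0 \<Longrightarrow> wpf as t b = wpf as' t (b' :: 'a)"
  unfolding wpf_def by (intro witt_isometric isometric_smult nonsingular_smult nonsingular_pf)

section \<open>Linkage\<close>

lemma witt_add_cancel:
  fixes u :: "'a witt"
  assumes "u + v = u' + v'" "u + w = u' + w'" shows "v + w = v' + w'"
proof -
  have "v + w = (u + v) + (u + w)" by (simp add: add_ac witt_add_self_left)
  also have "\<dots> = (u' + v') + (u' + w')" by (simp only: assms)
  also have "\<dots> = v' + w'" by (simp add: add_ac witt_add_self_left)
  finally show ?thesis .
qed

text \<open>In the notation of the overview, \<open>\<kappa>\<close> lists the slots of \<rho> and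
  \<open>pf \<mu> m\<close> is \<psi>.\<close>

context
  fixes \<kappa> \<mu> :: "'a list" and m :: 'a
  assumes nz: "0 \<notin> set \<kappa>" "0 \<notin> set \<mu>" and len: "length \<kappa> = length \<mu>"
begin

text \<open>Up to squares \<langle>d, d'\<rangle> = d \<langle>1, d d'\<rangle>, so
  \<open>eq\<close> is a similarity of Pfister forms, and \<open>wpf_similar\<close> frees it from
  its scale.\<close>

lemma wpf_similar_sum:
  assumes eq: "wpf \<kappa> d e + wpf \<kappa> d' e = wpf \<mu> f m + wpf \<mu> f' m"
    and d: "d \<noteq> 0" "d' \<noteq> 0" "f \<noteq> 0" "f' \<noteq> 0" and t: "t \<noteq> 0"
  shows "wpf \<kappa> t e + wpf \<kappa> (t * (d * d')) e = wpf \<mu> t m + wpf \<mu> (t * (f * f')) m"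
proof -
  have *: "wpf \<nu> (x * (x * y)) z = wpf \<nu> y z" if "0 \<notin> set \<nu>" "x \<noteq> 0" "y \<noteq> 0" for \<nu> x y z
    using wpf_square[OF that(1,3,2), of z] by (simp add: power2_eq_square mult_ac)
  have "wpf (d * d' # \<kappa>) d e = wpf (f * f' # \<mu>) f m"
    using eq d nz by (simp add: wpf_Cons *)
  then have "wpf (d * d' # \<kappa>) t e = wpf (f * f' # \<mu>) t m"
    using d nz len t by (intro wpf_similar[of _ d e _ f]) auto
  then show ?thesis using d nz t by (simp add: wpf_Cons)
qed

text \<open>
  If \<open>\<langle>\<langle>a\<rangle>\<rangle>\<rho> = \<langle>\<langle>x\<rangle>\<rangle>\<psi>\<close> and \<open>\<langle>\<langle>b\<rangle>\<rangle>\<rho> = \<langle>\<langle>z\<rangle>\<rangle>\<psi>\<close>, then \<open>\<langle>\<langle>a b\<rangle>\<rangle>\<rho>\<close> and \<open>\<langle>\<langle>x z\<rangle>\<rangle>\<psi>\<close> are similar, hence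
  isometric; so \<open>\<langle>\<langle>a, b\<rangle>\<rangle>\<rho> = \<langle>\<langle>x, z\<rangle>\<rangle>\<psi>\<close>.
\<close>

lemma wpf_linked_product:
  assumes a: "\<And>t. t \<noteq> 0 \<Longrightarrow> wpf \<kappa> t e + wpf \<kappa> (t * a) e = wpf \<mu> t m + wpf \<mu> (t * x) m"
    and b: "\<And>t. t \<noteq> 0 \<Longrightarrow> wpf \<kappa> t e + wpf \<kappa> (t * b) e = wpf \<mu> t m + wpf \<mu> (t * z) m"
    and n: "a \<noteq> 0" "b \<noteq> 0" "x \<noteq> 0" "z \<noteq> 0" and t: "t \<noteq> 0"
  shows "wpf \<kappa> t e + wpf \<kappa> (t * a) e + (wpf \<kappa> (t * b) e + wpf \<kappa> (t * (a * b)) e) =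
    wpf \<mu> t m + wpf \<mu> (t * x) m + (wpf \<mu> (t * z) m + wpf \<mu> (t * (x * z)) m)"
proof -
  have "wpf \<kappa> a e + wpf \<kappa> b e = wpf \<mu> x m + wpf \<mu> z m"
    using witt_add_cancel[OF a[of 1] b[of 1]] by simp
  from wpf_similar_sum[OF this n t]
  have "wpf \<kappa> t e + wpf \<kappa> (t * (a * b)) e = wpf \<mu> t m + wpf \<mu> (t * (x * z)) m" .
  from witt_add_cancel[OF b[OF t] this] a[OF t] show ?thesis by simp
qed

lemma wpf_separably_linked:
  assumes \<alpha>: "\<alpha> \<noteq> 0" and \<beta>: "\<beta> \<noteq> 0" and b: "b = \<beta> + \<gamma>\<^sup>2" "b \<noteq> 0" and c: "c = \<gamma> * b / \<beta>"
    and xyz: "x \<noteq> 0" "y \<noteq> 0" "z \<noteq> 0"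
    and 1: "\<And>t. t \<noteq> 0 \<Longrightarrow> wpf (\<alpha> # \<kappa>) t b = wpf (x # \<mu>) t m"
    and 2: "\<And>t. t \<noteq> 0 \<Longrightarrow> wpf (\<alpha> # \<kappa>) t c = wpf (y # \<mu>) t m"
    and 3: "\<And>t. t \<noteq> 0 \<Longrightarrow> wpf (b # \<kappa>) t c = wpf (z # \<mu>) t m"
    and t: "t \<noteq> 0"
  shows "wpf (\<alpha> # \<beta> # \<kappa>) t \<gamma> = 0"
proof -
  \<comment> \<open>\<open>k s e\<close> is the class of s \<rho> [1, e] and \<open>p s\<close> that
    of s \<psi>. A slot a becomes the sum over the scales s and s a.\<close>
  define k where "k s e = wpf \<kappa> s e" for s e
  define p where "p s = wpf \<mu> s m" for s
  note fold = k_def[symmetric] p_def[symmetric]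
  have h1: "k s b + k (s * \<alpha>) b = p s + p (s * x)" if "s \<noteq> 0" for s
    using 1[OF that] that nz \<alpha> xyz by (simp add: wpf_Cons fold)
  have h2: "k s c + k (s * \<alpha>) c = p s + p (s * y)" if "s \<noteq> 0" for s
    using 2[OF that] that nz \<alpha> xyz by (simp add: wpf_Cons fold)
  have h3: "k s c + k (s * b) c = p s + p (s * z)" if "s \<noteq> 0" for s
    using 3[OF that] that nz b(2) xyz by (simp add: wpf_Cons fold)
  have slot: "k s b + k (s * \<beta>) b = k s \<gamma> + k (s * \<beta>) \<gamma>" if "s \<noteq> 0" for s
    using wpf_quadratic_slot[OF \<beta> nz(1) that, of \<gamma>] by (simp add: b(1) fold)
  have exch: "k s c + k (s * b) c = k s \<gamma> + k (s * \<beta>) \<gamma>" if "s \<noteq> 0" for s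
    using wpf_exchange[OF \<beta> _ nz(1) that, of \<gamma>] b by (simp add: c fold)
  have self: "k (s * b) b = k s b" if "s \<noteq> 0" for s
    using wpf_mult_self[OF nz(1) that b(2)] by (simp add: fold)
  have add: "k s b + k s c = k s (b + c)" if "s \<noteq> 0" for s
    using wpf_add[OF nz(1) that] by (simp add: fold)
  define \<pi> where "\<pi> s = k s \<gamma> + k (s * \<beta>) \<gamma> + (k (s * \<alpha>) \<gamma> + k (s * \<alpha> * \<beta>) \<gamma>)" for s
  have \<pi>: "wpf (\<alpha> # \<beta> # \<kappa>) t \<gamma> = \<pi> t"
    using t nz \<alpha> \<beta> by (simp add: wpf_Cons fold \<pi>_def)
  \<comment> \<open>\<pi> is read as \<langle>\<langle>\<alpha>, \<beta>, b]]\<rho>, so that the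
    first and third forms share the quadratic slot b.\<close>
  have i13: "\<pi> t = p t + p (t * x) + (p (t * z) + p (t * (x * z)))"
  proof -
    have h: "k s b + k (s * \<beta>) b = p s + p (s * z)" if "s \<noteq> 0" for s
      using slot[OF that] exch[OF that] h3[OF that] by simp
    have "\<pi> t = k t b + k (t * \<beta>) b + (k (t * \<alpha>) b + k (t * \<alpha> * \<beta>) b)"
      unfolding \<pi>_def using slot[of t] slot[of "t * \<alpha>"] t \<alpha> by simp
    also have "\<dots> = k t b + k (t * \<alpha>) b + (k (t * \<beta>) b + k (t * (\<alpha> * \<beta>)) b)"
      by (simp add: add_ac mult.assoc)
    also have "\<dots> = p t + p (t * x) + (p (t * z) + p (t * (x * z)))"
      using wpf_linked_product[of b \<alpha> x \<beta> z t] h1 h \<alpha> \<beta> xyz t unfolding fold by blast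
    finally show ?thesis .
  qed
  \<comment> \<open>\<pi> is read as \<langle>\<langle>\<alpha>, b, c]]\<rho>, to compare the second
    and third forms.\<close>
  have pc: "\<pi> t = k t c + k (t * \<alpha>) c + (k (t * b) c + k (t * (\<alpha> * b)) c)"
    unfolding \<pi>_def using exch[of t] exch[of "t * \<alpha>"] t \<alpha> by (simp add: add_ac mult.assoc)
  have i23: "\<pi> t = p t + p (t * y) + (p (t * z) + p (t * (y * z)))"
    using pc wpf_linked_product[of c \<alpha> y b z t] h2 h3 \<alpha> b(2) xyz t unfolding fold by metis
  have s12: "k s (b + c) + k (s * \<alpha>) (b + c) = p (s * x) + p (s * y)" if "s \<noteq> 0" for s
  proof -
    have "k s (b + c) + k (s * \<alpha>) (b + c) = (k s b + k (s * \<alpha>) b) + (k s c + k (s * \<alpha>) c)"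
      using that \<alpha> add[of s] add[of "s * \<alpha>"] by (simp add: add_ac)
    then show ?thesis using h1[OF that] h2[OF that] by (simp add: add_ac witt_add_self_left)
  qed
  have h12: "k s (b + c) + k (s * \<alpha>) (b + c) = p s + p (s * (x * y))" if "s \<noteq> 0" for s
    using wpf_similar_sum[of 1 "b + c" \<alpha> x y s] s12[of 1] \<alpha> xyz that unfolding fold by simp
  \<comment> \<open>This is \<langle>\<langle>x, y\<rangle>\<rangle>\<psi> = 0 at the scale
    s.\<close>
  have i12: "p s + p (s * (x * y)) = p (s * x) + p (s * y)" if "s \<noteq> 0" for s
    using s12[OF that] h12[OF that] by simp
  \<comment> \<open>By \<langle>\<langle>b, b]] = 0 the third form also has the quadratic slot b +
    c.\<close>
  have h3': "k s (b + c) + k (s * b) (b + c) = p s + p (s * z)" if "s \<noteq> 0" for s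
  proof -
    have "k s (b + c) + k (s * b) (b + c) = (k s b + k (s * b) b) + (k s c + k (s * b) c)"
      using that b(2) add[of s] add[of "s * b"] by (simp add: add_ac)
    then show ?thesis using h3[OF that] self[OF that] by (simp add: witt_add_self)
  qed
  have "\<pi> t = k t (b + c) + k (t * \<alpha>) (b + c) + (k (t * b) (b + c) + k (t * (\<alpha> * b)) (b + c))"
  proof -
    have "k (t * (\<alpha> * b)) b = k (t * \<alpha>) b" using self[of "t * \<alpha>"] t \<alpha> by (simp add: mult.assoc)
    moreover have "k (t * b) b = k t b" using self[OF t] .
    ultimately show ?thesis unfolding pc
      using t \<alpha> b(2) by (simp add: add[symmetric] add_ac witt_add_self_left)
  qed
  also have "\<dots> = p t + p (t * (x * y)) + (p (t * z) + p (t * (x * y * z)))"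
    using wpf_linked_product[of "b + c" \<alpha> "x * y" b z t] h12 h3' \<alpha> b(2) xyz t unfolding fold by simp
  also have "\<dots> = p (t * x) + p (t * y) + (p t + p (t * z)) + (p t + p (t * (x * y * z)))"
    using i12[OF t] by (simp add: add_ac witt_add_self_left)
  finally have i: "\<pi> t = \<dots>" .
  have z: "p (t * z) + p (t * (x * y * z)) = p (t * (x * z)) + p (t * (y * z))"
    using i12[of "t * z"] t xyz by (simp add: mult_ac)
  \<comment> \<open>Three copies of \<pi> amount to one. After cancellation their expansions leave
    \<langle>\<langle>x, y\<rangle>\<rangle>\<psi> scaled by t z, which is 0 by
    \<open>i12\<close>.\<close>
  have "\<pi> t = \<pi> t + (\<pi> t + \<pi> t)" by (simp add: witt_add_self)
  also have "\<dots> = (p (t * x) + p (t * y) + (p t + p (t * z)) + (p t + p (t * (x * y * z)))) +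
      ((p t + p (t * x) + (p (t * z) + p (t * (x * z)))) + (p t + p (t * y) + (p (t * z) + p (t * (y * z)))))"
    using i i13 i23 by metis
  also have "\<dots> = (p (t * z) + p (t * (x * y * z))) + (p (t * (x * z)) + p (t * (y * z)))"
    by (simp add: add_ac witt_add_self witt_add_self_left)
  also have "\<dots> = 0" unfolding z by (rule witt_add_self)
  finally show ?thesis using \<pi> by simp
qed

end

lemma wpf_inseparably_linked:
  assumes nz: "0 \<notin> set \<kappa>" "0 \<notin> set \<mu>" and len: "length \<mu> = Suc (length \<kappa>)"
    and \<alpha>: "\<alpha> \<noteq> 0" and \<beta>: "\<beta> \<noteq> 0" and b: "b = \<beta> + \<gamma>\<^sup>2" "b \<noteq> 0" and c: "c = \<gamma> * b / \<beta>"
    and 1: "\<And>t. t \<noteq> 0 \<Longrightarrow> wpf (\<alpha> # \<kappa>) t b = wpf \<mu> t m"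
    and 3: "\<And>t. t \<noteq> 0 \<Longrightarrow> wpf (b # \<kappa>) t c = wpf \<mu> t m'"
    and t: "t \<noteq> 0"
  shows "wpf (\<alpha> # \<beta> # \<kappa>) t (\<gamma> :: 'a) = 0"
proof -
  define k where "k s = wpf \<kappa> s b" for s
  have h1: "k s + k (s * \<alpha>) = wpf \<mu> s m" if "s \<noteq> 0" for s
    using 1[OF that] that nz \<alpha> by (simp add: wpf_Cons k_def)
  \<comment> \<open>The third form is \<langle>\<langle>\<beta>, b]]\<rho>:
    \<open>wpf_exchange\<close> turns the slots b, c into \<beta>, \<gamma>, and
    \<open>wpf_quadratic_slot\<close> turns \<gamma> into b.\<close>
  have h3: "k s + k (s * \<beta>) = wpf \<mu> s m'" if "s \<noteq> 0" for s
    using 3[OF that] that nz b wpf_exchange[OF \<beta> _ nz(1) that, of \<gamma>]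
      wpf_quadratic_slot[OF \<beta> nz(1) that, of \<gamma>] by (simp add: wpf_Cons k_def c)
  have sum: "k (s * \<alpha>) + k (s * \<beta>) = wpf \<mu> s (m + m')" if "s \<noteq> 0" for s
  proof -
    have "k (s * \<alpha>) + k (s * \<beta>) = (k s + k (s * \<alpha>)) + (k s + k (s * \<beta>))"
      by (simp add: add_ac witt_add_self_left)
    then show ?thesis using wpf_add[OF nz(2) that] h1[OF that] h3[OF that] by simp
  qed
  \<comment> \<open>Up to the square of \<alpha>, \<langle>\<alpha>, \<beta>\<rangle> is
    \<alpha>\<langle>1, \<alpha>\<beta>\<rangle>.\<close>
  have "k (\<alpha> * (\<alpha> * \<beta>)) = k \<beta>"
    using wpf_square[OF nz(1) \<beta> \<alpha>, of b] by (simp add: k_def power2_eq_square mult_ac)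
  then have "wpf (\<alpha> * \<beta> # \<kappa>) \<alpha> b = wpf \<mu> 1 (m + m')"
    using sum[of 1] nz \<alpha> \<beta> by (simp add: wpf_Cons k_def)
  \<comment> \<open>With the factor \<alpha> removed, comparison with \<open>sum\<close> makes the
    four summands of \<pi> cancel.\<close>
  then have "wpf (\<alpha> * \<beta> # \<kappa>) t b = wpf \<mu> t (m + m')"
    using nz len \<alpha> \<beta> t by (intro wpf_similar[of _ \<alpha> b _ 1]) auto
  then have "k t + k (t * (\<alpha> * \<beta>)) = k (t * \<alpha>) + k (t * \<beta>)"
    using sum[OF t] nz \<alpha> \<beta> t by (simp add: wpf_Cons k_def)
  moreover have "wpf (\<alpha> # \<beta> # \<kappa>) t \<gamma> = k t + k (t * \<beta>) + (k (t * \<alpha>) + k (t * \<alpha> * \<beta>))"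
    using wpf_quadratic_slot[OF \<beta> nz(1), of _ \<gamma>] t nz \<alpha> \<beta> b(1) by (simp add: wpf_Cons k_def)
  ultimately have "wpf (\<alpha> # \<beta> # \<kappa>) t \<gamma> =
      (k (t * \<alpha>) + k (t * \<beta>)) + (k t + k (t * (\<alpha> * \<beta>)))" by (simp add: add_ac mult.assoc)
  also have "\<dots> = 0" using \<open>k t + k (t * (\<alpha> * \<beta>)) = _\<close> by (simp add: witt_add_self)
  finally show ?thesis .
qed

end

section \<open>Reduction of the linkage definitions to slots\<close>

lemma is_quad_pfister_pf:
  "Suc (length as) = n \<Longrightarrow> 0 \<notin> set as \<Longrightarrow> is_quad_pfister n (pf as b)"
  unfolding is_quad_pfister_def pf_def[symmetric] using isometric_refl[OF pf_carrier] by blast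

lemma is_quad_pfisterE:
  assumes "is_quad_pfister n Q"
  obtains as b where "Suc (length as) = n" "0 \<notin> set as" "Q \<cong>\<^sub>q pf as b"
  using assms unfolding is_quad_pfister_def pf_def by blast

text \<open>\<open>kron_isometric\<close> replaces each \<open>B\<close> and the common
  \<open>R\<close> by standard forms; the single \<open>R\<close> supplies one \<open>\<mu>\<close>
  and one \<open>m\<close> for the whole list.\<close>

lemma separably_linkedE:
  assumes "separably_linked n Qs"
  obtains \<mu> m where "Suc (length \<mu>) = n - 1" "0 \<notin> set \<mu>" "\<forall>Q\<in>set Qs. \<exists>x. x \<noteq> 0 \<and> Q \<cong>\<^sub>q pf (x # \<mu>) m"
proof -
  from assms obtain R Bs where R: "is_quad_pfister (n - 1) R" and Bs: "list_all (is_bil_pfister 1) Bs"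
    and QB: "list_all2 (\<lambda>Q B. Q \<cong>\<^sub>q B \<otimes>\<^sub>k R) Qs Bs" unfolding separably_linked_def by blast
  from R obtain \<mu> m where \<mu>: "Suc (length \<mu>) = n - 1" "0 \<notin> set \<mu>" "R \<cong>\<^sub>q pf \<mu> m" by (rule is_quad_pfisterE)
  show ?thesis
  proof (rule that[OF \<mu>(1,2)], rule ballI)
    fix Q assume "Q \<in> set Qs"
    with QB obtain B where "B \<in> set Bs" and B: "Q \<cong>\<^sub>q B \<otimes>\<^sub>k R"
      by (metis in_set_conv_nth list_all2_conv_all_nth)
    with Bs have "is_bil_pfister 1 B" by (simp add: list_all_iff)
    then obtain as where as: "transpose_mat B = B" "length as = 1" "0 \<notin> set as" "B \<cong>\<^sub>b bil_pfister as"
      unfolding is_bil_pfister_def by blast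
    then obtain x where x: "as = [x]" by (auto simp: length_Suc_conv)
    have "B \<otimes>\<^sub>k R \<cong>\<^sub>q bil_pfister [x] \<otimes>\<^sub>k pf \<mu> m" using as x \<mu> by (intro kron_isometric) auto
    also have "\<dots> = pf (x # \<mu>) m" by (simp add: pf_def kron_assoc kron_one_left del: One_nat_def)
    finally show "\<exists>x. x \<noteq> 0 \<and> Q \<cong>\<^sub>q pf (x # \<mu>) m" using B isometric_trans as x by auto
  qed
qed

lemma inseparably_linkedE:
  assumes "inseparably_linked n Qs"
  obtains \<mu> where "length \<mu> = n - 1" "0 \<notin> set \<mu>" "\<forall>Q\<in>set Qs. \<exists>m. Q \<cong>\<^sub>q pf \<mu> m"
proof -
  from assms obtain B Rs where B: "is_bil_pfister (n - 1) B" and Rs: "list_all (is_quad_pfister 1) Rs"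
    and QR: "list_all2 (\<lambda>Q R. Q \<cong>\<^sub>q B \<otimes>\<^sub>k R) Qs Rs" unfolding inseparably_linked_def by blast
  from B obtain \<mu> where \<mu>: "transpose_mat B = B" "length \<mu> = n - 1" "0 \<notin> set \<mu>" "B \<cong>\<^sub>b bil_pfister \<mu>"
    unfolding is_bil_pfister_def by blast
  show ?thesis
  proof (rule that[OF \<mu>(2,3)], rule ballI)
    fix Q assume "Q \<in> set Qs"
    with QR obtain R where "R \<in> set Rs" and R: "Q \<cong>\<^sub>q B \<otimes>\<^sub>k R"
      by (metis in_set_conv_nth list_all2_conv_all_nth)
    with Rs have "is_quad_pfister 1 R" by (simp add: list_all_iff)
    then obtain m where "R \<cong>\<^sub>q binary_form 1 m" by (auto elim!: is_quad_pfisterE)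
    then have "B \<otimes>\<^sub>k R \<cong>\<^sub>q pf \<mu> m" unfolding pf_def using \<mu> by (intro kron_isometric) auto
    then show "\<exists>m. Q \<cong>\<^sub>q pf \<mu> m" using R isometric_trans by blast
  qed
qed

section \<open>Vanishing of the generators in degree n + 1\<close>

theorem theorem3p3:
  fixes n :: nat
  assumes "CHAR('a::field) = 2"
    and "n \<ge> 3"
    and "\<And>Q1 Q2 Q3 :: 'a mat.
           is_quad_pfister n Q1 \<Longrightarrow> is_quad_pfister n Q2 \<Longrightarrow> is_quad_pfister n Q3 \<Longrightarrow>
           separably_linked n [Q1, Q2, Q3] \<or> inseparably_linked n [Q1, Q2, Q3]"
  shows "(I_q (n + 1) :: 'a mat set set) = {\<one>\<^bsub>witt_group\<^esub>}"
proof -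
  interpret char_two "TYPE('a)" by unfold_locales (rule assms(1))
  interpret comm_group "witt_group :: 'a mat set monoid" by (rule comm_group_witt_group)
  have vanish: "wpf (\<alpha> # \<beta> # \<kappa>) t \<gamma> = 0"
    if \<kappa>: "Suc (Suc (length \<kappa>)) = n" "0 \<notin> set \<kappa>" and \<alpha>: "\<alpha> \<noteq> 0" and \<beta>: "\<beta> \<noteq> 0" and t: "t \<noteq> 0"
    for \<alpha> \<beta> \<gamma> t :: 'a and \<kappa>
  proof -
    define b where "b = \<beta> + \<gamma>\<^sup>2"
    define c where "c = \<gamma> * b / \<beta>"
    show ?thesis
    proof (cases "b = 0")
      \<comment> \<open>\<open>b\<close> can be a bilinear slot only if it is nonzero. For b = 0,
        \<beta> is a square and \<langle>\<langle>\<beta>, \<gamma>]]\<rho> is the sum of two equal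
        classes.\<close>
      case True
      then have \<gamma>: "\<beta> = \<gamma>\<^sup>2" "\<gamma> \<noteq> 0" using \<beta> by (auto simp: b_def add_eq_zero_iff)
      have "wpf (\<beta> # \<kappa>) s \<gamma> = 0" if "s \<noteq> 0" for s
        using that \<gamma> \<kappa>(2) by (simp add: wpf_Cons wpf_square witt_add_self)
      then show ?thesis using \<kappa> \<alpha> \<beta> t by (subst wpf_Cons) auto
    next
      case b: False
      let ?Q1 = "pf (\<alpha> # \<kappa>) b" and ?Q2 = "pf (\<alpha> # \<kappa>) c" and ?Q3 = "pf (b # \<kappa>) c"
      have nz: "0 \<notin> set (\<alpha> # \<kappa>)" "0 \<notin> set (b # \<kappa>)" using \<kappa> \<alpha> b by auto
      have "is_quad_pfister n ?Q1" "is_quad_pfister n ?Q2" "is_quad_pfister n ?Q3"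
        using \<kappa> nz by (auto intro!: is_quad_pfister_pf)
      then consider "separably_linked n [?Q1, ?Q2, ?Q3]" | "inseparably_linked n [?Q1, ?Q2, ?Q3]"
        using assms(3) by blast
      then show ?thesis
      proof cases
        case 1
        then obtain \<mu> m where \<mu>: "Suc (length \<mu>) = n - 1" "0 \<notin> set \<mu>"
          and iso: "\<forall>Q\<in>set [?Q1, ?Q2, ?Q3]. \<exists>x. x \<noteq> 0 \<and> Q \<cong>\<^sub>q pf (x # \<mu>) m"
          by (rule separably_linkedE)
        from iso obtain x y z where xyz: "x \<noteq> 0" "y \<noteq> 0" "z \<noteq> 0"
          and i: "?Q1 \<cong>\<^sub>q pf (x # \<mu>) m" "?Q2 \<cong>\<^sub>q pf (y # \<mu>) m" "?Q3 \<cong>\<^sub>q pf (z # \<mu>) m" by auto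
        show ?thesis
          by (rule wpf_separably_linked[OF \<kappa>(2) \<mu>(2) _ \<alpha> \<beta> b_def b c_def xyz _ _ _ t])
            (use \<kappa> \<mu> nz xyz in \<open>auto intro!: wpf_isometric i\<close>)
      next
        case 2
        then obtain \<mu> where \<mu>: "length \<mu> = n - 1" "0 \<notin> set \<mu>"
          and iso: "\<forall>Q\<in>set [?Q1, ?Q2, ?Q3]. \<exists>m. Q \<cong>\<^sub>q pf \<mu> m"
          by (rule inseparably_linkedE)
        from iso obtain m m'
          where i: "?Q1 \<cong>\<^sub>q pf \<mu> m" "?Q3 \<cong>\<^sub>q pf \<mu> m'" by auto
        show ?thesis
          by (rule wpf_inseparably_linked[OF \<kappa>(2) \<mu>(2) _ \<alpha> \<beta> b_def b c_def _ _ t])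
            (use \<kappa> \<mu> nz in \<open>auto intro!: wpf_isometric i\<close>)
      qed
    qed
  qed
  have "witt_class (c \<cdot>\<^sub>m Q) = \<one>\<^bsub>witt_group\<^esub>"
    if c: "c \<noteq> 0" and Q: "is_quad_pfister (n + 1) Q" for c and Q :: "'a mat"
  proof -
    from Q obtain as g where as: "Suc (length as) = n + 1" "0 \<notin> set as" and iso: "Q \<cong>\<^sub>q pf as g"
      by (rule is_quad_pfisterE)
    \<comment> \<open>\<open>as\<close> has length n, at least 3, so two slots can be split
      off.\<close>
    from as assms(2) obtain \<alpha> \<beta> \<kappa> where *: "as = \<alpha> # \<beta> # \<kappa>"
      by (cases as; cases "tl as") auto
    have "wpf as c g = 0" unfolding * using as * c by (intro vanish) auto
    moreover have "nonsingular Q" using nonsingular_isometric[OF iso nonsingular_pf[OF as(2)]] .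
    ultimately have z: "witt (c \<cdot>\<^sub>m Q) = witt (0\<^sub>m 0 0)" "nonsingular (c \<cdot>\<^sub>m Q)"
      using witt_isometric[OF _ _ isometric_smult[OF iso]] as c
      by (simp_all add: nonsingular_smult nonsingular_pf wpf_def witt_zero_mat)
    then show ?thesis by (simp add: witt_one witt_class_eq_iff witt_eq_iff nonsingular_zero)
  qed
  then have "{witt_class (c \<cdot>\<^sub>m Q) | c Q. c \<noteq> 0 \<and> is_quad_pfister (n + 1) Q} \<subseteq> {\<one>\<^bsub>witt_group :: 'a mat set monoid\<^esub>}"
    by blast
  from mono_generate[OF this] show ?thesis
    unfolding I_q_def using generate.one by (auto simp: generate_one)
qed

end
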